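(* Let $\mathbf{P}$ be an operad with $\mathbf{P}(0)=(0)$ and all $\mathbf{P}(n)$ finite-dimensional. 1. Let $\Delta_*$ be the unique algebra morphism $T(\mathbf{P}^* )\to T(\mathbf{P}^* )\otimes T(\mathbf{P}^* )$ (for the concatenation product $m_{conc}$) such that $\Delta_*(f)=\delta(f)$ for all $f\in\mathbf{P}^*$. Then $\mathbf{D}^*_{\mathbf{P}}=(T(\mathbf{P}^* ),m_{conc},\Delta_* )$ is a bialgebra. It is graded, the elements of $\mathbf{P}^*(n)$ being homogeneous of degree $n-1$ for all $n\ge1$. 2. There exists a nondegenerate pairing $\ll-,-\gg:T(\mathbf{P}^* )\otimes T(\mathbf{P})\to K$ such that for all $F,G\in T(\mathbf{P}^* )$ and $X,Y\in T(\mathbf{P})$: $$\ll1,X\gg=\varepsilon(X),\qquad\ll F\otimes G,\Delta_{dec}(X)\gg=\ll FG,X\gg,$$ $$\ll F,1\gg=\varepsilon(F),\qquad\ll\Delta_*(F),X\otimes Y\gg=\ll F,X*Y\gg.$$ In other words, $\ll-,-\gg$ is a Hopf pairing between $\mathbf{D}^*_{\mathbf{P}}$ and $\mathbf{D}_{\mathbf{P}}=(T(\mathbf{P}),*,\Delta_{dec})$.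
   Context: $K$ is a field of characteristic zero, $\mathbf{P}=\bigoplus_{n\ge1}\mathbf{P}(n)$, $\mathbf{P}^*=\bigoplus_{n\ge1}\mathbf{P}(n)^*$, $\mathbf{P}^*(n)=\mathbf{P}(n)^*$. The operadic composition is a map $\circ:\bigoplus_n\mathbf{P}(n)\otimes\mathbf{P}^{\otimes n}\to\mathbf{P}$; $\delta:\mathbf{P}^*\to\mathbf{P}^*\otimes T(\mathbf{P}^* )$ is its transpose: for $f\in\mathbf{P}^*(n)$, $\delta(f)\in\bigoplus_{p=1}^n\bigoplus_{k_1+\cdots+k_p=n}\mathbf{P}^*(p)\otimes\mathbf{P}^*(k_1)\cdots\mathbf{P}^*(k_p)$ is determined by $\delta(f)(q\otimes q_1\cdots q_p)=f(q\circ(q_1,\ldots,q_p))$. $\Delta_{dec}$ is deconcatenation, $\varepsilon$ denotes counits (on $T(\mathbf{P}^* )$: the algebra morphism with $\varepsilon(f)=f(I)$ for $f\in\mathbf{P}^*(1)$ and $0$ on $\mathbf{P}^*(n)$, $n\ge2$, where $I$ is the operadic unit). The product $*$ on $T(\mathbf{P})$ is, for $x_1,\ldots,x_k\in\mathbf{P}$, $v$ a tensor in $T(\mathbf{P})$, $x_1\cdots x_k*v=\sum_{v=v_1\cdots v_{2k+1}}v_1\langle x_1,v_2\rangle v_3\cdots v_{2k-1}\langle x_k,v_{2k}\rangle v_{2k+1}$ (factorizations into possibly empty words), with $\langle p,p_1\cdots p_k\rangle=\sum_{1\le i_1<\cdots<i_k\le n}p\circ_{i_1,\ldots,i_k}(p_1,\ldots,p_k)$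 for $p\in\mathbf{P}(n)$, where $p_l$ is inserted in position $i_l$ and $I$ in the other positions. *)

theory Defs
  imports Complex_Main "HOL-Library.Function_Algebras"
begin

section \<open>Vector spaces of functions and their tensor products\<close>

text \<open>
  The tensor products and tensor algebras below are formed from spaces of scalar-valued functions
  (subspaces of \<open>'i \<Rightarrow> 'k\<close>). The elementary tensor of \<open>a\<close> and \<open>b\<close> is the function
  \<open>(i, j) \<mapsto> a i * b j\<close>, and the tensor product of \<open>A\<close> and \<open>B\<close> is the span of the elementary
  tensors. Over a field this is a model of the algebraic tensor product: elementary tensors are
  bilinear, they span, and there are no further relations (lemma \<open>tensor_no_relations\<close>).
\<close>

definition fscale :: "'k::field \<Rightarrow> ('i \<Rightarrow> 'k) \<Rightarrow> 'i \<Rightarrow> 'k" where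
  "fscale c f = (\<lambda>i. c * f i)"

global_interpretation fs: vector_space fscale
  by unfold_locales (auto simp: fscale_def fun_eq_iff algebra_simps)

definition linear_on ::
  "('k::field \<Rightarrow> 'a::ab_group_add \<Rightarrow> 'a) \<Rightarrow> ('k \<Rightarrow> 'b::ab_group_add \<Rightarrow> 'b) \<Rightarrow> 'a set \<Rightarrow> 'b set \<Rightarrow> ('a \<Rightarrow> 'b) \<Rightarrow> bool"
where
  "linear_on s1 s2 A B f \<longleftrightarrow>
     (\<forall>x\<in>A. f x \<in> B) \<and>
     (\<forall>x\<in>A. \<forall>y\<in>A. f (x + y) = f x + f y) \<and>
     (\<forall>c. \<forall>x\<in>A. f (s1 c x) = s2 c (f x))"

abbreviation flinear :: "('i \<Rightarrow> 'k::field) set \<Rightarrow> ('j \<Rightarrow> 'k) set \<Rightarrow> (('i \<Rightarrow> 'k) \<Rightarrow> 'j \<Rightarrow> 'k) \<Rightarrow> bool" where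
  "flinear \<equiv> linear_on fscale fscale"

abbreviation functional_on :: "('i \<Rightarrow> 'k::field) set \<Rightarrow> (('i \<Rightarrow> 'k) \<Rightarrow> 'k) \<Rightarrow> bool" where
  "functional_on A \<equiv> linear_on fscale (*) A UNIV"

definition tensor :: "('i \<Rightarrow> 'k::field) \<Rightarrow> ('j \<Rightarrow> 'k) \<Rightarrow> 'i \<times> 'j \<Rightarrow> 'k" (infix "\<otimes>" 75) where
  "a \<otimes> b = (\<lambda>(i, j). a i * b j)"

definition tens :: "('i \<Rightarrow> 'k::field) set \<Rightarrow> ('j \<Rightarrow> 'k) set \<Rightarrow> ('i \<times> 'j \<Rightarrow> 'k) set" where
  "tens A B = fs.span {a \<otimes> b | a b. a \<in> A \<and> b \<in> B}"

lemma tensor_no_relations: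
  assumes "finite S" "fs.independent S" "(\<Sum>b\<in>S. a b \<otimes> b) = 0" "b \<in> S"
  shows "a b = 0"
proof (rule ext)
  fix i
  have sum_app: "(\<Sum>b\<in>T. g b) x = (\<Sum>b\<in>T. g b x)" for T and g :: "_ \<Rightarrow> _ \<Rightarrow> 'b" and x
    by (induction T rule: infinite_finite_induct) auto
  have "(\<Sum>b\<in>S. fscale (a b i) b) = 0"
  proof (rule ext)
    fix j
    have "(\<Sum>b\<in>S. a b \<otimes> b) (i, j) = 0"
      using assms(3) by simp
    then have "(\<Sum>b\<in>S. a b i * b j) = 0"
      by (simp add: sum_app tensor_def)
    moreover have "(\<Sum>b\<in>S. fscale (a b i) b) j = (\<Sum>b\<in>S. a b i * b j)"
      by (induction S rule: infinite_finite_induct) (auto simp: fscale_def)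
    ultimately show "(\<Sum>b\<in>S. fscale (a b i) b) j = 0 j"
      by simp
  qed
  then show "a b i = 0 i"
    using fs.independentD[OF assms(2,1) order_refl, of "\<lambda>b. a b i"] assms(4) by simp
qed

text \<open>The maps \<open>f \<otimes> g\<close>, \<open>\<phi> \<otimes> id\<close> and \<open>id \<otimes> \<psi>\<close> for linear maps \<open>f, g\<close> and functionals \<open>\<phi>, \<psi>\<close>.\<close>

definition tmap ::
  "(('i \<Rightarrow> 'k::field) \<Rightarrow> 'm \<Rightarrow> 'k) \<Rightarrow> (('j \<Rightarrow> 'k) \<Rightarrow> 'n \<Rightarrow> 'k) \<Rightarrow> ('i \<times> 'j \<Rightarrow> 'k) \<Rightarrow> 'm \<times> 'n \<Rightarrow> 'k"
where
  "tmap f g t = (\<lambda>(m, n). f (\<lambda>i. g (\<lambda>j. t (i, j)) n) m)"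

definition contract_left :: "(('i \<Rightarrow> 'k::field) \<Rightarrow> 'k) \<Rightarrow> ('i \<times> 'j \<Rightarrow> 'k) \<Rightarrow> 'j \<Rightarrow> 'k" where
  "contract_left \<phi> t = (\<lambda>j. \<phi> (\<lambda>i. t (i, j)))"

definition contract_right :: "(('j \<Rightarrow> 'k::field) \<Rightarrow> 'k) \<Rightarrow> ('i \<times> 'j \<Rightarrow> 'k) \<Rightarrow> 'i \<Rightarrow> 'k" where
  "contract_right \<psi> t = (\<lambda>i. \<psi> (\<lambda>j. t (i, j)))"

definition tassoc :: "(('i \<times> 'j) \<times> 'l \<Rightarrow> 'k) \<Rightarrow> 'i \<times> ('j \<times> 'l) \<Rightarrow> 'k" where
  "tassoc t = (\<lambda>(i, (j, l)). t ((i, j), l))"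

definition tswap23 :: "(('i \<times> 'j) \<times> ('l \<times> 'm) \<Rightarrow> 'k) \<Rightarrow> ('i \<times> 'l) \<times> ('j \<times> 'm) \<Rightarrow> 'k" where
  "tswap23 t = (\<lambda>((i, l), (j, m)). t ((i, j), (l, m)))"

lemma tmap_tensor:
  assumes "flinear A A' f" "flinear B B' g" "a \<in> A" "b \<in> B"
  shows "tmap f g (a \<otimes> b) = f a \<otimes> g b"
proof -
  have g: "g (\<lambda>j. a i * b j) = fscale (a i) (g b)" for i
    using assms(2,4) by (simp add: linear_on_def fscale_def)
  have f: "f (\<lambda>i. a i * g b n) = fscale (g b n) (f a)" for n
    using assms(1,3) by (simp add: linear_on_def fscale_def mult.commute[of _ "g b n"])
  show ?thesis
    by (simp add: tmap_def tensor_def fun_eq_iff g f) (simp add: fscale_def f)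
qed

lemma contract_left_tensor:
  assumes "functional_on A \<phi>" "a \<in> A"
  shows "contract_left \<phi> (a \<otimes> b) = fscale (\<phi> a) b"
proof -
  have "\<phi> (\<lambda>i. a i * b j) = b j * \<phi> a" for j
    using assms by (simp add: linear_on_def fscale_def mult.commute[of _ "b j"])
  then show ?thesis
    by (simp add: contract_left_def tensor_def fscale_def mult.commute)
qed

lemma contract_right_tensor:
  assumes "functional_on B \<psi>" "b \<in> B"
  shows "contract_right \<psi> (a \<otimes> b) = fscale (\<psi> b) a"
proof -
  have "\<psi> (\<lambda>j. a i * b j) = a i * \<psi> b" for i
    using assms by (simp add: linear_on_def fscale_def)
  then show ?thesis
    by (simp add: contract_right_def tensor_def fscale_def mult.commute)
qed

lemma tassoc_tensor: "tassoc ((a \<otimes> b) \<otimes> c) = a \<otimes> (b \<otimes> c)"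
  by (auto simp: tassoc_def tensor_def mult.assoc fun_eq_iff)

lemma tswap23_tensor: "tswap23 ((a \<otimes> b) \<otimes> (c \<otimes> d)) = (a \<otimes> c) \<otimes> (b \<otimes> d)"
  by (auto simp: tswap23_def tensor_def mult_ac)


section \<open>Bialgebras, gradings and Hopf pairings\<close>

text \<open>Multiplications are linear maps on \<open>tens A A\<close>; the product of \<open>a\<close> and \<open>b\<close> is \<open>m (a \<otimes> b)\<close>.\<close>

definition algebra_on ::
  "('i \<Rightarrow> 'k::field) set \<Rightarrow> (('i \<times> 'i \<Rightarrow> 'k) \<Rightarrow> 'i \<Rightarrow> 'k) \<Rightarrow> ('i \<Rightarrow> 'k) \<Rightarrow> bool"
where
  "algebra_on A m u \<longleftrightarrow>
     fs.subspace A \<and> flinear (tens A A) A m \<and> u \<in> A \<and>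
     (\<forall>a\<in>A. m (u \<otimes> a) = a \<and> m (a \<otimes> u) = a) \<and>
     (\<forall>a\<in>A. \<forall>b\<in>A. \<forall>c\<in>A. m (m (a \<otimes> b) \<otimes> c) = m (a \<otimes> m (b \<otimes> c)))"

definition algebra_hom ::
  "('i \<Rightarrow> 'k::field) set \<Rightarrow> (('i \<times> 'i \<Rightarrow> 'k) \<Rightarrow> 'i \<Rightarrow> 'k) \<Rightarrow> ('i \<Rightarrow> 'k) \<Rightarrow>
   ('j \<Rightarrow> 'k) set \<Rightarrow> (('j \<times> 'j \<Rightarrow> 'k) \<Rightarrow> 'j \<Rightarrow> 'k) \<Rightarrow> ('j \<Rightarrow> 'k) \<Rightarrow> (('i \<Rightarrow> 'k) \<Rightarrow> 'j \<Rightarrow> 'k) \<Rightarrow> bool"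
where
  "algebra_hom A mA uA B mB uB f \<longleftrightarrow>
     flinear A B f \<and> f uA = uB \<and> (\<forall>a\<in>A. \<forall>b\<in>A. f (mA (a \<otimes> b)) = mB (f a \<otimes> f b))"

text \<open>The product \<open>(a \<otimes> b)(a' \<otimes> b') = aa' \<otimes> bb'\<close> of the tensor square of an algebra.\<close>

definition square_mult ::
  "(('i \<times> 'i \<Rightarrow> 'k::field) \<Rightarrow> 'i \<Rightarrow> 'k) \<Rightarrow> (('i \<times> 'i) \<times> ('i \<times> 'i) \<Rightarrow> 'k) \<Rightarrow> 'i \<times> 'i \<Rightarrow> 'k"
where
  "square_mult m t = tmap m m (tswap23 t)"

definition coalgebra_on ::
  "('i \<Rightarrow> 'k::field) set \<Rightarrow> (('i \<Rightarrow> 'k) \<Rightarrow> 'i \<times> 'i \<Rightarrow> 'k) \<Rightarrow> (('i \<Rightarrow> 'k) \<Rightarrow> 'k) \<Rightarrow> bool"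
where
  "coalgebra_on A \<Delta> \<epsilon> \<longleftrightarrow>
     fs.subspace A \<and> flinear A (tens A A) \<Delta> \<and> functional_on A \<epsilon> \<and>
     (\<forall>a\<in>A. tassoc (tmap \<Delta> id (\<Delta> a)) = tmap id \<Delta> (\<Delta> a)) \<and>
     (\<forall>a\<in>A. contract_left \<epsilon> (\<Delta> a) = a \<and> contract_right \<epsilon> (\<Delta> a) = a)"

definition bialgebra_on ::
  "('i \<Rightarrow> 'k::field) set \<Rightarrow> (('i \<times> 'i \<Rightarrow> 'k) \<Rightarrow> 'i \<Rightarrow> 'k) \<Rightarrow> ('i \<Rightarrow> 'k) \<Rightarrow>
   (('i \<Rightarrow> 'k) \<Rightarrow> 'i \<times> 'i \<Rightarrow> 'k) \<Rightarrow> (('i \<Rightarrow> 'k) \<Rightarrow> 'k) \<Rightarrow> bool"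
where
  "bialgebra_on A m u \<Delta> \<epsilon> \<longleftrightarrow>
     algebra_on A m u \<and> coalgebra_on A \<Delta> \<epsilon> \<and>
     algebra_hom A m u (tens A A) (square_mult m) (u \<otimes> u) \<Delta> \<and>
     \<epsilon> u = 1 \<and> (\<forall>a\<in>A. \<forall>b\<in>A. \<epsilon> (m (a \<otimes> b)) = \<epsilon> a * \<epsilon> b)"

text \<open>\<open>A\<close> is the internal direct sum of its subspaces \<open>G n\<close>.\<close>

definition is_grading ::
  "('k::field \<Rightarrow> 'a::ab_group_add \<Rightarrow> 'a) \<Rightarrow> 'a set \<Rightarrow> (nat \<Rightarrow> 'a set) \<Rightarrow> bool"
where
  "is_grading s A G \<longleftrightarrow>
     (\<forall>n. module.subspace s (G n) \<and> G n \<subseteq> A) \<and>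
     (\<forall>x\<in>A. \<exists>!c. (\<forall>n. c n \<in> G n) \<and> finite {n. c n \<noteq> 0} \<and> x = (\<Sum>n | c n \<noteq> 0. c n))"

definition graded_bialgebra_on ::
  "('i \<Rightarrow> 'k::field) set \<Rightarrow> (('i \<times> 'i \<Rightarrow> 'k) \<Rightarrow> 'i \<Rightarrow> 'k) \<Rightarrow> ('i \<Rightarrow> 'k) \<Rightarrow>
   (('i \<Rightarrow> 'k) \<Rightarrow> 'i \<times> 'i \<Rightarrow> 'k) \<Rightarrow> (('i \<Rightarrow> 'k) \<Rightarrow> 'k) \<Rightarrow> (nat \<Rightarrow> ('i \<Rightarrow> 'k) set) \<Rightarrow> bool"
where
  "graded_bialgebra_on A m u \<Delta> \<epsilon> G \<longleftrightarrow>
     bialgebra_on A m u \<Delta> \<epsilon> \<and> is_grading fscale A G \<and>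
     u \<in> G 0 \<and>
     (\<forall>i j. \<forall>a\<in>G i. \<forall>b\<in>G j. m (a \<otimes> b) \<in> G (i + j)) \<and>
     (\<forall>n. \<forall>a\<in>G n. \<Delta> a \<in> fs.span (\<Union>i\<le>n. tens (G i) (G (n - i)))) \<and>
     (\<forall>n>0. \<forall>a\<in>G n. \<epsilon> a = 0)"

text \<open>
  A pairing of \<open>A\<close> and \<open>B\<close> is a functional on \<open>tens A B\<close>. It extends to
  \<open>tens A A\<close> and \<open>tens B B\<close> by \<open>(a \<otimes> a', b \<otimes> b') \<mapsto> p (a \<otimes> b) * p (a' \<otimes> b')\<close>.
\<close>

definition pairing_square ::
  "(('i \<times> 'j \<Rightarrow> 'k::field) \<Rightarrow> 'k) \<Rightarrow> ('i \<times> 'i \<Rightarrow> 'k) \<Rightarrow> ('j \<times> 'j \<Rightarrow> 'k) \<Rightarrow> 'k"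
where
  "pairing_square p s t = p (\<lambda>(i, j). p (\<lambda>(i', j'). s (i, i') * t (j, j')))"

lemma pairing_square_tensor:
  assumes p: "functional_on (tens A B) p" and "a \<in> A" "a' \<in> A" "b \<in> B" "b' \<in> B"
  shows "pairing_square p (a \<otimes> a') (b \<otimes> b') = p (a \<otimes> b) * p (a' \<otimes> b')"
proof -
  have in_tens: "x \<otimes> y \<in> tens A B" if "x \<in> A" "y \<in> B" for x y
    unfolding tens_def using that by (intro fs.span_base) auto
  have hom: "p (fscale c t) = c * p t" if "t \<in> tens A B" for c t
    using p that by (simp add: linear_on_def)
  have "(\<lambda>(i', j'). (a \<otimes> a') (i, i') * (b \<otimes> b') (j, j')) = fscale (a i * b j) (a' \<otimes> b')" for i j
    by (auto simp: tensor_def fscale_def mult_ac)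
  then have "pairing_square p (a \<otimes> a') (b \<otimes> b') = p (\<lambda>(i, j). (a i * b j) * p (a' \<otimes> b'))"
    using assms(3,5) by (simp add: pairing_square_def hom in_tens)
  also have "(\<lambda>(i, j). (a i * b j) * p (a' \<otimes> b')) = fscale (p (a' \<otimes> b')) (a \<otimes> b)"
    by (auto simp: tensor_def fscale_def mult_ac)
  finally show ?thesis
    using assms(2,4) by (simp add: hom in_tens mult.commute)
qed

definition nondegenerate_pairing ::
  "('i \<Rightarrow> 'k::field) set \<Rightarrow> ('j \<Rightarrow> 'k) set \<Rightarrow> (('i \<times> 'j \<Rightarrow> 'k) \<Rightarrow> 'k) \<Rightarrow> bool"
where
  "nondegenerate_pairing A B p \<longleftrightarrow>
     (\<forall>a\<in>A. (\<forall>b\<in>B. p (a \<otimes> b) = 0) \<longrightarrow> a = 0) \<and>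
     (\<forall>b\<in>B. (\<forall>a\<in>A. p (a \<otimes> b) = 0) \<longrightarrow> b = 0)"

definition hopf_pairing ::
  "('i \<Rightarrow> 'k::field) set \<Rightarrow> (('i \<times> 'i \<Rightarrow> 'k) \<Rightarrow> 'i \<Rightarrow> 'k) \<Rightarrow> ('i \<Rightarrow> 'k) \<Rightarrow>
   (('i \<Rightarrow> 'k) \<Rightarrow> 'i \<times> 'i \<Rightarrow> 'k) \<Rightarrow> (('i \<Rightarrow> 'k) \<Rightarrow> 'k) \<Rightarrow>
   ('j \<Rightarrow> 'k) set \<Rightarrow> (('j \<times> 'j \<Rightarrow> 'k) \<Rightarrow> 'j \<Rightarrow> 'k) \<Rightarrow> ('j \<Rightarrow> 'k) \<Rightarrow>
   (('j \<Rightarrow> 'k) \<Rightarrow> 'j \<times> 'j \<Rightarrow> 'k) \<Rightarrow> (('j \<Rightarrow> 'k) \<Rightarrow> 'k) \<Rightarrow> (('i \<times> 'j \<Rightarrow> 'k) \<Rightarrow> 'k) \<Rightarrow> bool"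
where
  "hopf_pairing A mA uA \<Delta>A \<epsilon>A B mB uB \<Delta>B \<epsilon>B p \<longleftrightarrow>
     functional_on (tens A B) p \<and>
     (\<forall>X\<in>B. p (uA \<otimes> X) = \<epsilon>B X) \<and>
     (\<forall>F\<in>A. \<forall>G\<in>A. \<forall>X\<in>B. pairing_square p (F \<otimes> G) (\<Delta>B X) = p (mA (F \<otimes> G) \<otimes> X)) \<and>
     (\<forall>F\<in>A. p (F \<otimes> uB) = \<epsilon>A F) \<and>
     (\<forall>F\<in>A. \<forall>X\<in>B. \<forall>Y\<in>B. pairing_square p (\<Delta>A F) (X \<otimes> Y) = p (F \<otimes> mB (X \<otimes> Y)))"


section \<open>Tensor algebras\<close>

text \<open>
  The word \<open>v\<^sub>1 \<dots> v\<^sub>n\<close> in letters \<open>v\<^sub>l :: 'i \<Rightarrow> 'k\<close> is the \<open>n\<close>-fold elementary tensor, viewed as a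
  function on lists that vanishes on lists of length other than \<open>n\<close>. The unit is \<open>word []\<close>.
\<close>

definition word :: "('i \<Rightarrow> 'k::field) list \<Rightarrow> 'i list \<Rightarrow> 'k" where
  "word vs = (\<lambda>xs. if length xs = length vs then \<Prod>l<length vs. (vs ! l) (xs ! l) else 0)"

definition tensor_algebra :: "('i \<Rightarrow> 'k::field) set \<Rightarrow> ('i list \<Rightarrow> 'k) set" where
  "tensor_algebra V = fs.span {word vs | vs. set vs \<subseteq> V}"

definition conc :: "('i list \<times> 'i list \<Rightarrow> 'k::field) \<Rightarrow> 'i list \<Rightarrow> 'k" where
  "conc t = (\<lambda>xs. \<Sum>k\<le>length xs. t (take k xs, drop k xs))"

definition deconc :: "('i list \<Rightarrow> 'k::field) \<Rightarrow> 'i list \<times> 'i list \<Rightarrow> 'k" where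
  "deconc X = (\<lambda>(xs, ys). X (xs @ ys))"

definition deconc_counit :: "('i list \<Rightarrow> 'k::field) \<Rightarrow> 'k" where
  "deconc_counit X = X []"

lemma prod_lessThan_add:
  fixes h :: "nat \<Rightarrow> 'k::comm_monoid_mult"
  shows "(\<Prod>l<m + n. h l) = (\<Prod>l<m. h l) * (\<Prod>l<n. h (m + l))"
  by (induction n) (simp_all add: mult.assoc)

lemma word_append:
  "word (us @ vs) (xs @ ys) = word us xs * word vs ys" if "length xs = length us"
proof (cases "length ys = length vs")
  case True
  have "(\<Prod>l<length us + length vs. ((us @ vs) ! l) ((xs @ ys) ! l)) =
        (\<Prod>l<length us. ((us @ vs) ! l) ((xs @ ys) ! l)) *
        (\<Prod>l<length vs. ((us @ vs) ! (length us + l)) ((xs @ ys) ! (length us + l)))"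
    by (rule prod_lessThan_add)
  then show ?thesis
    using that True by (simp add: word_def nth_append)
qed (use that in \<open>auto simp: word_def\<close>)

lemma conc_word: "conc (word us \<otimes> word vs) = word (us @ vs)"
proof (rule ext)
  fix xs :: "'a list"
  have zero: "word us (take k xs) * word vs (drop k xs) = 0"
    if "k \<le> length xs" "k \<noteq> length us" for k
    using that by (simp add: word_def)
  show "conc (word us \<otimes> word vs) xs = word (us @ vs) xs"
  proof (cases "length us \<le> length xs")
    case True
    have "conc (word us \<otimes> word vs) xs =
        (\<Sum>k\<in>{length us}. word us (take k xs) * word vs (drop k xs))"
      unfolding conc_def tensor_def prod.case using True zero
      by (intro sum.mono_neutral_right) auto
    also have "\<dots> = word (us @ vs) (take (length us) xs @ drop (length us) xs)"
      using True by (subst word_append) auto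
    finally show ?thesis by simp
  next
    case False
    then have "conc (word us \<otimes> word vs) xs = 0"
      unfolding conc_def tensor_def prod.case using zero by (intro sum.neutral) auto
    then show ?thesis using False by (simp add: word_def)
  qed
qed

lemma deconc_word: "deconc (word vs) = (\<Sum>k\<le>length vs. word (take k vs) \<otimes> word (drop k vs))"
proof (rule ext, clarify)
  fix xs ys :: "'a list"
  have sum_app: "(\<Sum>k\<in>T. g k) z = (\<Sum>k\<in>T. g k z)" for T :: "nat set"
      and g :: "nat \<Rightarrow> 'a list \<times> 'a list \<Rightarrow> 'b" and z
    by (induction T rule: infinite_finite_induct) auto
  have eq: "(\<Sum>k\<le>length vs. word (take k vs) \<otimes> word (drop k vs)) (xs, ys) =
      (\<Sum>k\<le>length vs. word (take k vs) xs * word (drop k vs) ys)"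
    by (simp add: sum_app tensor_def)
  have zero: "word (take k vs) xs * word (drop k vs) ys = 0"
    if "k \<le> length vs" "k \<noteq> length xs" for k
    using that by (simp add: word_def)
  show "deconc (word vs) (xs, ys) = (\<Sum>k\<le>length vs. word (take k vs) \<otimes> word (drop k vs)) (xs, ys)"
  proof (cases "length xs \<le> length vs")
    case True
    have "(\<Sum>k\<le>length vs. word (take k vs) xs * word (drop k vs) ys) =
        (\<Sum>k\<in>{length xs}. word (take k vs) xs * word (drop k vs) ys)"
      using True zero by (intro sum.mono_neutral_right) auto
    also have "\<dots> = word (take (length xs) vs @ drop (length xs) vs) (xs @ ys)"
      using True by (subst word_append) auto
    finally show ?thesis by (simp add: eq deconc_def)
  next
    case False
    then have "(\<Sum>k\<le>length vs. word (take k vs) xs * word (drop k vs) ys) = 0"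
      using zero by (intro sum.neutral) auto
    then show ?thesis using False by (simp only: eq) (simp add: deconc_def word_def)
  qed
qed

text \<open>
  An arbitrary vector space is turned into a space of functions by evaluation on its linear
  functionals, which is injective over a field. Outside the linear functionals \<open>evl\<close> is cut off
  to \<open>0\<close> so that it is linear in the vector.
\<close>

definition evl :: "('k::field \<Rightarrow> 'v::ab_group_add \<Rightarrow> 'v) \<Rightarrow> 'v \<Rightarrow> ('v \<Rightarrow> 'k) \<Rightarrow> 'k" where
  "evl s v = (\<lambda>\<phi>. if Vector_Spaces.linear s (*) \<phi> then \<phi> v else 0)"


section \<open>Operads\<close>

text \<open>
  The type \<open>'v\<close> is the whole space \<open>\<Oplus>n. P n\<close>. \<open>\<gamma> p [p\<^sub>1, \<dots>, p\<^sub>n]\<close> is the operadic composition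
  \<open>p \<circ> (p\<^sub>1, \<dots>, p\<^sub>n)\<close> of \<open>p \<in> P n\<close> with \<open>n\<close> elements; its values on other arguments are irrelevant.
  No symmetric group actions are required: symmetric operads are covered by forgetting them.
\<close>

locale operad = vector_space scale
  for scale :: "'k::field_char_0 \<Rightarrow> 'v::ab_group_add \<Rightarrow> 'v" +
  fixes P :: "nat \<Rightarrow> 'v set"
    and \<gamma> :: "'v \<Rightarrow> 'v list \<Rightarrow> 'v"
    and I :: 'v
  assumes arity_grading: "is_grading scale UNIV P"
    and unit_in: "I \<in> P 1"
    and comp_in: "\<lbrakk>p \<in> P n; length qs = n; list_all2 (\<lambda>q k. q \<in> P k) qs ks\<rbrakk>
          \<Longrightarrow> \<gamma> p qs \<in> P (sum_list ks)"
    and comp_add_left: "\<lbrakk>p \<in> P n; p' \<in> P n; length qs = n\<rbrakk>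
          \<Longrightarrow> \<gamma> (p + p') qs = \<gamma> p qs + \<gamma> p' qs"
    and comp_scale_left: "\<lbrakk>p \<in> P n; length qs = n\<rbrakk>
          \<Longrightarrow> \<gamma> (scale c p) qs = scale c (\<gamma> p qs)"
    and comp_add_right: "\<lbrakk>p \<in> P n; Suc (length qs + length rs) = n\<rbrakk>
          \<Longrightarrow> \<gamma> p (qs @ (q + q') # rs) = \<gamma> p (qs @ q # rs) + \<gamma> p (qs @ q' # rs)"
    and comp_scale_right: "\<lbrakk>p \<in> P n; Suc (length qs + length rs) = n\<rbrakk>
          \<Longrightarrow> \<gamma> p (qs @ scale c q # rs) = scale c (\<gamma> p (qs @ q # rs))"
    and unit_left: "\<gamma> I [p] = p"
    and unit_right: "p \<in> P n \<Longrightarrow> \<gamma> p (replicate n I) = p"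
    and comp_assoc: "\<lbrakk>p \<in> P n; length qs = n; list_all2 (\<lambda>q rs. q \<in> P (length rs)) qs rss\<rbrakk>
          \<Longrightarrow> \<gamma> (\<gamma> p qs) (concat rss) = \<gamma> p (map2 \<gamma> qs rss)"

definition finite_dimensional :: "('k::field \<Rightarrow> 'v::ab_group_add \<Rightarrow> 'v) \<Rightarrow> 'v set \<Rightarrow> bool" where
  "finite_dimensional s V \<longleftrightarrow> (\<exists>B. finite B \<and> V = module.span s B)"

definition hcomp :: "(nat \<Rightarrow> 'v::ab_group_add set) \<Rightarrow> nat \<Rightarrow> 'v \<Rightarrow> 'v" where
  "hcomp P n x = (THE c. (\<forall>n. c n \<in> P n) \<and> finite {n. c n \<noteq> 0} \<and> x = (\<Sum>n | c n \<noteq> 0. c n)) n"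

text \<open>
  Restriction to \<open>P n\<close> identifies \<open>dual_component s P n\<close> with the dual space of \<open>P n\<close>, as \<open>'v\<close> is
  the direct sum of the \<open>P m\<close>.
\<close>

definition dual_component ::
  "('k::field \<Rightarrow> 'v::ab_group_add \<Rightarrow> 'v) \<Rightarrow> (nat \<Rightarrow> 'v set) \<Rightarrow> nat \<Rightarrow> ('v \<Rightarrow> 'k) set"
where
  "dual_component s P n =
     {f. Vector_Spaces.linear s (*) f \<and> (\<forall>m. m \<noteq> n \<longrightarrow> (\<forall>x\<in>P m. f x = 0))}"

definition graded_dual ::
  "('k::field \<Rightarrow> 'v::ab_group_add \<Rightarrow> 'v) \<Rightarrow> (nat \<Rightarrow> 'v set) \<Rightarrow> ('v \<Rightarrow> 'k) set"
where
  "graded_dual s P = fs.span (\<Union>n\<in>{1..}. dual_component s P n)"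

abbreviation T_dual ::
  "('k::field \<Rightarrow> 'v::ab_group_add \<Rightarrow> 'v) \<Rightarrow> (nat \<Rightarrow> 'v set) \<Rightarrow> ('v list \<Rightarrow> 'k) set"
where
  "T_dual s P \<equiv> tensor_algebra (graded_dual s P)"

abbreviation T_operad ::
  "('k::field \<Rightarrow> 'v::ab_group_add \<Rightarrow> 'v) \<Rightarrow> (('v \<Rightarrow> 'k) list \<Rightarrow> 'k) set"
where
  "T_operad s \<equiv> tensor_algebra (range (evl s))"

abbreviation oword ::
  "('k::field \<Rightarrow> 'v::ab_group_add \<Rightarrow> 'v) \<Rightarrow> 'v list \<Rightarrow> ('v \<Rightarrow> 'k) list \<Rightarrow> 'k"
where
  "oword s vs \<equiv> word (map (evl s) vs)"

text \<open>
  The transpose of the composition: evaluated at a letter \<open>q\<close> and a word \<open>q\<^sub>1 \<dots> q\<^sub>p\<close>,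
  \<open>\<delta> f\<close> is \<open>f (q \<circ> (q\<^sub>1, \<dots>, q\<^sub>p))\<close> if \<open>q \<in> P p\<close>, extended linearly in \<open>q\<close> by \<open>0\<close> on the other \<open>P n\<close>.
\<close>

definition delta ::
  "(nat \<Rightarrow> 'v::ab_group_add set) \<Rightarrow> ('v \<Rightarrow> 'v list \<Rightarrow> 'v) \<Rightarrow> ('v \<Rightarrow> 'k::field) \<Rightarrow> 'v list \<times> 'v list \<Rightarrow> 'k"
where
  "delta P \<gamma> f = (\<lambda>(u, qs). case u of [q] \<Rightarrow> f (\<gamma> (hcomp P (length qs) q) qs) | _ \<Rightarrow> 0)"

definition extends_delta ::
  "('k::field \<Rightarrow> 'v::ab_group_add \<Rightarrow> 'v) \<Rightarrow> (nat \<Rightarrow> 'v set) \<Rightarrow> ('v \<Rightarrow> 'v list \<Rightarrow> 'v) \<Rightarrow>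
   (('v list \<Rightarrow> 'k) \<Rightarrow> 'v list \<times> 'v list \<Rightarrow> 'k) \<Rightarrow> bool"
where
  "extends_delta s P \<gamma> \<Delta> \<longleftrightarrow>
     algebra_hom (T_dual s P) conc (word [])
       (tens (T_dual s P) (T_dual s P)) (square_mult conc) (word [] \<otimes> word []) \<Delta> \<and>
     (\<forall>f\<in>graded_dual s P. \<Delta> (word [f]) = delta P \<gamma> f)"

text \<open>
  On words \<open>f\<^sub>1 \<dots> f\<^sub>n\<close> this is \<open>f\<^sub>1 I * \<dots> * f\<^sub>n I\<close> (lemma \<open>dual_counit_word\<close>); elements of
  \<open>dual_component s P n\<close> with \<open>n \<noteq> 1\<close> vanish at \<open>I\<close>.
\<close>

definition dual_counit :: "'v \<Rightarrow> ('v list \<Rightarrow> 'k::field) \<Rightarrow> 'k" where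
  "dual_counit I F = (\<Sum>n | F (replicate n I) \<noteq> 0. F (replicate n I))"

lemma dual_counit_word: "dual_counit I (word fs) = (\<Prod>l<length fs. (fs ! l) I)"
proof -
  have "dual_counit I (word fs) = (\<Sum>n\<in>{length fs}. word fs (replicate n I))"
    unfolding dual_counit_def
    by (rule sum.mono_neutral_left) (auto simp: word_def split: if_splits)
  then show ?thesis by (simp add: word_def)
qed

text \<open>\<open>\<langle>p, p\<^sub>1 \<dots> p\<^sub>k\<rangle>\<close>: \<open>S\<close> is the set of positions (counted from \<open>0\<close>) that receive the \<open>p\<^sub>l\<close>, in order.\<close>

definition bracket ::
  "(nat \<Rightarrow> 'v::ab_group_add set) \<Rightarrow> ('v \<Rightarrow> 'v list \<Rightarrow> 'v) \<Rightarrow> 'v \<Rightarrow> 'v \<Rightarrow> 'v list \<Rightarrow> 'v"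
where
  "bracket P \<gamma> I p ps =
     (\<Sum>n | hcomp P n p \<noteq> 0. \<Sum>S | S \<subseteq> {..<n} \<and> card S = length ps.
        \<gamma> (hcomp P n p) (map (\<lambda>i. if i \<in> S then ps ! card {j\<in>S. j < i} else I) [0..<n]))"

text \<open>
  \<open>x\<^sub>1 \<dots> x\<^sub>k * v\<close> for words: \<open>ws\<close> runs over the factorizations of \<open>v\<close> into \<open>2k+1\<close> words;
  counted from \<open>0\<close>, the factors with odd index are absorbed by the brackets.
\<close>

definition star_words ::
  "('k::field \<Rightarrow> 'v::ab_group_add \<Rightarrow> 'v) \<Rightarrow> (nat \<Rightarrow> 'v set) \<Rightarrow> ('v \<Rightarrow> 'v list \<Rightarrow> 'v) \<Rightarrow> 'v \<Rightarrow>
   'v list \<Rightarrow> 'v list \<Rightarrow> ('v \<Rightarrow> 'k) list \<Rightarrow> 'k"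
where
  "star_words s P \<gamma> I xs v =
     (\<Sum>ws | length ws = 2 * length xs + 1 \<and> concat ws = v.
        oword s (concat (map (\<lambda>i. if even i then ws ! i
                                  else [bracket P \<gamma> I (xs ! (i div 2)) (ws ! i)])
                             [0..<length ws])))"

definition is_star ::
  "('k::field \<Rightarrow> 'v::ab_group_add \<Rightarrow> 'v) \<Rightarrow> (nat \<Rightarrow> 'v set) \<Rightarrow> ('v \<Rightarrow> 'v list \<Rightarrow> 'v) \<Rightarrow> 'v \<Rightarrow>
   ((('v \<Rightarrow> 'k) list \<times> ('v \<Rightarrow> 'k) list \<Rightarrow> 'k) \<Rightarrow> ('v \<Rightarrow> 'k) list \<Rightarrow> 'k) \<Rightarrow> bool"
where
  "is_star s P \<gamma> I m \<longleftrightarrow>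
     flinear (tens (T_operad s) (T_operad s)) (T_operad s) m \<and>
     (\<forall>xs v. m (oword s xs \<otimes> oword s v) = star_words s P \<gamma> I xs v)"

end

(*
  A word F = f_1 ... f_n of linear forms is the multilinear function
  (x_1, ..., x_n) |-> f_1(x_1) ... f_n(x_n), and the coproduct has the closed formula: Delta F at (x_1 ... x_n, ys) is the sum of
  F (x_1 o w_1, ..., x_n o w_n) over the factorizations ys = w_1 ... w_n. It is multiplicative by
  construction. Coassociativity reduces to a single letter, where it is operadic associativity tested on
  homogeneous elements. That Delta F is a finite sum of tensors is seen by expanding in a homogeneous
  basis: P(0) = 0 and dim P(n) finite leave finitely many terms.

  The relations <<f, 1>> = f(I), <<f, x>> = f(x) and <<f, x y ...>> = 0 force <<F, v>> to be the sum of
  the values of F at all words obtained from v by inserting letters I. This is triangular with respect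
  to the length of words, hence nondegenerate. In <<Delta F, X (x) Y>> = <<F, X * Y>> both sides satisfy the same
  recursion when a letter is split off F, because f(<x, v>) is the sum of f(x o w) over all words w
  obtained from v by inserting letters I.
*)

theory Submission
  imports Defs "HOL-Library.Groups_Big_Fun"
begin

section \<open>Linear maps on spans and tensor products\<close>

text \<open>Because every space consists of functions, \<open>Delta\<close> and \<open>conc\<close>
  are defined on all functions, and their identities hold pointwise with few membership hypotheses.
  The price is that lying in a tensor product becomes a claim of its own, namely finiteness. The
  grading settles it: the coproduct of a letter is placed in one degree of the tensor square, and
  this inclusion already contains the finiteness. The insertion operator \<open>ins\<close> is the
  algebra endomorphism that sends a letter f to f(I) 1 + f. Compatibility of the pairing with
  deconcatenation is therefore multiplicativity of \<open>ins\<close>. A form f applied to a bracket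
  is \<open>ins\<close> of the function w \<mapsto> f (x o w), so the sum over position sets in
  \<open>bracket\<close> is traded for \<open>ins\<close> before anything is proved about the
  product. Pairing and product are prescribed on words but must be maps on functions that come
  without a decomposition into words. Both are defined by coordinates in a homogeneous basis;
  multilinearity then shows that on words the basis disappears.\<close>

lemma sum_fun_apply: "(\<Sum>a\<in>S. g a) x = (\<Sum>a\<in>S. g a x)"
  by (induction S rule: infinite_finite_induct) (auto simp: plus_fun_apply zero_fun_apply)

lemma fscale_apply: "fscale c f i = c * f i"
  by (simp add: fscale_def)

(* As simp rules these would unfold the sums of functions that induction rules leave eta-expanded. *)
declare plus_fun_apply [simp del] zero_fun_apply [simp del]

lemmas fun_apply = plus_fun_apply zero_fun_apply fscale_apply

text \<open>The combination \<open>fscale c x + y\<close> merges additivity and homogeneity, so that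
  an induction over a span needs one linearity equation. This is the reason for the many facts in
  \<open>_step\<close> form below.\<close>

lemma span_lin_induct [consumes 1, case_names zero step]:
  assumes "x \<in> fs.span S" "Q 0"
    and "\<And>c x y. x \<in> S \<Longrightarrow> y \<in> fs.span S \<Longrightarrow> Q y \<Longrightarrow> Q (fscale c x + y)"
  shows "Q x"
proof -
  have "x \<in> fs.span S \<and> Q x"
    using assms(1)
    by (induction rule: fs.span_induct_alt) (auto simp: assms fs.span_zero fs.span_add fs.span_scale fs.span_base)
  then show ?thesis ..
qed

lemma linear_on_zero: "linear_on s1 s2 A B f \<Longrightarrow> 0 \<in> A \<Longrightarrow> f 0 = 0"
  unfolding linear_on_def by (metis add_cancel_right_right add_0)

lemma linear_on_step:
  assumes "linear_on s1 s2 A B f" "x \<in> A" "y \<in> A" "s1 c x \<in> A"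
  shows "f (s1 c x + y) = s2 c (f x) + f y"
  using assms by (auto simp: linear_on_def)

lemma linear_on_subset:
  "linear_on s1 s2 A B f \<Longrightarrow> A' \<subseteq> A \<Longrightarrow> (\<And>x. x \<in> A' \<Longrightarrow> f x \<in> B') \<Longrightarrow> linear_on s1 s2 A' B' f"
  unfolding linear_on_def by (meson subsetD)

lemma linear_on_sum:
  assumes "linear_on fscale s2 A B f" "fs.subspace A" "\<And>a. a \<in> S \<Longrightarrow> g a \<in> A"
  shows "f (\<Sum>a\<in>S. g a) = (\<Sum>a\<in>S. f (g a))"
  using assms(3)
proof (induction S rule: infinite_finite_induct)
  case (insert a S)
  then have "(\<Sum>a\<in>S. g a) \<in> A" "g a \<in> A"
    using assms(2) by (auto intro: fs.subspace_sum)
  with insert assms(1) show ?case by (simp add: linear_on_def)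
qed (simp_all add: linear_on_zero[OF assms(1)] fs.subspace_0[OF assms(2)])

lemma linear_on_span_eq:
  assumes "linear_on fscale s A B f" "linear_on fscale s A C g" "A = fs.span S"
    and "\<And>x. x \<in> S \<Longrightarrow> f x = g x" "x \<in> A"
  shows "f x = g x"
proof -
  have "x \<in> fs.span S" using assms by simp
  then show ?thesis
  proof (induction rule: span_lin_induct)
    case zero
    show ?case using assms(1-3) by (metis linear_on_zero fs.span_zero)
  next
    case (step c x y)
    have "x \<in> A" "y \<in> A" "fscale c x \<in> A"
      using step assms(3) by (auto intro: fs.span_base fs.span_scale)
    with step assms(1,2,4) show ?case by (simp add: linear_on_step)
  qed
qed

lemma tensor_apply [simp]: "(a \<otimes> b) (i, j) = a i * b j"
  by (simp add: tensor_def)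

lemma tensor_bilinear:
  "(a + a') \<otimes> b = a \<otimes> b + a' \<otimes> b" "a \<otimes> (b + b') = a \<otimes> b + a \<otimes> b'"
  "fscale c a \<otimes> b = fscale c (a \<otimes> b)" "a \<otimes> fscale c b = fscale c (a \<otimes> b)"
  "0 \<otimes> b = 0" "a \<otimes> 0 = 0"
  by (auto simp: fun_eq_iff fun_apply algebra_simps)

lemma tens_subspace [simp]: "fs.subspace (tens A B)"
  by (simp add: tens_def)

lemma tensor_in_tens: "a \<in> A \<Longrightarrow> b \<in> B \<Longrightarrow> a \<otimes> b \<in> tens A B"
  unfolding tens_def by (intro fs.span_base) auto

lemma tens_induct [consumes 1, case_names zero step]:
  assumes "t \<in> tens A B" "Q 0"
    and "\<And>c a b y. a \<in> A \<Longrightarrow> b \<in> B \<Longrightarrow> y \<in> tens A B \<Longrightarrow> Q y \<Longrightarrow> Q (fscale c (a \<otimes> b) + y)"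
  shows "Q t"
  using assms(1) unfolding tens_def
proof (induction rule: span_lin_induct)
  case (step c x y)
  then obtain a b where "x = a \<otimes> b" "a \<in> A" "b \<in> B" by blast
  with step assms(3) show ?case unfolding tens_def by blast
qed (rule assms(2))

text \<open>Contractions and pairings apply a functional to slices of a function of two arguments.
  The functional is linear only on its own space, so the slices have to be located there
  first.\<close>

lemma tens_slice_left:
  assumes "t \<in> tens A B" "fs.subspace A"
  shows "(\<lambda>i. t (i, j)) \<in> A"
  using assms(1)
proof (induction rule: tens_induct)
  case zero
  then show ?case using fs.subspace_0[OF assms(2)] by (simp add: zero_fun_def)
next
  case (step c a b y)
  have "fscale (c * b j) a + (\<lambda>i. y (i, j)) \<in> A"
    using step assms(2) by (intro fs.subspace_add fs.subspace_scale)
  then show ?case by (simp add: plus_fun_def fscale_def tensor_def mult_ac)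
qed

lemma tens_slice_right:
  assumes "t \<in> tens A B" "fs.subspace B"
  shows "(\<lambda>j. t (i, j)) \<in> B"
  using assms(1)
proof (induction rule: tens_induct)
  case zero
  then show ?case using fs.subspace_0[OF assms(2)] by (simp add: zero_fun_def)
next
  case (step c a b y)
  have "fscale (c * a i) b + (\<lambda>j. y (i, j)) \<in> B"
    using step assms(2) by (intro fs.subspace_add fs.subspace_scale)
  then show ?case by (simp add: plus_fun_def fscale_def tensor_def mult_ac)
qed

lemma contract_right_step:
  assumes "functional_on B \<psi>" "fs.subspace B" "t \<in> tens A B" "s \<in> tens A B"
  shows "contract_right \<psi> (fscale c t + s) = fscale c (contract_right \<psi> t) + contract_right \<psi> s"
proof (rule ext)
  fix i
  have "(\<lambda>j. (fscale c t + s) (i, j)) = fscale c (\<lambda>j. t (i, j)) + (\<lambda>j. s (i, j))"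
    by (auto simp: fun_apply)
  moreover have "(\<lambda>j. t (i, j)) \<in> B" "(\<lambda>j. s (i, j)) \<in> B"
    by (rule tens_slice_right[OF assms(3,2)], rule tens_slice_right[OF assms(4,2)])
  ultimately show "contract_right \<psi> (fscale c t + s) i =
      (fscale c (contract_right \<psi> t) + contract_right \<psi> s) i"
    using assms(1,2) by (simp add: contract_right_def linear_on_step fs.subspace_scale fun_apply)
qed

lemma contract_right_in:
  assumes "functional_on B \<psi>" "fs.subspace A" "fs.subspace B" "t \<in> tens A B"
  shows "contract_right \<psi> t \<in> A"
  using assms(4)
proof (induction rule: tens_induct)
  case zero
  have \<psi>0: "\<psi> 0 = 0" by (rule linear_on_zero[OF assms(1) fs.subspace_0[OF assms(3)]])
  show ?case
    using \<psi>0 fs.subspace_0[OF assms(2)] by (simp add: contract_right_def zero_fun_def)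
next
  case (step c a b y)
  then have "contract_right \<psi> (fscale c (a \<otimes> b) + y) = fscale c (fscale (\<psi> b) a) + contract_right \<psi> y"
    by (simp only: contract_right_step[OF assms(1,3) tensor_in_tens] contract_right_tensor[OF assms(1)])
  then show ?case
    using step assms(2) by (auto intro: fs.subspace_add fs.subspace_scale)
qed

section \<open>Pairings of tensor squares, computed by contractions\<close>

lemma functional_on_tensor:
  assumes "functional_on (tens A B) p" "fs.subspace B" "a \<in> A"
  shows "functional_on B (\<lambda>b. p (a \<otimes> b))"
  using assms by (auto simp: linear_on_def tensor_bilinear tensor_in_tens)

text \<open>\<open>pairing_square\<close> applies \<open>p\<close> twice. The inner application
  pairs the second legs and leaves a matrix indexed by the first legs; its entries are values of
  \<open>p\<close> at tensors of slices, hence linear in \<open>s\<close>.\<close>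

lemma pairing_matrix_step:
  assumes p: "functional_on (tens A B) p" and "fs.subspace A" "fs.subspace B"
    and "s \<in> tens C A" "s' \<in> tens C A" "t \<in> tens D B"
  shows "(\<lambda>(i, j). p (\<lambda>(i', j'). (fscale c s + s') (i, i') * t (j, j'))) =
    fscale c (\<lambda>(i, j). p (\<lambda>(i', j'). s (i, i') * t (j, j'))) +
    (\<lambda>(i, j). p (\<lambda>(i', j'). s' (i, i') * t (j, j')))"
proof (rule ext, clarify)
  fix i j
  have "(\<lambda>(i', j'). (fscale c s + s') (i, i') * t (j, j')) =
      fscale c ((\<lambda>i'. s (i, i')) \<otimes> (\<lambda>j'. t (j, j'))) + (\<lambda>i'. s' (i, i')) \<otimes> (\<lambda>j'. t (j, j'))"
    by (auto simp: fun_apply algebra_simps)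
  moreover have "(\<lambda>i'. s (i, i')) \<otimes> (\<lambda>j'. t (j, j')) \<in> tens A B"
      "(\<lambda>i'. s' (i, i')) \<otimes> (\<lambda>j'. t (j, j')) \<in> tens A B"
    using assms by (auto intro!: tensor_in_tens dest: tens_slice_right)
  ultimately show "p (\<lambda>(i', j'). (fscale c s + s') (i, i') * t (j, j')) =
      (fscale c (\<lambda>(i, j). p (\<lambda>(i', j'). s (i, i') * t (j, j'))) +
       (\<lambda>(i, j). p (\<lambda>(i', j'). s' (i, i') * t (j, j')))) (i, j)"
    using linear_on_step[OF p, of "(\<lambda>i'. s (i, i')) \<otimes> (\<lambda>j'. t (j, j'))"
        "(\<lambda>i'. s' (i, i')) \<otimes> (\<lambda>j'. t (j, j'))" c]
    by (simp add: fs.subspace_scale fun_apply) (simp add: tensor_def fscale_def plus_fun_def)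
qed

lemma pairing_matrix_tensor:
  assumes p: "functional_on (tens A B) p" and "fs.subspace A" "fs.subspace B"
    and "b \<in> A" "t \<in> tens D B"
  shows "(\<lambda>(i, j). p (\<lambda>(i', j'). (a \<otimes> b) (i, i') * t (j, j'))) =
    a \<otimes> contract_right (\<lambda>x. p (b \<otimes> x)) t"
proof (rule ext, clarify)
  fix i j
  have "(\<lambda>(i', j'). (a \<otimes> b) (i, i') * t (j, j')) = fscale (a i) (b \<otimes> (\<lambda>j'. t (j, j')))"
    by (auto simp: fun_apply mult_ac)
  moreover have "b \<otimes> (\<lambda>j'. t (j, j')) \<in> tens A B"
    using assms by (auto intro!: tensor_in_tens dest: tens_slice_right)
  ultimately show "p (\<lambda>(i', j'). (a \<otimes> b) (i, i') * t (j, j')) =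
      (a \<otimes> contract_right (\<lambda>x. p (b \<otimes> x)) t) (i, j)"
    using p by (simp add: contract_right_def linear_on_def)
qed

text \<open>Needed for the outer application of \<open>p\<close>, which is linear only on its tensor
  product. For an elementary left argument the matrix is an elementary tensor with a contraction of
  \<open>t\<close> as second factor.\<close>

lemma pairing_matrix_in:
  assumes p: "functional_on (tens A B) p" and A: "fs.subspace A" and B: "fs.subspace B"
    and D: "fs.subspace D" and s: "s \<in> tens C A" and t: "t \<in> tens D B"
  shows "(\<lambda>(i, j). p (\<lambda>(i', j'). s (i, i') * t (j, j'))) \<in> tens C D"
  using s
proof (induction rule: tens_induct)
  case zero
  have "p 0 = 0" by (rule linear_on_zero[OF p fs.subspace_0[OF tens_subspace]])
  then show ?case
    using fs.subspace_0[OF tens_subspace, of C D] by (simp add: zero_fun_def case_prod_unfold)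
next
  case (step c a b y)
  have "contract_right (\<lambda>x. p (b \<otimes> x)) t \<in> D"
    using contract_right_in[OF functional_on_tensor[OF p B step(2)] D B t] .
  then have "a \<otimes> contract_right (\<lambda>x. p (b \<otimes> x)) t \<in> tens C D"
    using step(1) by (intro tensor_in_tens)
  then have "fscale c (\<lambda>(i, j). p (\<lambda>(i', j'). (a \<otimes> b) (i, i') * t (j, j'))) +
      (\<lambda>(i, j). p (\<lambda>(i', j'). y (i, i') * t (j, j'))) \<in> tens C D"
    using step(4) unfolding pairing_matrix_tensor[OF p A B step(2) t]
    by (intro fs.subspace_add fs.subspace_scale tens_subspace)
  then show ?case
    using pairing_matrix_step[OF p A B tensor_in_tens[OF step(1,2)] step(3) t] by simp
qed

lemma pairing_square_step_left:
  assumes p: "functional_on (tens A B) p" and A: "fs.subspace A" and B: "fs.subspace B"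
    and "s \<in> tens A A" "s' \<in> tens A A" "t \<in> tens B B"
  shows "pairing_square p (fscale c s + s') t = c * pairing_square p s t + pairing_square p s' t"
  unfolding pairing_square_def pairing_matrix_step[OF assms]
  using assms by (intro linear_on_step[OF p] fs.subspace_scale tens_subspace pairing_matrix_in)

text \<open>Pairing the second legs with \<open>y\<close> is a contraction, and what remains is an
  ordinary pairing with \<open>x\<close>. For \<open>s = Delta F\<close> this turns the double
  pairing into an iterated one.\<close>

lemma pairing_square_tensor_right:
  assumes p: "functional_on (tens A B) p" and A: "fs.subspace A" and B: "fs.subspace B"
    and "s \<in> tens A A" "x \<in> B" "y \<in> B"
  shows "pairing_square p s (x \<otimes> y) = p (contract_right (\<lambda>a. p (a \<otimes> y)) s \<otimes> x)"
proof -
  have "p (\<lambda>(i', j'). s (i, i') * (x \<otimes> y) (j, j')) =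
      (contract_right (\<lambda>a. p (a \<otimes> y)) s \<otimes> x) (i, j)" for i j
  proof -
    have "(\<lambda>(i', j'). s (i, i') * (x \<otimes> y) (j, j')) = fscale (x j) ((\<lambda>i'. s (i, i')) \<otimes> y)"
      by (auto simp: fun_apply mult_ac)
    moreover have "(\<lambda>i'. s (i, i')) \<otimes> y \<in> tens A B"
      using assms by (auto intro!: tensor_in_tens dest: tens_slice_right)
    ultimately show ?thesis
      using p by (simp add: linear_on_def contract_right_def)
  qed
  then show ?thesis
    unfolding pairing_square_def by (intro arg_cong[of _ _ p]) auto
qed

section \<open>Tensor algebras\<close>

lemma conc_flinear: "flinear UNIV UNIV conc"
  by (auto simp: linear_on_def conc_def fun_eq_iff fun_apply sum.distrib sum_distrib_left)

lemma conc_zero: "conc 0 = 0"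
  by (auto simp: conc_def fun_apply)

lemma conc_step: "conc (fscale c s + t) = fscale c (conc s) + conc t"
  by (rule linear_on_step[OF conc_flinear]) simp_all

lemma conc_fscale: "conc (fscale c t) = fscale c (conc t)"
  using conc_flinear by (auto simp: linear_on_def)

lemma conc_unit_left [simp]: "conc (word [] \<otimes> a) = a"
proof (rule ext)
  fix xs
  have "conc (word [] \<otimes> a) xs = (\<Sum>k\<in>{0}. word [] (take k xs) * a (drop k xs))"
    unfolding conc_def by (intro sum.mono_neutral_cong_right) (auto simp: word_def)
  then show "conc (word [] \<otimes> a) xs = a xs" by (simp add: word_def)
qed

lemma conc_unit_right [simp]: "conc (a \<otimes> word []) = a"
proof (rule ext)
  fix xs
  have "conc (a \<otimes> word []) xs = (\<Sum>k\<in>{length xs}. a (take k xs) * word [] (drop k xs))"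
    unfolding conc_def by (intro sum.mono_neutral_cong_right) (auto simp: word_def)
  then show "conc (a \<otimes> word []) xs = a xs" by (simp add: word_def)
qed

lemma conc_Nil: "conc (A \<otimes> B) [] = A [] * B []"
  by (simp add: conc_def)

text \<open>The cut before \<open>x\<close> gives the first summand; every other cut leaves
  \<open>x\<close> in the left factor.\<close>

lemma conc_Cons: "conc (A \<otimes> B) (x # xs) = A [] * B (x # xs) + conc ((\<lambda>l. A (x # l)) \<otimes> B) xs"
  by (simp add: conc_def sum.atMost_Suc_shift del: sum.atMost_Suc)

lemma word_Nil_apply: "word [] xs = (if xs = [] then 1 else 0)"
  by (simp add: word_def)

lemma word_single_apply: "word [f] xs = (case xs of [x] \<Rightarrow> f x | _ \<Rightarrow> 0)"
  by (auto simp: word_def split: list.splits)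

lemma word_single_Cons: "(\<lambda>l. word [f] (x # l)) = fscale (f x) (word [])"
  by (auto simp: word_single_apply word_Nil_apply fscale_apply split: list.splits)

lemma word_Cons: "word (f # fs) = conc (word [f] \<otimes> word fs)"
  by (simp add: conc_word)

lemma conc_single_left:
  "conc (word [f] \<otimes> G) xs = (case xs of [] \<Rightarrow> 0 | x # xs' \<Rightarrow> f x * G xs')"
proof (cases xs)
  case (Cons x xs')
  then show ?thesis
    by (simp add: conc_Cons tensor_bilinear word_single_Cons conc_fscale fscale_apply)
       (simp add: word_single_apply)
qed (simp add: conc_Nil word_def)

lemma word_Cons_apply: "word (f # fs) xs = (case xs of [] \<Rightarrow> 0 | x # xs' \<Rightarrow> f x * word fs xs')"
  by (simp only: word_Cons[of f fs] conc_single_left)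

lemma word_nonzero_length: "word vs xs \<noteq> 0 \<Longrightarrow> length xs = length vs"
  by (auto simp: word_def split: if_splits)

lemma tensor_algebra_subspace [simp]: "fs.subspace (tensor_algebra V)"
  by (simp add: tensor_algebra_def)

lemma word_in_tensor_algebra: "set vs \<subseteq> V \<Longrightarrow> word vs \<in> tensor_algebra V"
  unfolding tensor_algebra_def by (intro fs.span_base) auto

lemma tensor_algebra_induct [consumes 1, case_names zero step]:
  assumes "F \<in> tensor_algebra V" "Q 0"
    and "\<And>c vs F. set vs \<subseteq> V \<Longrightarrow> F \<in> tensor_algebra V \<Longrightarrow> Q F \<Longrightarrow> Q (fscale c (word vs) + F)"
  shows "Q F"
  using assms(1) unfolding tensor_algebra_def
proof (induction rule: span_lin_induct)
  case (step c x y)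
  then obtain vs where "x = word vs" "set vs \<subseteq> V" by blast
  with step assms(3) show ?case unfolding tensor_algebra_def by blast
qed (rule assms(2))

lemma conc_in_tensor_algebra:
  assumes "F \<in> tensor_algebra V" "G \<in> tensor_algebra V"
  shows "conc (F \<otimes> G) \<in> tensor_algebra V"
  using assms(1)
proof (induction rule: tensor_algebra_induct)
  case zero
  then show ?case by (simp add: tensor_bilinear conc_zero fs.subspace_0)
next
  case (step c vs F)
  have "conc (word vs \<otimes> G) \<in> tensor_algebra V"
    using assms(2)
  proof (induction rule: tensor_algebra_induct)
    case zero
    then show ?case by (simp add: tensor_bilinear conc_zero fs.subspace_0)
  next
    case (step d us G)
    then show ?case using \<open>set vs \<subseteq> V\<close>
      by (simp add: tensor_bilinear conc_step conc_word fs.subspace_add fs.subspace_scale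
          word_in_tensor_algebra)
  qed
  then show ?case using step
    by (simp add: tensor_bilinear conc_step fs.subspace_add fs.subspace_scale)
qed

lemma conc_tens_in_tensor_algebra:
  assumes "t \<in> tens (tensor_algebra V) (tensor_algebra V)"
  shows "conc t \<in> tensor_algebra V"
  using assms
  by (induction rule: tens_induct)
    (simp_all add: conc_zero fs.subspace_0 conc_step fs.subspace_add fs.subspace_scale
      conc_in_tensor_algebra)

text \<open>Prepending one letter is the only case in which cuts have to be compared; longer words
  follow by peeling off letters, with \<open>A\<close> and \<open>H\<close> arbitrary
  functions.\<close>

lemma conc_single_assoc:
  "conc (conc (word [v] \<otimes> A) \<otimes> H) = conc (word [v] \<otimes> conc (A \<otimes> H))"
proof (rule ext)
  fix xs
  show "conc (conc (word [v] \<otimes> A) \<otimes> H) xs = conc (word [v] \<otimes> conc (A \<otimes> H)) xs"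
  proof (cases xs)
    case (Cons x xs')
    have "(\<lambda>l. conc (word [v] \<otimes> A) (x # l)) = fscale (v x) A"
      by (auto simp: conc_single_left fun_apply)
    then show ?thesis using Cons
      by (simp add: conc_Cons conc_Nil tensor_bilinear conc_fscale word_single_Cons fscale_apply)
         (simp add: word_single_apply)
  qed (simp add: conc_Nil word_def)
qed

lemma conc_word_assoc:
  "conc (conc (word vs \<otimes> G) \<otimes> H) = conc (word vs \<otimes> conc (G \<otimes> H))"
proof (induction vs arbitrary: G)
  case Nil
  then show ?case by simp
next
  case (Cons v vs)
  then show ?case by (simp only: word_Cons[of v vs] conc_single_assoc)
qed

lemma conc_assoc:
  assumes "F \<in> tensor_algebra V"
  shows "conc (conc (F \<otimes> G) \<otimes> H) = conc (F \<otimes> conc (G \<otimes> H))"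
  using assms
  by (induction rule: tensor_algebra_induct)
    (simp_all add: tensor_bilinear conc_zero conc_step conc_word_assoc)

lemma algebra_on_tensor_algebra: "algebra_on (tensor_algebra V) conc (word [])"
  unfolding algebra_on_def
  by (auto intro: linear_on_subset[OF conc_flinear] conc_tens_in_tensor_algebra conc_assoc
      word_in_tensor_algebra)

lemma word_single_in_tensor_algebra:
  assumes "v \<in> fs.span S"
  shows "word [v] \<in> tensor_algebra S"
  using assms
proof (induction rule: span_lin_induct)
  case zero
  have "word [0 :: 'a \<Rightarrow> 'b] = 0" by (auto simp: word_single_apply fun_apply split: list.splits)
  then show ?case by (simp add: fs.subspace_0)
next
  case (step c x y)
  have "word [fscale c x + y] = fscale c (word [x]) + word [y]"
    by (auto simp: word_single_apply fun_apply split: list.splits)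
  with step show ?case
    by (simp add: fs.subspace_add fs.subspace_scale word_in_tensor_algebra)
qed

text \<open>This allows \<open>T_dual\<close> to be generated by words in homogeneous forms,
  although \<open>graded_dual\<close> also contains sums of forms of different arities.\<close>

lemma tensor_algebra_span: "tensor_algebra (fs.span S) = tensor_algebra S"
proof
  have "word vs \<in> tensor_algebra S" if "set vs \<subseteq> fs.span S" for vs
    using that
  proof (induction vs)
    case Nil
    then show ?case by (intro word_in_tensor_algebra) simp
  next
    case (Cons v vs)
    then show ?case
      by (subst word_Cons) (auto intro: conc_in_tensor_algebra word_single_in_tensor_algebra)
  qed
  then show "tensor_algebra (fs.span S) \<subseteq> tensor_algebra S"
    unfolding tensor_algebra_def[of "fs.span S"] by (intro fs.span_minimal) auto
  show "tensor_algebra S \<subseteq> tensor_algebra (fs.span S)"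
    unfolding tensor_algebra_def by (intro fs.span_mono) (auto dest: subsetD[OF fs.span_superset])
qed

section \<open>Homogeneous components and multilinear functions\<close>

lemma vector_space_over_itself: "vector_space ((*) :: 'k::field \<Rightarrow> 'k \<Rightarrow> 'k)"
  by unfold_locales (auto simp: algebra_simps)

context operad
begin

abbreviation lin :: "('v \<Rightarrow> 'k) \<Rightarrow> bool" where
  "lin \<equiv> Vector_Spaces.linear scale (*)"

lemma linI: "(\<And>c x y. \<phi> (scale c x + y) = c * \<phi> x + \<phi> y) \<Longrightarrow> lin \<phi>"
proof -
  assume *: "\<And>c x y. \<phi> (scale c x + y) = c * \<phi> x + \<phi> y"
  have "\<phi> (x + y) = \<phi> x + \<phi> y" for x y using *[of 1 x y] by simp
  moreover from this[of 0 0] have "\<phi> 0 = 0" by simp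
  moreover from this have "\<phi> (scale c x) = c * \<phi> x" for c x using *[of c x 0] by simp
  ultimately show "lin \<phi>"
    by (auto simp: Vector_Spaces.linear_iff vector_space_axioms vector_space_over_itself)
qed

lemma lin_step: "lin \<phi> \<Longrightarrow> \<phi> (scale c x + y) = c * \<phi> x + \<phi> y"
  by (simp add: Vector_Spaces.linear_iff)

lemma lin_zero: "lin \<phi> \<Longrightarrow> \<phi> 0 = 0"
  using lin_step[of \<phi> 1 0 0] by simp

lemma lin_sum: "lin \<phi> \<Longrightarrow> \<phi> (\<Sum>a\<in>S. g a) = (\<Sum>a\<in>S. \<phi> (g a))"
  by (induction S rule: infinite_finite_induct) (auto simp: Vector_Spaces.linear_iff lin_zero)

lemma P_subspace: "subspace (P n)"
  using arity_grading by (simp add: is_grading_def)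

text \<open>\<open>is_grading\<close> provides the unique existence that the definite description in
  \<open>hcomp\<close> requires. Writing the decomposition with \<open>Sum_any\<close> hides its
  support, so decompositions of different vectors can be compared over a common finite set.\<close>

lemma
  shows hcomp_in: "hcomp P n x \<in> P n"
    and hcomp_finite: "finite {n. hcomp P n x \<noteq> 0}"
    and hcomp_sum: "x = Sum_any (\<lambda>n. hcomp P n x)"
    and hcomp_eqI: "\<lbrakk>\<And>n. c n \<in> P n; finite {n. c n \<noteq> 0}; x = Sum_any c\<rbrakk> \<Longrightarrow> hcomp P n x = c n"
proof -
  let ?Q = "\<lambda>c. (\<forall>n. c n \<in> P n) \<and> finite {n. c n \<noteq> 0} \<and> x = (\<Sum>n | c n \<noteq> 0. c n)"
  have ex1: "\<exists>!c. ?Q c"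
    using arity_grading by (simp add: is_grading_def)
  have "?Q (\<lambda>n. hcomp P n x)"
    using theI'[OF ex1] by (simp add: hcomp_def)
  then show "hcomp P n x \<in> P n" "finite {n. hcomp P n x \<noteq> 0}" "x = Sum_any (\<lambda>n. hcomp P n x)"
    by (auto simp: Sum_any.expand_set)
  show "hcomp P n x = c n" if "\<And>n. c n \<in> P n" "finite {n. c n \<noteq> 0}" "x = Sum_any c"
    using the1_equality[OF ex1, of c] that by (simp add: hcomp_def Sum_any.expand_set)
qed

lemma hcomp_step: "hcomp P n (scale c x + y) = scale c (hcomp P n x) + hcomp P n y"
proof (rule hcomp_eqI)
  let ?S = "{n. hcomp P n x \<noteq> 0} \<union> {n. hcomp P n y \<noteq> 0}"
  have fin: "finite ?S" by (simp add: hcomp_finite)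
  show "scale c (hcomp P n x) + hcomp P n y \<in> P n" for n
    by (intro subspace_add subspace_scale P_subspace hcomp_in)
  show "finite {n. scale c (hcomp P n x) + hcomp P n y \<noteq> 0}"
    by (rule finite_subset[OF _ fin]) auto
  have "Sum_any (\<lambda>n. scale c (hcomp P n x) + hcomp P n y) = (\<Sum>n\<in>?S. scale c (hcomp P n x) + hcomp P n y)"
    by (rule Sum_any.expand_superset[OF fin]) auto
  also have "\<dots> = scale c (\<Sum>n\<in>?S. hcomp P n x) + (\<Sum>n\<in>?S. hcomp P n y)"
    by (simp only: sum.distrib scale_sum_right)
  also have "(\<Sum>n\<in>?S. hcomp P n x) = x"
    by (subst (2) hcomp_sum[of x]) (rule Sum_any.expand_superset[OF fin, symmetric], auto)
  also have "(\<Sum>n\<in>?S. hcomp P n y) = y"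
    by (subst (2) hcomp_sum[of y]) (rule Sum_any.expand_superset[OF fin, symmetric], auto)
  finally show "scale c x + y = Sum_any (\<lambda>n. scale c (hcomp P n x) + hcomp P n y)" ..
qed

lemma hcomp_homogeneous: "x \<in> P m \<Longrightarrow> hcomp P n x = (if n = m then x else 0)"
proof (rule hcomp_eqI)
  assume x: "x \<in> P m"
  show "(if n = m then x else 0) \<in> P n" for n
    using x P_subspace by (auto intro: subspace_0)
  show "finite {n. (if n = m then x else 0) \<noteq> 0}"
    by (rule finite_subset[of _ "{m}"]) auto
  show "x = Sum_any (\<lambda>n. if n = m then x else 0)"
    by (subst Sum_any.expand_superset[of "{m}"]) auto
qed

lemma P_disjoint: "x \<in> P m \<Longrightarrow> x \<in> P n \<Longrightarrow> m \<noteq> n \<Longrightarrow> x = 0"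
  using hcomp_homogeneous[of x m n] hcomp_homogeneous[of x n n] by simp

lemma P_zero: "0 \<in> P n"
  using P_subspace by (rule subspace_0)

text \<open>The composition, extended by \<open>0\<close> to arguments of the wrong number.\<close>

definition act :: "'v \<Rightarrow> 'v list \<Rightarrow> 'v" where
  "act x ys = \<gamma> (hcomp P (length ys) x) ys"

lemma comp_zero_left: "length qs = n \<Longrightarrow> \<gamma> 0 qs = 0"
  using comp_scale_left[of 0 n qs 0] P_zero by simp

lemma act_step: "act (scale c x + y) ys = scale c (act x ys) + act y ys"
  unfolding act_def hcomp_step
  by (simp add: comp_add_left[of _ "length ys"] comp_scale_left[of _ "length ys"] hcomp_in
      subspace_scale P_subspace)

lemma act_homogeneous: "x \<in> P n \<Longrightarrow> act x ys = (if length ys = n then \<gamma> x ys else 0)"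
  by (auto simp: act_def hcomp_homogeneous comp_zero_left)

lemma act_unit: "act I ys = (case ys of [y] \<Rightarrow> y | _ \<Rightarrow> 0)"
  using act_homogeneous[OF unit_in] by (auto simp: unit_left split: list.splits)

lemma lin_act: "lin \<phi> \<Longrightarrow> lin (\<lambda>x. \<phi> (act x ys))"
  by (intro linI) (simp add: act_step lin_step)

text \<open>One function holds a multilinear map for each length, with no relation between the
  lengths. The elements of \<open>T_dual\<close> are of this kind, and so are the coproduct and the
  product as functions of their arguments.\<close>

definition mlin :: "('v list \<Rightarrow> 'k) \<Rightarrow> bool" where
  "mlin F \<longleftrightarrow> (\<forall>us ws c x y. F (us @ (scale c x + y) # ws) = c * F (us @ x # ws) + F (us @ y # ws))"

lemma mlinI:
  "(\<And>us ws c x y. F (us @ (scale c x + y) # ws) = c * F (us @ x # ws) + F (us @ y # ws)) \<Longrightarrow> mlin F"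
  by (simp add: mlin_def)

lemma mlin_step:
  "mlin F \<Longrightarrow> F (us @ (scale c x + y) # ws) = c * F (us @ x # ws) + F (us @ y # ws)"
  by (simp add: mlin_def)

lemma mlin_zero: "mlin (\<lambda>l. 0)"
  by (simp add: mlin_def)

lemma mlin_add: "mlin F \<Longrightarrow> mlin G \<Longrightarrow> mlin (\<lambda>l. F l + G l)"
  by (simp add: mlin_def algebra_simps)

lemma mlin_mult: "mlin F \<Longrightarrow> mlin (\<lambda>l. a * F l)"
  by (simp add: mlin_def algebra_simps)

lemma mlin_sum: "(\<And>a. a \<in> S \<Longrightarrow> mlin (F a)) \<Longrightarrow> mlin (\<lambda>l. \<Sum>a\<in>S. F a l)"
  by (induction S rule: infinite_finite_induct) (auto intro: mlin_zero mlin_add)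

lemma mlin_act: "lin \<phi> \<Longrightarrow> mlin (\<lambda>ys. \<phi> (act x ys))"
proof (rule mlinI)
  fix us ws :: "'v list" and c p q
  assume \<phi>: "lin \<phi>"
  let ?x = "hcomp P (Suc (length us + length ws)) x"
  have "\<gamma> ?x (us @ (scale c p + q) # ws) = scale c (\<gamma> ?x (us @ p # ws)) + \<gamma> ?x (us @ q # ws)"
    by (simp add: comp_add_right[OF hcomp_in] comp_scale_right[OF hcomp_in])
  then show "\<phi> (act x (us @ (scale c p + q) # ws)) = c * \<phi> (act x (us @ p # ws)) + \<phi> (act x (us @ q # ws))"
    using \<phi> by (simp add: act_def lin_step)
qed

lemma mlin_cons: "mlin F \<Longrightarrow> mlin (\<lambda>l. F (x # l))"
proof (rule mlinI)
  fix us ws c p q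
  assume "mlin F"
  from mlin_step[OF this, of "x # us" c p q ws]
  show "F (x # us @ (scale c p + q) # ws) = c * F (x # us @ p # ws) + F (x # us @ q # ws)" by simp
qed

lemma lin_mlin_hd: "mlin F \<Longrightarrow> lin (\<lambda>x. F (x # l))"
proof (rule linI)
  fix c x y
  assume "mlin F"
  from mlin_step[OF this, of "[]" c x y l]
  show "F ((scale c x + y) # l) = c * F (x # l) + F (y # l)" by simp
qed

lemma mlin_conc:
  assumes "mlin A" "mlin B"
  shows "mlin (conc (A \<otimes> B))"
proof (rule mlinI)
  fix us ws c x y
  have "A (take k (us @ (scale c x + y) # ws)) * B (drop k (us @ (scale c x + y) # ws)) =
      c * (A (take k (us @ x # ws)) * B (drop k (us @ x # ws))) +
      A (take k (us @ y # ws)) * B (drop k (us @ y # ws))" for k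
  \<comment> \<open>A cut at or before the varying letter leaves that letter in the second factor, a
    later cut leaves it in the first.\<close>
  proof (cases "k \<le> length us")
    case True
    then show ?thesis by (simp add: mlin_step[OF assms(2)] distrib_left mult.left_commute)
  next
    case False
    then obtain j where "k = Suc (length us + j)"
      by (metis add_Suc_right less_imp_Suc_add not_le)
    then show ?thesis by (simp add: mlin_step[OF assms(1)] distrib_right mult.assoc)
  qed
  then show "conc (A \<otimes> B) (us @ (scale c x + y) # ws) =
      c * conc (A \<otimes> B) (us @ x # ws) + conc (A \<otimes> B) (us @ y # ws)"
    by (simp only: conc_def tensor_apply length_append list.size sum_distrib_left sum.distrib)
qed

lemma mlin_word_Nil: "mlin (word [])"
  by (rule mlinI) (simp add: word_Nil_apply)

lemma mlin_word_single: "lin f \<Longrightarrow> mlin (word [f])"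
proof (rule mlinI)
  fix us ws :: "'v list" and c x y
  assume f: "lin f"
  show "word [f] (us @ (scale c x + y) # ws) = c * word [f] (us @ x # ws) + word [f] (us @ y # ws)"
    by (cases "us = [] \<and> ws = []") (auto simp: word_def lin_step[OF f])
qed

lemma mlin_word: "(\<And>f. f \<in> set fs \<Longrightarrow> lin f) \<Longrightarrow> mlin (word fs)"
proof (induction fs)
  case (Cons f fs)
  then show ?case by (subst word_Cons) (intro mlin_conc mlin_word_single, auto)
qed (rule mlin_word_Nil)

lemma dual_component_lin: "f \<in> dual_component scale P n \<Longrightarrow> lin f"
  by (simp add: dual_component_def)

definition hdual :: "('v \<Rightarrow> 'k) set" where
  "hdual = (\<Union>n\<in>{1..}. dual_component scale P n)"

lemma graded_dual_hdual: "graded_dual scale P = fs.span hdual"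
  by (simp add: graded_dual_def hdual_def)

lemma T_dual_hdual: "T_dual scale P = tensor_algebra hdual"
  by (simp add: graded_dual_hdual tensor_algebra_span)

lemma hdual_lin: "f \<in> hdual \<Longrightarrow> lin f"
  by (auto simp: hdual_def dual_component_lin)

lemma mlin_T_dual: "F \<in> T_dual scale P \<Longrightarrow> mlin F"
  unfolding T_dual_hdual
proof (induction rule: tensor_algebra_induct)
  case zero
  show ?case by (simp add: mlin_def zero_fun_apply)
next
  case (step c vs F)
  then have "mlin (word vs)" by (intro mlin_word hdual_lin) auto
  with step(3) show ?case
    by (auto simp: fun_apply intro!: mlin_add mlin_mult simp: plus_fun_def fscale_def)
qed

end

locale fd_operad = operad scale P \<gamma> I
  for scale :: "'k::field_char_0 \<Rightarrow> 'v::ab_group_add \<Rightarrow> 'v" and P and \<gamma> and I +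
  assumes P_0: "P 0 = {0}"
    and P_finite_dimensional: "finite_dimensional scale (P n)"
begin

section \<open>A homogeneous basis\<close>

definition bas :: "nat \<Rightarrow> 'v set" where
  "bas n = (SOME B. finite B \<and> independent B \<and> span B = P n)"

lemma
  shows bas_finite: "finite (bas n)" and bas_independent: "independent (bas n)"
    and bas_span: "span (bas n) = P n"
proof -
  obtain T where T: "finite T" "P n = span T"
    using P_finite_dimensional[of n] by (auto simp: finite_dimensional_def)
  obtain B where B: "B \<subseteq> P n" "independent B" "P n \<subseteq> span B"
    using maximal_independent_subset by blast
  have "finite B"
    using independent_span_bound[OF T(1) B(2)] B(1) T(2) by auto
  moreover have "span B = P n"
    using B P_subspace span_minimal by blast
  ultimately have "finite B \<and> independent B \<and> span B = P n"
    using B by blast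
  then have "finite (bas n) \<and> independent (bas n) \<and> span (bas n) = P n"
    unfolding bas_def by (rule someI)
  then show "finite (bas n)" "independent (bas n)" "span (bas n) = P n" by auto
qed

definition deg :: "'v \<Rightarrow> nat" where
  "deg b = (THE n. b \<in> bas n)"

definition basis :: "'v set" where
  "basis = (\<Union>n. bas n)"

lemma bas_in_P: "b \<in> bas n \<Longrightarrow> b \<in> P n"
  using bas_span span_base by blast

lemma deg_bas: "b \<in> bas n \<Longrightarrow> deg b = n"
  unfolding deg_def
proof (rule the_equality)
  fix m assume "b \<in> bas n" "b \<in> bas m"
  moreover from this have "b \<noteq> 0" using bas_independent dependent_zero by metis
  ultimately show "m = n" using P_disjoint bas_in_P by metis
qed

lemma basis_bas: "b \<in> basis \<Longrightarrow> b \<in> bas (deg b)"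
  by (auto simp: basis_def deg_bas)

lemma basis_in_P: "b \<in> basis \<Longrightarrow> b \<in> P (deg b)"
  by (simp add: basis_bas bas_in_P)

text \<open>Here P(0) = 0 enters. Since all degrees are positive, the total degree of a basis word
  bounds its length, which is what makes the coproduct a finite sum.\<close>

lemma deg_pos: "b \<in> basis \<Longrightarrow> 1 \<le> deg b"
proof (rule ccontr)
  assume b: "b \<in> basis" "\<not> 1 \<le> deg b"
  then have "deg b = 0" by simp
  then have "b \<in> bas 0" "b = 0" using basis_bas[OF b(1)] basis_in_P[OF b(1)] P_0 by simp_all
  then show False using bas_independent[of 0] dependent_zero by metis
qed

text \<open>The coordinate form of \<open>b\<close>, taken as zero when \<open>b\<close> is not a
  basis vector. Then \<open>word (map co bs)\<close> vanishes unless all letters of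
  \<open>bs\<close> are basis vectors, and coordinate sums may run over all lists.\<close>

definition co :: "'v \<Rightarrow> 'v \<Rightarrow> 'k" where
  "co b v = (if b \<in> basis then representation (bas (deg b)) (hcomp P (deg b) v) b else 0)"

lemma lin_co: "lin (co b)"
proof (rule linI)
  fix c x y
  have "hcomp P n z \<in> span (bas n)" for n z by (simp add: bas_span hcomp_in)
  then show "co b (scale c x + y) = c * co b x + co b y"
    by (simp add: co_def hcomp_step representation_add representation_scale span_scale bas_independent)
qed

lemma co_nonzero: "co b v \<noteq> 0 \<Longrightarrow> b \<in> basis \<and> hcomp P (deg b) v \<noteq> 0"
  by (auto simp: co_def representation_zero split: if_splits)

lemma co_homogeneous: "x \<in> P n \<Longrightarrow> n \<noteq> deg b \<Longrightarrow> co b x = 0"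
  using co_nonzero hcomp_homogeneous by metis

lemma co_dual_component: "co b \<in> dual_component scale P (deg b)"
  by (auto simp: dual_component_def lin_co co_homogeneous)

lemma co_hdual: "b \<in> basis \<Longrightarrow> co b \<in> hdual"
  using co_dual_component deg_pos by (auto simp: hdual_def)

lemma co_basis: "b \<in> basis \<Longrightarrow> b' \<in> basis \<Longrightarrow> co b b' = (if b = b' then 1 else 0)"
proof -
  assume b: "b \<in> basis" "b' \<in> basis"
  show ?thesis
  proof (cases "deg b = deg b'")
    case True
    then show ?thesis
      using b by (simp add: co_def hcomp_homogeneous[OF basis_in_P] representation_basis bas_independent basis_bas)
  next
    case False
    then show ?thesis using co_homogeneous[OF basis_in_P[OF b(2)]] by auto
  qed
qed

lemma co_finite: "finite {b. co b v \<noteq> 0}"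
proof (rule finite_subset)
  show "{b. co b v \<noteq> 0} \<subseteq> (\<Union>n\<in>{n. hcomp P n v \<noteq> 0}. bas n)"
    using co_nonzero basis_bas by blast
  show "finite (\<Union>n\<in>{n. hcomp P n v \<noteq> 0}. bas n)"
    by (intro finite_UN_I hcomp_finite bas_finite)
qed

lemma co_expand: "v = (\<Sum>b | co b v \<noteq> 0. scale (co b v) b)"
proof -
  let ?N = "{n. hcomp P n v \<noteq> 0}"
  have inj: "bas m \<inter> bas n = {}" if "m \<noteq> n" for m n
    using that deg_bas by blast
  have "v = (\<Sum>n\<in>?N. hcomp P n v)"
    using hcomp_sum[of v] by (simp add: Sum_any.expand_set)
  also have "\<dots> = (\<Sum>n\<in>?N. \<Sum>b\<in>bas n. scale (co b v) b)"
  proof (rule sum.cong[OF refl])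
    fix n
    have "hcomp P n v = (\<Sum>b\<in>bas n. scale (representation (bas n) (hcomp P n v) b) b)"
      by (rule sum_representation_eq[symmetric]) (auto simp: bas_independent bas_span hcomp_in bas_finite)
    also have "\<dots> = (\<Sum>b\<in>bas n. scale (co b v) b)"
      by (intro sum.cong refl) (auto simp: co_def deg_bas basis_def)
    finally show "hcomp P n v = (\<Sum>b\<in>bas n. scale (co b v) b)" .
  qed
  also have "\<dots> = (\<Sum>b\<in>(\<Union>n\<in>?N. bas n). scale (co b v) b)"
    by (rule sum.UNION_disjoint[symmetric]) (auto simp: hcomp_finite bas_finite inj)
  also have "\<dots> = (\<Sum>b | co b v \<noteq> 0. scale (co b v) b)"
    by (rule sum.mono_neutral_right) (auto simp: hcomp_finite bas_finite dest: co_nonzero intro: basis_bas)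
  finally show ?thesis .
qed

lemma lin_expand:
  assumes "lin \<phi>" "finite K" "{b. co b v \<noteq> 0} \<subseteq> K"
  shows "\<phi> v = (\<Sum>b\<in>K. co b v * \<phi> b)"
proof -
  have "\<phi> v = \<phi> (\<Sum>b | co b v \<noteq> 0. scale (co b v) b)"
    using co_expand[of v] by simp
  also have "\<dots> = (\<Sum>b | co b v \<noteq> 0. co b v * \<phi> b)"
    using assms(1) by (simp add: lin_sum Vector_Spaces.linear_iff)
  also have "\<dots> = (\<Sum>b\<in>K. co b v * \<phi> b)"
    using assms by (intro sum.mono_neutral_left) auto
  finally show ?thesis .
qed

lemma mlin_expand:
  assumes "mlin M" "finite K" "\<And>v. v \<in> set vs \<Longrightarrow> {b. co b v \<noteq> 0} \<subseteq> K"
  shows "M vs = (\<Sum>bs | set bs \<subseteq> K \<and> length bs = length vs. word (map co bs) vs * M bs)"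
  using assms
proof (induction vs arbitrary: M)
  case Nil
  have "{bs. set bs \<subseteq> K \<and> length bs = length []} = {[]}" by auto
  then show ?case by (simp add: word_Nil_apply)
next
  case (Cons v vs)
  let ?L = "\<lambda>n. {bs. set bs \<subseteq> K \<and> length bs = n}"
  have "(\<Sum>bs\<in>?L (Suc (length vs)). word (map co bs) (v # vs) * M bs) =
      (\<Sum>(bs, b)\<in>?L (length vs) \<times> K. word (map co (b # bs)) (v # vs) * M (b # bs))"
    unfolding lists_length_Suc_eq
    by (subst sum.reindex) (auto simp: inj_on_def case_prod_unfold)
  also have "\<dots> = (\<Sum>(bs, b)\<in>?L (length vs) \<times> K. co b v * (word (map co bs) vs * M (b # bs)))"
    by (simp add: word_Cons_apply mult.assoc)
  also have "\<dots> = (\<Sum>b\<in>K. co b v * (\<Sum>bs\<in>?L (length vs). word (map co bs) vs * M (b # bs)))"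
    by (subst sum.cartesian_product[symmetric], subst sum.swap) (simp add: sum_distrib_left)
  also have "\<dots> = (\<Sum>b\<in>K. co b v * M (b # vs))"
    by (intro sum.cong refl arg_cong2[of _ _ _ _ "(*)"] Cons.IH[symmetric] mlin_cons Cons.prems) auto
  also have "\<dots> = M (v # vs)"
    by (intro lin_expand[symmetric] lin_mlin_hd Cons.prems) auto
  finally show ?case by simp
qed

text \<open>The words \<open>map co bs\<close> are dual to the basis words \<open>bs\<close>, so a
  multilinear function is recovered from its values at basis words. The sum is finite: only lists as
  long as \<open>vs\<close>, with letters from the supports of the letters of \<open>vs\<close>,
  contribute.\<close>

lemma
  shows word_co_finite: "finite {bs. word (map co bs) vs \<noteq> 0}"
    and mlin_Sum_any: "mlin M \<Longrightarrow> Sum_any (\<lambda>bs. word (map co bs) vs * M bs) = M vs"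
    and word_co_basis: "word (map co bs) vs \<noteq> 0 \<Longrightarrow> set bs \<subseteq> basis"
proof -
  let ?K = "\<Union>v\<in>set vs. {b. co b v \<noteq> 0}"
  let ?L = "{bs. set bs \<subseteq> ?K \<and> length bs = length vs}"
  have fin: "finite ?K" by (simp add: co_finite)
  have sub: "bs \<in> ?L" if "word (map co bs) vs \<noteq> 0" for bs
    using that
  proof (induction vs arbitrary: bs)
    case Nil
    then show ?case by (auto simp: word_def split: if_splits)
  next
    case (Cons v vs)
    then obtain b bs' where "bs = b # bs'"
      by (cases bs) (auto simp: word_Nil_apply)
    with Cons show ?case by (fastforce simp: word_Cons_apply)
  qed
  have finL: "finite ?L" using fin by (rule finite_lists_length_eq)
  show "finite {bs. word (map co bs) vs \<noteq> 0}"
    by (rule finite_subset[OF _ finL]) (use sub in auto)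
  show "Sum_any (\<lambda>bs. word (map co bs) vs * M bs) = M vs" if "mlin M"
  proof -
    have "Sum_any (\<lambda>bs. word (map co bs) vs * M bs) = (\<Sum>bs\<in>?L. word (map co bs) vs * M bs)"
      by (rule Sum_any.expand_superset[OF finL]) (use sub in auto)
    also have "\<dots> = M vs"
      by (rule mlin_expand[OF that fin, symmetric]) auto
    finally show ?thesis .
  qed
  show "set bs \<subseteq> basis" if "word (map co bs) vs \<noteq> 0"
    using sub[OF that] co_nonzero by blast
qed

text \<open>Reduces multilinear identities to words in homogeneous vectors. The operad axioms can be
  applied only there, because they mention arities.\<close>

lemma mlin_eqI:
  assumes "mlin M" "mlin N" "\<And>bs. set bs \<subseteq> basis \<Longrightarrow> length bs = length vs \<Longrightarrow> M bs = N bs"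
  shows "M vs = N vs"
proof -
  have "M vs = Sum_any (\<lambda>bs. word (map co bs) vs * M bs)"
    using assms(1) by (simp only: mlin_Sum_any)
  also have "\<dots> = Sum_any (\<lambda>bs. word (map co bs) vs * N bs)"
  proof (rule Sum_any.cong)
    fix bs
    show "word (map co bs) vs * M bs = word (map co bs) vs * N bs"
      using assms(3)[of bs] word_co_basis[of bs vs] word_nonzero_length[of "map co bs" vs]
      by (cases "word (map co bs) vs = 0") auto
  qed
  also have "\<dots> = N vs"
    using assms(2) by (simp only: mlin_Sum_any)
  finally show ?thesis .
qed

end

section \<open>The coproduct\<close>

text \<open>Cuts into three pieces, listed by the first cut and the length of the middle piece, or
  by the second cut and then the first.\<close>

lemma sum_triangle:
  fixes g :: "nat \<Rightarrow> nat \<Rightarrow> 'b::comm_monoid_add"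
  shows "(\<Sum>i\<le>n. \<Sum>j\<le>n - i. g i (i + j)) = (\<Sum>j\<le>n. \<Sum>i\<le>j. g i j)"
proof -
  have "(\<Sum>i\<le>n. \<Sum>j\<le>n - i. g i (i + j)) = (\<Sum>(i, j)\<in>(SIGMA i:{..n}. {..n - i}). g i (i + j))"
    by (rule sum.Sigma) auto
  also have "\<dots> = (\<Sum>(j, i)\<in>(SIGMA j:{..n}. {..j}). g i j)"
    by (rule sum.reindex_bij_witness[of _ "\<lambda>(j, i). (i, j - i)" "\<lambda>(i, j). (i + j, i)"]) auto
  also have "\<dots> = (\<Sum>j\<le>n. \<Sum>i\<le>j. g i j)"
    by (rule sum.Sigma[symmetric]) auto
  finally show ?thesis .
qed

context operad
begin

text \<open>
  \<open>cop F xs ys\<close> is the sum of \<open>F [x\<^sub>1 \<circ> w\<^sub>1, \<dots>, x\<^sub>n \<circ> w\<^sub>n]\<close> over all factorizations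
  \<open>ys = w\<^sub>1 \<dots> w\<^sub>n\<close>, where \<open>n\<close> is the length of \<open>xs\<close>.
\<close>

primrec cop :: "('v list \<Rightarrow> 'k) \<Rightarrow> 'v list \<Rightarrow> 'v list \<Rightarrow> 'k" where
  "cop F [] ys = (if ys = [] then F [] else 0)"
| "cop F (x # xs) ys = (\<Sum>k\<le>length ys. cop (\<lambda>l. F (act x (take k ys) # l)) xs (drop k ys))"

definition Delta :: "('v list \<Rightarrow> 'k) \<Rightarrow> 'v list \<times> 'v list \<Rightarrow> 'k" where
  "Delta F = (\<lambda>(xs, ys). cop F xs ys)"

lemma Delta_apply: "Delta F (xs, ys) = cop F xs ys"
  by (simp add: Delta_def)

lemma cop_step: "cop (\<lambda>l. c * F l + G l) xs ys = c * cop F xs ys + cop G xs ys"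
  by (induction xs arbitrary: F G ys) (simp_all add: sum_distrib_left sum.distrib)

lemma cop_zero: "cop (\<lambda>l. 0) xs ys = 0"
  by (induction xs arbitrary: ys) simp_all

lemma cop_mult: "cop (\<lambda>l. c * F l) xs ys = c * cop F xs ys"
  using cop_step[of c F "\<lambda>l. 0"] by (simp add: cop_zero)

lemma cop_sum: "cop (\<lambda>l. \<Sum>a\<in>S. F a l) xs ys = (\<Sum>a\<in>S. cop (F a) xs ys)"
  using cop_step[of 1] by (induction S rule: infinite_finite_induct) (simp_all add: cop_zero)

text \<open>\<open>cop F xs\<close> reads \<open>F\<close> only at words with as many letters as
  \<open>xs\<close>. In \<open>cop_conc\<close> this fixes the range of the cut positions, so that
  the sum can be pulled out.\<close>

lemma cop_cong: "(\<And>l. length l = length xs \<Longrightarrow> F l = G l) \<Longrightarrow> cop F xs ys = cop G xs ys"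
proof (induction xs arbitrary: F G ys)
  case (Cons x xs)
  show ?case
    by (simp only: cop.simps, intro sum.cong refl Cons.IH Cons.prems) simp
qed simp

lemma Delta_flinear: "flinear UNIV UNIV Delta"
proof -
  have "Delta (F + G) = Delta F + Delta G" for F G
    using cop_step[of 1 F G] by (auto simp: fun_eq_iff Delta_def fun_apply plus_fun_def)
  moreover have "Delta (fscale c F) = fscale c (Delta F)" for c F
    by (auto simp: fun_eq_iff Delta_def fun_apply fscale_def cop_mult)
  ultimately show ?thesis by (simp add: linear_on_def)
qed

lemma Delta_step: "Delta (fscale c F + G) = fscale c (Delta F) + Delta G"
  by (rule linear_on_step[OF Delta_flinear]) simp_all

text \<open>A factorization of \<open>zs\<close> along \<open>ys\<close> consists of one along the
  first \<open>k\<close> letters and one along the rest; \<open>j\<close> is the place in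
  \<open>zs\<close> where they meet.\<close>

lemma cop_split:
  "k \<le> length ys \<Longrightarrow> cop (\<lambda>l. A (take k l) * B (drop k l)) ys zs =
    (\<Sum>j\<le>length zs. cop A (take k ys) (take j zs) * cop B (drop k ys) (drop j zs))"
proof (induction k arbitrary: ys A zs)
  case 0
  have "(\<Sum>j\<le>length zs. cop A (take 0 ys) (take j zs) * cop B (drop 0 ys) (drop j zs)) =
      (\<Sum>j\<in>{0}. cop A [] (take j zs) * cop B ys (drop j zs))"
    by (rule sum.mono_neutral_cong_right) auto
  then show ?case by (simp add: cop_mult)
next
  case (Suc k)
  then obtain y ys' where ys: "ys = y # ys'" "k \<le> length ys'" by (cases ys) auto
  let ?A = "\<lambda>i l. A (act y (take i zs) # l)"
  \<comment> \<open>Here \<open>i\<close> is the end of the block composed into \<open>y\<close>,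
    and \<open>j\<close> the end of the blocks for the first \<open>Suc k\<close> letters of
    \<open>ys\<close>.\<close>
  let ?g = "\<lambda>i j. cop (?A i) (take k ys') (drop i (take j zs)) * cop B (drop k ys') (drop j zs)"
  have "cop (\<lambda>l. ?A i (take k l) * B (drop k l)) ys' (drop i zs) =
      (\<Sum>j\<le>length zs - i. ?g i (i + j))" for i
    by (subst Suc.IH[OF ys(2)]) (simp add: take_drop add.commute)
  then have "cop (\<lambda>l. A (take (Suc k) l) * B (drop (Suc k) l)) ys zs =
      (\<Sum>i\<le>length zs. \<Sum>j\<le>length zs - i. ?g i (i + j))"
    by (simp add: ys)
  also have "\<dots> = (\<Sum>j\<le>length zs. \<Sum>i\<le>j. ?g i j)"
    by (rule sum_triangle)
  also have "\<dots> = (\<Sum>j\<le>length zs. cop A (take (Suc k) ys) (take j zs) * cop B (drop (Suc k) ys) (drop j zs))"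
    by (intro sum.cong refl) (auto simp: ys sum_distrib_right min_def intro!: sum.cong)
  finally show ?case .
qed

lemma cop_conc:
  "cop (conc (A \<otimes> B)) ys zs =
    (\<Sum>k\<le>length ys. \<Sum>j\<le>length zs.
      cop A (take k ys) (take j zs) * cop B (drop k ys) (drop j zs))"
proof -
  have "cop (conc (A \<otimes> B)) ys zs = cop (\<lambda>l. \<Sum>k\<le>length ys. A (take k l) * B (drop k l)) ys zs"
    by (rule cop_cong) (simp add: conc_def)
  then show ?thesis
    by (simp add: cop_sum cop_split)
qed

lemma Delta_conc: "Delta (conc (A \<otimes> B)) = square_mult conc (Delta A \<otimes> Delta B)"
proof (rule ext, clarify)
  fix xs zs
  show "Delta (conc (A \<otimes> B)) (xs, zs) = square_mult conc (Delta A \<otimes> Delta B) (xs, zs)"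
    unfolding Delta_apply cop_conc
    by (simp add: square_mult_def tmap_def conc_def tswap23_def Delta_apply)
qed

lemma Delta_unit: "Delta (word []) = word [] \<otimes> word []"
proof (rule ext, clarify)
  fix xs ys :: "'v list"
  show "Delta (word []) (xs, ys) = (word [] \<otimes> word []) (xs, ys)"
    by (cases xs) (auto simp: Delta_def word_Nil_apply cop_zero)
qed

text \<open>The form \<open>f\<close> receives \<open>x\<close> composed with a prefix of
  \<open>ys\<close> of any length, so the left factor is a function on words of all lengths and not
  a letter.\<close>

lemma cop_single_Cons:
  "cop (word (f # fs)) (x # xs) ys = conc ((\<lambda>m. f (act x m)) \<otimes> cop (word fs) xs) ys"
  by (simp add: conc_def word_Cons_apply cop_mult)

lemma cop_word_Nil: "cop (word []) xs ys = (if xs = [] \<and> ys = [] then 1 else 0)"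
  by (cases xs) (auto simp: word_Nil_apply cop_zero)

lemma cop_word_Cons_Nil: "cop (word (f # fs)) [] ys = 0"
  by (simp add: word_Cons_apply)

lemma cop_word_single: "cop (word [f]) xs ys = (case xs of [x] \<Rightarrow> f (act x ys) | _ \<Rightarrow> 0)"
proof (cases xs)
  case (Cons x xs')
  have "conc (F \<otimes> cop (word []) []) ys = F ys" for F
  proof -
    have "cop (word []) [] = word []" by (auto simp: word_Nil_apply)
    then show ?thesis by simp
  qed
  moreover have "cop (word []) xs' = (\<lambda>ys. 0)" if "xs' \<noteq> []"
    using that by (auto simp: cop_word_Nil)
  ultimately show ?thesis
    using Cons by (cases xs') (simp_all add: cop_single_Cons conc_def del: cop.simps)
qed (simp add: word_def)

lemma Delta_single: "Delta (word [f]) = delta P \<gamma> f"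
  by (auto simp: fun_eq_iff Delta_def delta_def cop_word_single act_def split: list.splits)

lemma mlin_cop: "mlin F \<Longrightarrow> mlin (\<lambda>xs. cop F xs zs)"
proof (rule mlinI)
  fix us ws :: "'v list" and c x y
  assume "mlin F"
  then show "cop F (us @ (scale c x + y) # ws) zs = c * cop F (us @ x # ws) zs + cop F (us @ y # ws) zs"
  proof (induction us arbitrary: F zs)
    case Nil
    have "F ((scale c (act x w) + act y w) # l) = c * F (act x w # l) + F (act y w # l)" for w l
      using mlin_step[OF Nil, of "[]"] by simp
    then show ?case
      by (simp add: act_step cop_step sum.distrib sum_distrib_left)
  next
    case (Cons u us)
    show ?case
      by (simp add: Cons.IH[OF mlin_cons[OF Cons.prems]] sum.distrib sum_distrib_left)
  qed
qed

primrec pieces :: "nat list \<Rightarrow> 'a list \<Rightarrow> 'a list list" where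
  "pieces [] zs = []"
| "pieces (k # ks) zs = take k zs # pieces ks (drop k zs)"

lemma concat_pieces: "length zs = sum_list ks \<Longrightarrow> concat (pieces ks zs) = zs"
  by (induction ks arbitrary: zs) auto

lemma list_all2_pieces:
  "list_all2 (\<lambda>q k. q \<in> P k) qs ks \<Longrightarrow> length zs = sum_list ks \<Longrightarrow>
    list_all2 (\<lambda>q rs. q \<in> P (length rs)) qs (pieces ks zs)"
  by (induction qs ks arbitrary: zs rule: list_all2_induct) auto

lemma length_pieces [simp]: "length (pieces ks zs) = length ks"
  by (induction ks arbitrary: zs) auto

text \<open>An entry of arity k annihilates every block of another length. Of all factorizations of
  \<open>zs\<close> only the one prescribed by the arities survives, and it exists only if the
  lengths add up.\<close>

lemma cop_homogeneous:
  "list_all2 (\<lambda>q k. q \<in> P k) ys ks \<Longrightarrow> mlin F \<Longrightarrow>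
    cop F ys zs = (if length zs = sum_list ks then F (map2 \<gamma> ys (pieces ks zs)) else 0)"
proof (induction ys ks arbitrary: F zs rule: list_all2_induct)
  case (Cons y ys k ks)
  have F0: "F (0 # l) = 0" for l
    using lin_zero[OF lin_mlin_hd[OF Cons.prems]] .
  have eq: "cop (\<lambda>l. F (act y (take i zs) # l)) ys (drop i zs) =
      (if i = k \<and> length zs = k + sum_list ks then F (map2 \<gamma> (y # ys) (pieces (k # ks) zs)) else 0)"
    if "i \<le> length zs" for i
    using that by (auto simp: act_homogeneous[OF Cons.hyps(1)] F0 cop_zero Cons.IH mlin_cons Cons.prems)
  show ?case
    by (simp add: eq sum.If_cases)
qed auto

text \<open>Homogeneous \<open>ys\<close> determine the arity of \<open>act x ys\<close>, so
  operadic associativity applies to the one surviving factorization. If \<open>zs\<close> has the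
  wrong length, both sides vanish.\<close>

lemma act_assoc_homogeneous:
  assumes "list_all2 (\<lambda>q k. q \<in> P k) ys ks" "lin \<phi>"
  shows "\<phi> (act (act x ys) zs) = cop (\<lambda>l. \<phi> (act x l)) ys zs"
proof -
  let ?x = "hcomp P (length ys) x"
  have len: "length ks = length ys"
    using assms(1) by (simp add: list_all2_lengthD)
  have "act x ys \<in> P (sum_list ks)"
    unfolding act_def by (rule comp_in[OF hcomp_in refl assms(1)])
  then have "act (act x ys) zs = (if length zs = sum_list ks then \<gamma> (act x ys) zs else 0)"
    by (rule act_homogeneous)
  moreover have "\<gamma> (act x ys) zs = act x (map2 \<gamma> ys (pieces ks zs))" if "length zs = sum_list ks"
    using comp_assoc[OF hcomp_in refl list_all2_pieces[OF assms(1) that]]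
    by (simp add: act_def concat_pieces that len)
  ultimately show ?thesis
    by (simp add: cop_homogeneous[OF assms(1) mlin_act[OF assms(2)]] lin_zero[OF assms(2)])
qed

end

section \<open>Coassociativity\<close>

context fd_operad
begin

lemma basis_homogeneous: "set bs \<subseteq> basis \<Longrightarrow> list_all2 (\<lambda>q k. q \<in> P k) bs (map deg bs)"
  by (auto simp: list_all2_conv_all_nth intro!: basis_in_P dest: nth_mem)

text \<open>Both sides are multilinear in \<open>ys\<close>, hence it suffices to take basis words.
  For general \<open>ys\<close> the right-hand side has to sum over all factorizations, since the
  arities are not fixed.\<close>

lemma act_assoc:
  assumes "lin \<phi>"
  shows "\<phi> (act (act x ys) zs) = cop (\<lambda>l. \<phi> (act x l)) ys zs"
proof -
  have "mlin (\<lambda>ys. \<phi> (act (act x ys) zs))"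
    using mlin_act[OF lin_act[OF assms]] .
  then show ?thesis
    by (rule mlin_eqI[OF _ mlin_cop[OF mlin_act[OF assms]]])
       (use act_assoc_homogeneous[OF basis_homogeneous assms] in auto)
qed

text \<open>After the first letter \<open>f\<close> is split off, \<open>act_assoc\<close> treats
  the factor containing \<open>f\<close> and the induction hypothesis the other one. The two cuts,
  of \<open>ys\<close> and of \<open>zs\<close>, recombine through \<open>cop_conc\<close>.\<close>

lemma cop_coassoc_word:
  assumes "\<And>f. f \<in> set fs \<Longrightarrow> lin f"
  shows "cop (\<lambda>l. cop (word fs) l zs) xs ys = cop (\<lambda>l. cop (word fs) xs l) ys zs"
  using assms
proof (induction fs arbitrary: xs ys zs)
  case Nil
  show ?case
    by (simp only: cop_word_Nil) (cases xs; cases ys; auto simp: cop_zero)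
next
  case (Cons f fs)
  have f: "lin f" using Cons.prems by simp
  show ?case
  proof (cases xs)
    case Nil
    then show ?thesis by (simp add: word_Cons_apply cop_zero cong: if_cong)
  next
    case xs: (Cons x xs')
    have "cop (\<lambda>l. cop (word (f # fs)) l zs) xs ys =
        (\<Sum>k\<le>length ys. \<Sum>j\<le>length zs. f (act (act x (take k ys)) (take j zs)) *
           cop (\<lambda>l. cop (word fs) l (drop j zs)) xs' (drop k ys))"
      by (simp add: xs word_Cons_apply cop_sum cop_mult)
    also have "\<dots> = (\<Sum>k\<le>length ys. \<Sum>j\<le>length zs. cop (\<lambda>l. f (act x l)) (take k ys) (take j zs) *
           cop (cop (word fs) xs') (drop k ys) (drop j zs))"
      using Cons by (simp add: act_assoc[OF f])
    also have "\<dots> = cop (conc ((\<lambda>m. f (act x m)) \<otimes> cop (word fs) xs')) ys zs"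
      by (simp only: cop_conc)
    also have "conc ((\<lambda>m. f (act x m)) \<otimes> cop (word fs) xs') = (\<lambda>l. cop (word (f # fs)) xs l)"
      by (rule ext) (simp only: xs cop_single_Cons)
    finally show ?thesis .
  qed
qed

lemma Delta_coassoc:
  assumes "F \<in> T_dual scale P"
  shows "tassoc (tmap Delta id (Delta F)) = tmap id Delta (Delta F)"
proof (rule ext, clarify)
  fix xs ys zs
  have "cop (\<lambda>l. cop F l zs) xs ys = cop (\<lambda>l. cop F xs l) ys zs"
    using assms unfolding T_dual_hdual
  proof (induction rule: tensor_algebra_induct)
    case zero
    show ?case by (simp add: zero_fun_def cop_zero)
  next
    case (step c vs F)
    have "cop (\<lambda>l. cop (word vs) l zs) xs ys = cop (\<lambda>l. cop (word vs) xs l) ys zs"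
      by (rule cop_coassoc_word) (use step(1) hdual_lin in auto)
    with step show ?case
      by (simp add: plus_fun_def fscale_def cop_step)
  qed
  then show "tassoc (tmap Delta id (Delta F)) (xs, ys, zs) = tmap id Delta (Delta F) (xs, ys, zs)"
    by (simp add: tassoc_def tmap_def Delta_def)
qed

end

text \<open>The counit and \<open>ins\<close> are sums whose support depends on \<open>F\<close>. A
  common length bound replaces them by sums over a fixed range, which is how their linearity is
  obtained.\<close>

definition len_bound :: "nat \<Rightarrow> ('a list \<Rightarrow> 'b::zero) \<Rightarrow> bool" where
  "len_bound N F \<longleftrightarrow> (\<forall>l. N < length l \<longrightarrow> F l = 0)"

lemma len_bound_mono: "len_bound M F \<Longrightarrow> M \<le> N \<Longrightarrow> len_bound N F"
  by (auto simp: len_bound_def)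

lemma len_bound_tensor_algebra:
  assumes "F \<in> tensor_algebra V"
  obtains N where "len_bound N F"
proof -
  have "\<exists>N. len_bound N F"
    using assms
  proof (induction rule: tensor_algebra_induct)
    case zero
    show ?case by (simp add: len_bound_def zero_fun_apply)
  next
    case (step c vs F)
    then obtain N where "len_bound N F" by blast
    then have "len_bound (max N (length vs)) (fscale c (word vs) + F)"
      by (auto simp: len_bound_def fun_apply word_def)
    then show ?case by blast
  qed
  then show thesis using that by blast
qed

lemma dual_counit_bound:
  assumes "len_bound N F"
  shows "dual_counit I F = (\<Sum>n\<le>N. F (replicate n I))"
  unfolding dual_counit_def
proof (rule sum.mono_neutral_left)
  show "{n. F (replicate n I) \<noteq> 0} \<subseteq> {..N}"
    using assms by (auto simp: len_bound_def not_less[symmetric])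
qed auto

lemma dual_counit_functional:
  "functional_on (tensor_algebra V) (dual_counit I :: ('a list \<Rightarrow> 'b::field) \<Rightarrow> 'b)"
  unfolding linear_on_def
proof (intro conjI ballI allI UNIV_I)
  fix F G :: "'a list \<Rightarrow> 'b" assume "F \<in> tensor_algebra V" "G \<in> tensor_algebra V"
  then obtain M N where "len_bound M F" "len_bound N G"
    by (metis len_bound_tensor_algebra)
  then have N: "len_bound (max M N) F" "len_bound (max M N) G"
    by (auto intro: len_bound_mono)
  then have "len_bound (max M N) (F + G)"
    by (auto simp: len_bound_def fun_apply)
  with N show "dual_counit I (F + G) = dual_counit I F + dual_counit I G"
    by (simp add: dual_counit_bound fun_apply sum.distrib)
next
  fix F :: "'a list \<Rightarrow> 'b" and c assume "F \<in> tensor_algebra V"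
  then obtain N where N: "len_bound N F"
    by (metis len_bound_tensor_algebra)
  then have "len_bound N (fscale c F)"
    by (auto simp: len_bound_def fun_apply)
  with N show "dual_counit I (fscale c F) = c * dual_counit I F"
    by (simp add: dual_counit_bound fun_apply sum_distrib_left)
qed

lemma dual_counit_append:
  "dual_counit I (word (us @ vs)) = dual_counit I (word us) * dual_counit I (word vs)"
  by (simp add: dual_counit_word prod_lessThan_add nth_append)

lemma dual_counit_conc:
  assumes "F \<in> tensor_algebra V" "G \<in> tensor_algebra V"
  shows "dual_counit I (conc (F \<otimes> G)) = dual_counit I F * dual_counit I G"
proof -
  note lin = dual_counit_functional[of V I]
  note zero = linear_on_zero[OF lin fs.subspace_0[OF tensor_algebra_subspace]]
  note sc = fs.subspace_scale[OF tensor_algebra_subspace]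
  have word_left: "dual_counit I (conc (word us \<otimes> G)) = dual_counit I (word us) * dual_counit I G"
    if "set us \<subseteq> V" for us
    using assms(2)
  proof (induction rule: tensor_algebra_induct)
    case zero
    show ?case by (simp add: tensor_bilinear conc_zero \<open>dual_counit I 0 = 0\<close>)
  next
    case (step c vs G)
    have "conc (word us \<otimes> G) \<in> tensor_algebra V" "word (us @ vs) \<in> tensor_algebra V"
        "word vs \<in> tensor_algebra V"
      using step that by (simp_all add: conc_in_tensor_algebra word_in_tensor_algebra)
    with step show ?case
      by (simp add: tensor_bilinear conc_step conc_word linear_on_step[OF lin] sc
          dual_counit_append) (simp add: algebra_simps)
  qed
  show ?thesis
    using assms(1)
  proof (induction rule: tensor_algebra_induct)
    case zero
    show ?case by (simp add: tensor_bilinear conc_zero \<open>dual_counit I 0 = 0\<close>)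
  next
    case (step c us F)
    have "conc (F \<otimes> G) \<in> tensor_algebra V" "conc (word us \<otimes> G) \<in> tensor_algebra V"
        "word us \<in> tensor_algebra V"
      using step assms(2) by (auto intro: conc_in_tensor_algebra word_in_tensor_algebra)
    with step show ?case
      by (simp add: tensor_bilinear conc_step linear_on_step[OF lin] sc word_left)
        (simp add: algebra_simps)
  qed
qed

context operad
begin

lemma lin_dual_component_zero: "f \<in> dual_component scale P n \<Longrightarrow> x \<in> P m \<Longrightarrow> f x \<noteq> 0 \<Longrightarrow> m = n"
  by (auto simp: dual_component_def)

section \<open>The grading\<close>

text \<open>A form of arity k + 1 has weight k. Indexing by \<open>Suc k\<close> gives the degree n
  - 1 of the theorem without truncated subtraction and excludes arity 0.\<close>

inductive hword :: "('v \<Rightarrow> 'k) list \<Rightarrow> nat \<Rightarrow> bool" where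
  Nil: "hword [] 0"
| Cons: "f \<in> dual_component scale P (Suc k) \<Longrightarrow> hword fs n \<Longrightarrow> hword (f # fs) (k + n)"

lemma hword_hdual: "hword fs n \<Longrightarrow> set fs \<subseteq> hdual"
  by (induction rule: hword.induct) (auto simp: hdual_def)

lemma hdual_hword: "set fs \<subseteq> hdual \<Longrightarrow> \<exists>n. hword fs n"
proof (induction fs)
  case (Cons f fs)
  then obtain n k where "hword fs n" "f \<in> dual_component scale P (Suc k)"
    by (auto simp: hdual_def) (metis One_nat_def Suc_le_D)
  then show ?case by (blast intro: hword.Cons)
qed (auto intro: hword.Nil)

lemma hword_append: "hword fs m \<Longrightarrow> hword gs n \<Longrightarrow> hword (fs @ gs) (m + n)"
  by (induction rule: hword.induct) (auto simp: add.assoc intro: hword.Cons)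

definition dual_part :: "nat \<Rightarrow> ('v list \<Rightarrow> 'k) set" where
  "dual_part n = fs.span {word fs | fs. hword fs n}"

lemma dual_part_subspace [simp]: "fs.subspace (dual_part n)"
  by (simp add: dual_part_def)

lemma word_in_dual_part: "hword fs n \<Longrightarrow> word fs \<in> dual_part n"
  unfolding dual_part_def by (intro fs.span_base) auto

lemma dual_part_subset: "dual_part n \<subseteq> T_dual scale P"
  unfolding dual_part_def T_dual_hdual
  by (rule fs.span_minimal) (auto intro: word_in_tensor_algebra dest: hword_hdual)

lemma dual_part_induct [consumes 1, case_names zero step]:
  assumes "F \<in> dual_part n" "Q 0"
    and "\<And>c fs F. hword fs n \<Longrightarrow> F \<in> dual_part n \<Longrightarrow> Q F \<Longrightarrow> Q (fscale c (word fs) + F)"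
  shows "Q F"
  using assms(1) unfolding dual_part_def
proof (induction rule: span_lin_induct)
  case (step c x y)
  then obtain fs where "x = word fs" "hword fs n" by blast
  with step assms(3) show ?case unfolding dual_part_def by blast
qed (rule assms(2))

lemma conc_dual_part:
  assumes "F \<in> dual_part m" "G \<in> dual_part n"
  shows "conc (F \<otimes> G) \<in> dual_part (m + n)"
  using assms(1)
proof (induction rule: dual_part_induct)
  case zero
  then show ?case by (simp add: tensor_bilinear conc_zero fs.subspace_0)
next
  case (step c fs F)
  have "conc (word fs \<otimes> G) \<in> dual_part (m + n)"
    using assms(2)
  proof (induction rule: dual_part_induct)
    case zero
    then show ?case by (simp add: tensor_bilinear conc_zero fs.subspace_0)
  next
    case (step d gs G)
    then show ?case using \<open>hword fs m\<close>
      by (simp add: tensor_bilinear conc_step conc_word fs.subspace_add fs.subspace_scale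
          word_in_dual_part hword_append)
  qed
  then show ?case using step
    by (simp add: tensor_bilinear conc_step fs.subspace_add fs.subspace_scale)
qed

text \<open>Positive weight means that some letter has arity at least 2, and such a letter vanishes
  at the unit, which lies in \<open>P 1\<close>.\<close>

lemma hword_counit: "hword fs n \<Longrightarrow> dual_counit I (word fs) \<noteq> 0 \<Longrightarrow> n = 0"
proof (induction rule: hword.induct)
  case (Cons f k fs n)
  have "dual_counit I (word (f # fs)) = f I * dual_counit I (word fs)"
    by (simp add: dual_counit_word prod.lessThan_Suc_shift del: prod.lessThan_Suc)
  with Cons lin_dual_component_zero[OF Cons(1) unit_in] show ?case by auto
qed simp

lemma dual_counit_dual_part:
  assumes "F \<in> dual_part n" "0 < n"
  shows "dual_counit I F = 0"
proof -
  have "F \<in> T_dual scale P \<and> dual_counit I F = 0"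
    using assms(1)
  proof (induction rule: dual_part_induct)
    case zero
    show ?case
      using linear_on_zero[OF dual_counit_functional fs.subspace_0[OF tensor_algebra_subspace]]
      by (simp add: fs.subspace_0)
  next
    case (step c fs F)
    then have "dual_counit I (word fs) = 0" "word fs \<in> T_dual scale P"
      using hword_counit[OF step(1)] assms(2) word_in_dual_part[OF step(1)] dual_part_subset by auto
    with step show ?case
      by (simp add: linear_on_step[OF dual_counit_functional[of "graded_dual scale P"]]
          fs.subspace_add fs.subspace_scale)
  qed
  then show ?thesis ..
qed

text \<open>The weight \<open>n\<close> part of the tensor square, spanned directly by homogeneous
  elementary tensors. This gives an induction rule with a single elementary tensor per step.\<close>

definition square_part :: "nat \<Rightarrow> ('v list \<times> 'v list \<Rightarrow> 'k) set" where
  "square_part n = fs.span {a \<otimes> b | a b. \<exists>i\<le>n. a \<in> dual_part i \<and> b \<in> dual_part (n - i)}"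

lemma square_part_subspace [simp]: "fs.subspace (square_part n)"
  by (simp add: square_part_def)

lemma tensor_in_square_part: "a \<in> dual_part i \<Longrightarrow> b \<in> dual_part j \<Longrightarrow> i + j = n \<Longrightarrow> a \<otimes> b \<in> square_part n"
proof -
  assume "a \<in> dual_part i" "b \<in> dual_part j" "i + j = n"
  then have "i \<le> n" "a \<in> dual_part i" "b \<in> dual_part (n - i)" by auto
  then show ?thesis unfolding square_part_def by (intro fs.span_base) blast
qed

lemma square_part_induct [consumes 1, case_names zero step]:
  assumes "t \<in> square_part n" "Q 0"
    and "\<And>c a b i j t. a \<in> dual_part i \<Longrightarrow> b \<in> dual_part j \<Longrightarrow> n = i + j \<Longrightarrow> t \<in> square_part n \<Longrightarrow> Q t \<Longrightarrow> Q (fscale c (a \<otimes> b) + t)"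
  shows "Q t"
  using assms(1) unfolding square_part_def
proof (induction rule: span_lin_induct)
  case (step c x y)
  then obtain a b i where "x = a \<otimes> b" "i \<le> n" "a \<in> dual_part i" "b \<in> dual_part (n - i)" by blast
  with step assms(3)[of a i b "n - i"] show ?case unfolding square_part_def by simp
qed (rule assms(2))

lemma square_part_subset: "square_part n \<subseteq> fs.span (\<Union>i\<le>n. tens (dual_part i) (dual_part (n - i)))"
  unfolding square_part_def by (rule fs.span_mono) (blast intro: tensor_in_tens)

lemma square_part_subset_tens: "square_part n \<subseteq> tens (T_dual scale P) (T_dual scale P)"
  unfolding square_part_def
  by (rule fs.span_minimal) (auto intro!: tensor_in_tens dest: subsetD[OF dual_part_subset])

lemma square_mult_zero: "square_mult conc 0 = 0"
  by (auto simp: fun_eq_iff square_mult_def tmap_def tswap23_def conc_def fun_apply)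

lemma square_mult_step:
  "square_mult conc (fscale c s + t) = fscale c (square_mult conc s) + square_mult conc t"
  by (auto simp: fun_eq_iff square_mult_def tmap_def tswap23_def conc_def fun_apply
      sum.distrib sum_distrib_left)

lemma square_mult_tensor:
  "square_mult conc ((a \<otimes> b) \<otimes> (c \<otimes> d)) = conc (a \<otimes> c) \<otimes> conc (b \<otimes> d)"
  unfolding square_mult_def tswap23_tensor
  by (rule tmap_tensor[OF conc_flinear conc_flinear]) auto

lemma square_mult_square_part:
  assumes "s \<in> square_part m" "t \<in> square_part n"
  shows "square_mult conc (s \<otimes> t) \<in> square_part (m + n)"
  using assms(1)
proof (induction rule: square_part_induct)
  case zero
  then show ?case by (simp add: tensor_bilinear square_mult_zero fs.subspace_0)
next
  case (step c a b i j s)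
  have "square_mult conc ((a \<otimes> b) \<otimes> t) \<in> square_part (m + n)"
    using assms(2)
  proof (induction rule: square_part_induct)
    case zero
    then show ?case by (simp add: tensor_bilinear square_mult_zero fs.subspace_0)
  next
    case (step d a' b' i' j' t)
    have "conc (a \<otimes> a') \<otimes> conc (b \<otimes> b') \<in> square_part (m + n)"
      using \<open>a \<in> dual_part i\<close> \<open>b \<in> dual_part j\<close> \<open>m = i + j\<close> step
      by (intro tensor_in_square_part[of _ "i + i'" _ "j + j'"] conc_dual_part) auto
    then show ?case using step
      by (simp add: tensor_bilinear square_mult_step square_mult_tensor fs.subspace_add fs.subspace_scale)
  qed
  then show ?case using step
    by (simp add: tensor_bilinear square_mult_step fs.subspace_add fs.subspace_scale)
qed

end

context fd_operad
begin

text \<open>Basis words of different weight separate the homogeneous parts; uniqueness of the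
  decomposition rests on this.\<close>

lemma dual_part_support:
  assumes "F \<in> dual_part n" "set bs \<subseteq> basis" "F bs \<noteq> 0"
  shows "(\<Sum>b\<leftarrow>bs. deg b - 1) = n"
proof -
  have word: "(\<Sum>b\<leftarrow>bs. deg b - 1) = n" if "hword fs n" "set bs \<subseteq> basis" "word fs bs \<noteq> 0" for fs bs
    using that
  proof (induction arbitrary: bs rule: hword.induct)
    case Nil
    then show ?case by (simp add: word_Nil_apply split: if_splits)
  next
    case (Cons f k fs n)
    then obtain b bs' where bs: "bs = b # bs'" "f b \<noteq> 0" "word fs bs' \<noteq> 0"
      by (cases bs) (auto simp: word_Cons_apply)
    with Cons have "deg b = Suc k"
      using lin_dual_component_zero basis_in_P by (metis list.set_intros(1) subset_code(1))
    with Cons bs show ?case by simp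
  qed
  have "F bs \<noteq> 0 \<longrightarrow> (\<Sum>b\<leftarrow>bs. deg b - 1) = n"
    using assms(1)
  proof (induction rule: dual_part_induct)
    case zero
    show ?case by (simp add: zero_fun_apply)
  next
    case (step c fs F)
    then show ?case using word[OF step(1) assms(2)] by (auto simp: fun_apply)
  qed
  then show ?thesis using assms(3) by blast
qed

lemma dual_part_grading: "is_grading fscale (T_dual scale P) dual_part"
  unfolding is_grading_def
proof (intro conjI allI ballI ex_ex1I)
  fix n show "fs.subspace (dual_part n)" "dual_part n \<subseteq> T_dual scale P"
    by (simp_all add: dual_part_subset)
next
  fix F assume "F \<in> T_dual scale P"
  then have "F \<in> tensor_algebra hdual" by (simp add: T_dual_hdual)
  then have "\<exists>c. (\<forall>n. c n \<in> dual_part n) \<and> finite {n. c n \<noteq> 0} \<and> F = Sum_any c"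
  proof (induction rule: tensor_algebra_induct)
    case zero
    have "\<forall>n. (\<lambda>_. 0) n \<in> dual_part n" by (simp add: fs.subspace_0)
    then show ?case by (intro exI[of _ "\<lambda>_. 0"]) simp
  next
    case (step a vs F)
    then obtain c where c: "\<And>n. c n \<in> dual_part n" "finite {n. c n \<noteq> 0}" "F = Sum_any c" by blast
    obtain m where m: "hword vs m" using hdual_hword[OF step(1)] by blast
    let ?w = "\<lambda>n. if n = m then fscale a (word vs) else 0"
    have w: "?w n \<in> dual_part n" for n
      using m by (auto intro: fs.subspace_0 fs.subspace_scale word_in_dual_part)
    have fin: "finite {n. ?w n \<noteq> 0}" by (rule finite_subset[of _ "{m}"]) auto
    have "Sum_any ?w = fscale a (word vs)"
      by (subst Sum_any.expand_superset[of "{m}"]) auto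
    then have "fscale a (word vs) + F = Sum_any (\<lambda>n. ?w n + c n)"
      using Sum_any.distrib[OF fin c(2)] c(3) by simp
    moreover have "finite {n. ?w n + c n \<noteq> 0}"
      by (rule finite_subset[OF _ finite_UnI[OF fin c(2)]]) auto
    moreover have "?w n + c n \<in> dual_part n" for n
      using w c(1) by (intro fs.subspace_add) simp_all
    ultimately show ?case by (intro exI[of _ "\<lambda>n. ?w n + c n"]) blast
  qed
  then show "\<exists>c. (\<forall>n. c n \<in> dual_part n) \<and> finite {n. c n \<noteq> 0} \<and> F = (\<Sum>n | c n \<noteq> 0. c n)"
    by (simp only: Sum_any.expand_set)
next
  fix F c c'
  assume c: "(\<forall>n. c n \<in> dual_part n) \<and> finite {n. c n \<noteq> 0} \<and> F = (\<Sum>n | c n \<noteq> 0. c n)"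
    and c': "(\<forall>n. c' n \<in> dual_part n) \<and> finite {n. c' n \<noteq> 0} \<and> F = (\<Sum>n | c' n \<noteq> 0. c' n)"
  \<comment> \<open>At a basis word only the component whose index is the weight of that word can be
    nonzero, so its value there is \<open>F bs\<close>. Any two decompositions thus agree at basis
    words, and by multilinearity everywhere.\<close>
  have coeff: "d n bs = (if n = (\<Sum>b\<leftarrow>bs. deg b - 1) then F bs else 0)"
    if d: "(\<forall>n. d n \<in> dual_part n) \<and> finite {n. d n \<noteq> 0} \<and> F = (\<Sum>n | d n \<noteq> 0. d n)"
      and bs: "set bs \<subseteq> basis" for d n bs
  proof -
    let ?m = "\<Sum>b\<leftarrow>bs. deg b - 1"
    have zero: "d n bs = 0" if "n \<noteq> ?m" for n
      using dual_part_support[of "d n" n bs] d bs that by blast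
    have "F bs = (\<Sum>n | d n \<noteq> 0. d n bs)"
      using d by (metis (no_types, lifting) sum_fun_apply sum.cong)
    also have "\<dots> = (\<Sum>n\<in>{n. d n \<noteq> 0} \<union> {?m}. d n bs)"
      using d by (intro sum.mono_neutral_left) (auto simp: zero_fun_apply)
    also have "\<dots> = d ?m bs"
      using d zero by (subst sum.mono_neutral_right[of _ "{?m}"]) auto
    finally show ?thesis using zero by auto
  qed
  have "c n vs = c' n vs" for n vs
    by (rule mlin_eqI) (use c c' dual_part_subset in \<open>auto simp: coeff[OF c] coeff[OF c'] intro!: mlin_T_dual\<close>)
  then show "c = c'" by auto
qed

section \<open>Finiteness and homogeneity of the coproduct\<close>

lemma hword_co: "set bs \<subseteq> basis \<Longrightarrow> hword (map co bs) (\<Sum>b\<leftarrow>bs. deg b - 1)"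
proof (induction bs)
  case (Cons b bs)
  have "co b \<in> dual_component scale P (Suc (deg b - 1))"
    using co_dual_component[of b] deg_pos[of b] Cons.prems by simp
  with Cons show ?case by (auto intro: hword.Cons)
qed (auto intro: hword.Nil)

lemma sum_list_deg:
  "set bs \<subseteq> basis \<Longrightarrow> (\<Sum>b\<leftarrow>bs. deg b) = (\<Sum>b\<leftarrow>bs. deg b - 1) + length bs"
proof (induction bs)
  case (Cons b bs)
  then show ?case using deg_pos[of b] by simp
qed simp

text \<open>The composition must be defined in the arity of \<open>b\<close>, and its result must
  have the arity seen by \<open>f\<close>. These two constraints leave finitely many pairs
  \<open>b\<close>, \<open>bs\<close>.\<close>

lemma act_basis_nonzero:
  assumes f: "f \<in> dual_component scale P n" and b: "b \<in> basis" "set bs \<subseteq> basis"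
    and nz: "f (act b bs) \<noteq> 0"
  shows "deg b = length bs" "(\<Sum>b\<leftarrow>bs. deg b) = n"
proof -
  have "act b bs \<noteq> 0" using nz lin_zero[OF dual_component_lin[OF f]] by auto
  then show len: "deg b = length bs"
    using act_homogeneous[OF basis_in_P[OF b(1)]] by (metis (full_types))
  have "act b bs = \<gamma> b bs"
    using len act_homogeneous[OF basis_in_P[OF b(1)]] by simp
  also have "\<dots> \<in> P (\<Sum>b\<leftarrow>bs. deg b)"
    by (rule comp_in[OF basis_in_P[OF b(1)] len[symmetric] basis_homogeneous[OF b(2)]])
  finally show "(\<Sum>b\<leftarrow>bs. deg b) = n"
    using lin_dual_component_zero[OF f _ nz] by simp
qed

text \<open>Expand f (b o bs) in basis vectors for both arguments. In a nonzero term the weights are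
  m - 1 and (n + 1) - m with m = deg b = length bs, so they add up to n.\<close>

lemma Delta_single_square_part:
  assumes f: "f \<in> dual_component scale P (Suc n)"
  shows "Delta (word [f]) \<in> square_part n"
proof -
  \<comment> \<open>A nonzero term has total degree \<open>Suc n\<close>. This bounds the degrees of
    the letters and, as these are positive, the length of \<open>bs\<close>; the degree of
    \<open>b\<close> equals that length.\<close>
  let ?K = "\<Union>k\<le>Suc n. bas k"
  let ?L = "{bs. set bs \<subseteq> ?K \<and> length bs \<le> Suc n}"
  have f_lin: "lin f" using f by (rule dual_component_lin)
  have K: "finite ?K" "?K \<subseteq> basis" by (auto simp: bas_finite basis_def)
  have L: "finite ?L" using K(1) by (rule finite_lists_length_le)
  have range: "b \<in> ?K \<and> bs \<in> ?L" if "b \<in> basis" "set bs \<subseteq> basis" "f (act b bs) \<noteq> 0" for b bs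
  proof -
    note nz = act_basis_nonzero[OF f that]
    have "length bs \<le> Suc n" using nz sum_list_deg[OF that(2)] by simp
    moreover have "b' \<in> ?K" if "b' \<in> set bs" for b'
    proof -
      have "deg b' \<le> Suc n" using that nz(2) member_le_sum_list[of "deg b'" "map deg bs"] by auto
      moreover have "b' \<in> bas (deg b')" using that \<open>set bs \<subseteq> basis\<close> basis_bas by blast
      ultimately show ?thesis by blast
    qed
    moreover have "b \<in> bas (deg b)" using that(1) by (rule basis_bas)
    ultimately show ?thesis using nz(1) by auto
  qed
  \<comment> \<open>The support of the coordinates of \<open>x\<close> varies with \<open>x\<close>.
    It is exchanged for the fixed finite set \<open>?K\<close>, so that one finite tensor serves for
    all arguments.\<close>
  have act: "f (act x bs) = (\<Sum>b\<in>?K. co b x * f (act b bs))" if "set bs \<subseteq> basis" for x bs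
  proof -
    have "f (act x bs) = (\<Sum>b | co b x \<noteq> 0. co b x * f (act b bs))"
      by (rule lin_expand[OF lin_act[OF f_lin] co_finite]) simp
    also have "\<dots> = (\<Sum>b\<in>{b. co b x \<noteq> 0} \<union> ?K. co b x * f (act b bs))"
      using co_finite K by (intro sum.mono_neutral_left) auto
    also have "\<dots> = (\<Sum>b\<in>?K. co b x * f (act b bs))"
    proof (rule sum.mono_neutral_right)
      show "\<forall>b\<in>{b. co b x \<noteq> 0} \<union> ?K - ?K. co b x * f (act b bs) = 0"
        using range[OF _ that] co_nonzero by fastforce
    qed (use co_finite K in auto)
    finally show ?thesis .
  qed
  have L_basis: "set bs \<subseteq> basis" if "bs \<in> ?L" for bs
    using that K(2) by blast
  have "Delta (word [f]) =
      (\<Sum>bs\<in>?L. \<Sum>b\<in>?K. fscale (f (act b bs)) (word [co b] \<otimes> word (map co bs)))"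
  proof (rule ext, clarify)
    fix xs ys
    have rhs: "(\<Sum>bs\<in>?L. \<Sum>b\<in>?K. fscale (f (act b bs)) (word [co b] \<otimes> word (map co bs))) (xs, ys) =
        (\<Sum>bs\<in>?L. \<Sum>b\<in>?K. f (act b bs) * (word [co b] xs * word (map co bs) ys))"
      by (simp add: sum_fun_apply fscale_apply)
    show "Delta (word [f]) (xs, ys) =
      (\<Sum>bs\<in>?L. \<Sum>b\<in>?K. fscale (f (act b bs)) (word [co b] \<otimes> word (map co bs))) (xs, ys)"
    proof (cases "\<exists>x. xs = [x]")
      case True
      then obtain x where x: "xs = [x]" ..
      have "f (act x ys) = Sum_any (\<lambda>bs. word (map co bs) ys * f (act x bs))"
        by (rule mlin_Sum_any[OF mlin_act[OF f_lin], symmetric])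
      \<comment> \<open>Likewise the words \<open>bs\<close> may be confined to \<open>?L\<close>,
        whatever \<open>ys\<close> is: outside \<open>?L\<close> every coefficient f (b o bs)
        vanishes.\<close>
      also have "\<dots> = (\<Sum>bs\<in>?L. word (map co bs) ys * f (act x bs))"
      proof (rule Sum_any.expand_superset[OF L], clarify)
        fix bs assume nz: "word (map co bs) ys * f (act x bs) \<noteq> 0"
        then have bs: "set bs \<subseteq> basis" by (intro word_co_basis[of bs ys]) auto
        then have "(\<Sum>b\<in>?K. co b x * f (act b bs)) \<noteq> 0" using act nz by auto
        then obtain b where "b \<in> ?K" "f (act b bs) \<noteq> 0" by (metis (no_types, lifting) mult_zero_right sum.neutral)
        then show "set bs \<subseteq> ?K \<and> length bs \<le> Suc n" using range[OF _ bs, of b] K(2) by blast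
      qed
      also have "\<dots> = (\<Sum>bs\<in>?L. \<Sum>b\<in>?K. f (act b bs) * (co b x * word (map co bs) ys))"
        by (intro sum.cong refl) (auto simp: act[OF L_basis] sum_distrib_left mult_ac)
      finally show ?thesis
        unfolding rhs by (simp add: x Delta_apply cop_word_single word_single_apply)
    next
      case False
      then show ?thesis
        unfolding rhs by (auto simp: Delta_apply cop_word_single word_single_apply split: list.splits)
    qed
  qed
  moreover have "fscale (f (act b bs)) (word [co b] \<otimes> word (map co bs)) \<in> square_part n"
    if "b \<in> basis" "set bs \<subseteq> basis" for b bs
  proof (cases "f (act b bs) = 0")
    case True
    then show ?thesis using fs.subspace_0[OF square_part_subspace] by simp
  next
    case False
    note nz = act_basis_nonzero[OF f that False]
    have "word [co b] \<in> dual_part (deg b - 1)" "word (map co bs) \<in> dual_part (\<Sum>b\<leftarrow>bs. deg b - 1)"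
      using hword_co[of "[b]"] hword_co[of bs] that by (auto intro: word_in_dual_part)
    then show ?thesis
      using nz sum_list_deg[OF that(2)] deg_pos[OF that(1)]
      by (intro fs.subspace_scale tensor_in_square_part square_part_subspace) auto
  qed
  ultimately show ?thesis
    using K L_basis by (auto intro!: fs.subspace_sum)
qed

lemma Delta_word_square_part: "hword fs n \<Longrightarrow> Delta (word fs) \<in> square_part n"
proof (induction rule: hword.induct)
  case Nil
  have "word [] \<in> dual_part 0" by (intro word_in_dual_part hword.Nil)
  then show ?case by (auto simp: Delta_unit intro: tensor_in_square_part)
next
  case (Cons f k fs n)
  then show ?case
    by (subst word_Cons, subst Delta_conc) (intro square_mult_square_part Delta_single_square_part)
qed

lemma Delta_zero: "Delta 0 = 0"
  using linear_on_zero[OF Delta_flinear] by simp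

lemma Delta_square_part: "F \<in> dual_part n \<Longrightarrow> Delta F \<in> square_part n"
  by (induction rule: dual_part_induct)
    (simp_all add: Delta_zero Delta_step fs.subspace_0 fs.subspace_add fs.subspace_scale Delta_word_square_part)

text \<open>Every word in homogeneous forms has a weight, so the graded inclusion already gives
  membership in the tensor product.\<close>

lemma Delta_in_tens:
  assumes "F \<in> T_dual scale P"
  shows "Delta F \<in> tens (T_dual scale P) (T_dual scale P)"
  using assms unfolding T_dual_hdual
proof (induction rule: tensor_algebra_induct)
  case zero
  then show ?case by (simp add: Delta_zero fs.subspace_0)
next
  case (step c vs F)
  then obtain n where "hword vs n" using hdual_hword by blast
  then have "Delta (word vs) \<in> tens (tensor_algebra hdual) (tensor_algebra hdual)"
    using Delta_word_square_part square_part_subset_tens T_dual_hdual by auto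
  with step show ?case
    by (simp add: Delta_step fs.subspace_add fs.subspace_scale)
qed

text \<open>The counit, \<open>ins\<close> and the pairing are applied to the second leg of
  \<open>Delta F\<close>; their linearity and multiplicativity require the slices to lie in
  \<open>T_dual\<close>.\<close>

lemma cop_slice: "F \<in> T_dual scale P \<Longrightarrow> cop F xs \<in> T_dual scale P"
  using tens_slice_right[OF Delta_in_tens tensor_algebra_subspace, of F xs]
  by (simp add: Delta_apply)

section \<open>The bialgebra\<close>

text \<open>The unit annihilates every block that is not a single letter, so only the cut of
  \<open>ys\<close> into its letters survives.\<close>

lemma cop_unit_left:
  "mlin F \<Longrightarrow> cop F (replicate n I) ys = (if length ys = n then F ys else 0)"
proof (induction n arbitrary: F ys)
  case (Suc n)
  have F0: "F (0 # l) = 0" for l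
    using lin_zero[OF lin_mlin_hd[OF Suc.prems]] .
  have eq: "cop (\<lambda>l. F (act I (take k ys) # l)) (replicate n I) (drop k ys) =
      (if k = 1 \<and> length ys = Suc n then F ys else 0)" if "k \<le> length ys" for k
  proof (cases "k = 1")
    case True
    then obtain y ys' where "ys = y # ys'" using \<open>k \<le> length ys\<close> by (cases ys) auto
    then show ?thesis using True Suc by (simp add: act_unit mlin_cons)
  next
    case False
    then have "act I (take k ys) = 0"
      using that by (auto simp: act_unit split: list.splits) (metis length_take min.absorb2 length_Cons list.size(3) One_nat_def)
    then show ?thesis using False by (simp add: F0 cop_zero)
  qed
  show ?case by (simp add: eq sum.If_cases)
qed auto

text \<open>Filling every input with \<open>I\<close> leaves each letter unchanged, but the number
  of units has to match the total arity, which is defined only for homogeneous letters.\<close>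

lemma cop_unit_right_basis:
  assumes "mlin F" "set bs \<subseteq> basis"
  shows "cop F bs (replicate n I) = (if n = (\<Sum>b\<leftarrow>bs. deg b) then F bs else 0)"
proof -
  have "map2 \<gamma> bs (pieces (map deg bs) (replicate (\<Sum>b\<leftarrow>bs. deg b) I)) = bs"
    using assms(2)
  proof (induction bs)
    case (Cons b bs)
    then show ?case using unit_right[OF basis_in_P[of b]] by simp
  qed simp
  then show ?thesis
    by (simp add: cop_homogeneous[OF basis_homogeneous[OF assms(2)] assms(1)])
qed

lemma counit_left:
  assumes "F \<in> T_dual scale P"
  shows "contract_left (dual_counit I) (Delta F) = F"
proof (rule ext)
  fix ys
  have eq: "{n. length ys = n \<and> F ys \<noteq> 0} = (if F ys = 0 then {} else {length ys})" by auto
  show "contract_left (dual_counit I) (Delta F) ys = F ys"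
    by (simp add: contract_left_def dual_counit_def Delta_apply cop_unit_left mlin_T_dual[OF assms] eq)
qed

lemma counit_right:
  assumes "F \<in> T_dual scale P"
  shows "contract_right (dual_counit I) (Delta F) = F"
proof (rule ext)
  fix xs
  have F: "mlin F" using assms by (rule mlin_T_dual)
  \<comment> \<open>For inhomogeneous letters several numbers of units contribute. Multilinearity in
    \<open>xs\<close> reduces to basis words, where exactly one number matters.\<close>
  have "mlin (\<lambda>xs. dual_counit I (cop F xs))"
  proof (rule mlinI)
    fix us ws :: "'v list" and c x y
    have "cop F (us @ (scale c x + y) # ws) = fscale c (cop F (us @ x # ws)) + cop F (us @ y # ws)"
      using mlin_step[OF mlin_cop[OF F]] by (auto simp: fun_apply)
    then show "dual_counit I (cop F (us @ (scale c x + y) # ws)) =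
        c * dual_counit I (cop F (us @ x # ws)) + dual_counit I (cop F (us @ y # ws))"
      by (simp add: linear_on_step[OF dual_counit_functional[of "graded_dual scale P"]]
          cop_slice[OF assms] fs.subspace_scale)
  qed
  moreover have "dual_counit I (cop F bs) = F bs" if "set bs \<subseteq> basis" for bs
  proof -
    have "{n. n = m \<and> F bs \<noteq> 0} = (if F bs = 0 then {} else {m})" for m by auto
    then show ?thesis
      by (simp add: dual_counit_def cop_unit_right_basis[OF F that])
  qed
  ultimately have "dual_counit I (cop F xs) = F xs"
    by (rule mlin_eqI[OF _ F])
  then show "contract_right (dual_counit I) (Delta F) xs = F xs"
    by (simp add: contract_right_def Delta_apply)
qed

lemma word_Nil_in_T: "word [] \<in> tensor_algebra V"
  by (simp add: word_in_tensor_algebra)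

lemma Delta_extends: "extends_delta scale P \<gamma> Delta"
  unfolding extends_delta_def algebra_hom_def
  by (auto simp: Delta_unit Delta_conc Delta_single Delta_in_tens intro!: linear_on_subset[OF Delta_flinear])

lemma extends_delta_unique:
  assumes "extends_delta scale P \<gamma> \<Delta>" "F \<in> T_dual scale P"
  shows "\<Delta> F = Delta F"
proof -
  let ?T = "T_dual scale P"
  have lin: "flinear ?T (tens ?T ?T) \<Delta>" and unit: "\<Delta> (word []) = word [] \<otimes> word []"
    and mult: "\<And>a b. a \<in> ?T \<Longrightarrow> b \<in> ?T \<Longrightarrow> \<Delta> (conc (a \<otimes> b)) = square_mult conc (\<Delta> a \<otimes> \<Delta> b)"
    and gen: "\<And>f. f \<in> graded_dual scale P \<Longrightarrow> \<Delta> (word [f]) = delta P \<gamma> f"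
    using assms(1) by (auto simp: extends_delta_def algebra_hom_def)
  have word: "\<Delta> (word fs) = Delta (word fs)" if "set fs \<subseteq> graded_dual scale P" for fs
    using that
  proof (induction fs)
    case Nil
    show ?case by (simp add: unit Delta_unit)
  next
    case (Cons f fs)
    then have "word [f] \<in> ?T" "word fs \<in> ?T" by (auto intro: word_in_tensor_algebra)
    with Cons show ?case
      by (subst (1 2) word_Cons) (simp add: mult Delta_conc gen Delta_single)
  qed
  show ?thesis
    by (rule linear_on_span_eq[OF lin linear_on_subset[OF Delta_flinear subset_UNIV Delta_in_tens]
          tensor_algebra_def _ assms(2)]) (auto intro: word)
qed

lemma bialgebra: "bialgebra_on (T_dual scale P) conc (word []) Delta (dual_counit I)"
  unfolding bialgebra_on_def coalgebra_on_def
proof (intro conjI ballI)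
  show "algebra_hom (T_dual scale P) conc (word []) (tens (T_dual scale P) (T_dual scale P))
      (square_mult conc) (word [] \<otimes> word []) Delta"
    using Delta_extends by (simp add: extends_delta_def)
  then show "flinear (T_dual scale P) (tens (T_dual scale P) (T_dual scale P)) Delta"
    by (simp add: algebra_hom_def)
  show "dual_counit I (word []) = 1"
    by (simp add: dual_counit_word)
qed (simp_all add: algebra_on_tensor_algebra dual_counit_functional Delta_coassoc counit_left
    counit_right dual_counit_conc)

lemma graded_bialgebra: "graded_bialgebra_on (T_dual scale P) conc (word []) Delta (dual_counit I) dual_part"
  unfolding graded_bialgebra_on_def
  using square_part_subset Delta_square_part
  by (auto simp: bialgebra dual_part_grading conc_dual_part dual_counit_dual_part intro: word_in_dual_part hword.Nil)

end

section \<open>The pairing\<close>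

lemma len_bound_cons: "len_bound N F \<Longrightarrow> len_bound N (\<lambda>l. F (x # l))"
  by (simp add: len_bound_def)


context operad
begin

text \<open>
  \<open>insn n F v\<close> is the sum of the values of \<open>F\<close> at all words of length \<open>n\<close> that arise from \<open>v\<close> by
  inserting letters \<open>I\<close>, counted with multiplicity.
\<close>

primrec insn :: "nat \<Rightarrow> ('v list \<Rightarrow> 'k) \<Rightarrow> 'v list \<Rightarrow> 'k" where
  "insn 0 F v = (if v = [] then F [] else 0)"
| "insn (Suc n) F v = insn n (\<lambda>l. F (I # l)) v + (case v of [] \<Rightarrow> 0 | y # v' \<Rightarrow> insn n (\<lambda>l. F (y # l)) v')"

definition ins :: "('v list \<Rightarrow> 'k) \<Rightarrow> 'v list \<Rightarrow> 'k" where
  "ins F v = Sum_any (\<lambda>n. insn n F v)"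

lemma insn_step: "insn n (\<lambda>l. c * F l + G l) v = c * insn n F v + insn n G v"
  by (induction n arbitrary: F G v) (auto simp: algebra_simps split: list.splits)

lemma insn_cong: "(\<And>l. length l = n \<Longrightarrow> F l = G l) \<Longrightarrow> insn n F v = insn n G v"
proof (induction n arbitrary: F G v)
  case (Suc n)
  have "insn n (\<lambda>l. F (y # l)) w = insn n (\<lambda>l. G (y # l)) w" for y w
    by (intro Suc.IH Suc.prems) simp
  then show ?case by (simp split: list.splits)
qed simp

lemma insn_zero: "insn n (\<lambda>l. 0) v = 0"
  by (induction n arbitrary: v) (auto split: list.splits)

lemma insn_Nil: "insn n F [] = F (replicate n I)"
  by (induction n arbitrary: F) auto

lemma insn_short: "n < length v \<Longrightarrow> insn n F v = 0"
  by (induction n arbitrary: F v) (auto split: list.splits)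

lemma insn_full: "insn (length v) F v = F v"
  by (induction v arbitrary: F) (auto simp: insn_short)

lemma insn_len_bound: "len_bound N F \<Longrightarrow> N < n \<Longrightarrow> insn n F v = 0"
  using insn_cong[of n F "\<lambda>l. 0" v] by (simp add: len_bound_def insn_zero)

lemma ins_len_bound: "len_bound N F \<Longrightarrow> ins F v = (\<Sum>n\<le>N. insn n F v)"
  unfolding ins_def
  by (rule Sum_any.expand_superset) (auto dest: insn_len_bound simp: not_less[symmetric])

text \<open>The first letter of a target word is either an inserted \<open>I\<close> or the first
  letter of \<open>v\<close>; the additional term is the empty target word.\<close>

lemma ins_rec:
  assumes "len_bound N F"
  shows "ins F v = (if v = [] then F [] else 0) + ins (\<lambda>l. F (I # l)) v +
    (case v of [] \<Rightarrow> 0 | y # v' \<Rightarrow> ins (\<lambda>l. F (y # l)) v')"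
proof -
  \<comment> \<open>With the bound raised by one, splitting off the empty target leaves tails of
    length at most \<open>N\<close>, the bound available for both shifted functions.\<close>
  have "len_bound (Suc N) F" using len_bound_mono[OF assms] by simp
  then have "ins F v = insn 0 F v + (\<Sum>n\<le>N. insn (Suc n) F v)"
    by (simp only: ins_len_bound sum.atMost_Suc_shift)
  then show ?thesis
    by (cases v) (auto simp: ins_len_bound[OF len_bound_cons[OF assms]] sum.distrib)
qed

lemma ins_step:
  assumes "len_bound M F" "len_bound N G"
  shows "ins (\<lambda>l. c * F l + G l) v = c * ins F v + ins G v"
proof -
  have *: "len_bound (max M N) F" "len_bound (max M N) G" "len_bound (max M N) (\<lambda>l. c * F l + G l)"
    using assms by (auto simp: len_bound_def)
  show ?thesis
    by (simp add: ins_len_bound[OF *(1)] ins_len_bound[OF *(2)] ins_len_bound[OF *(3)]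
        insn_step sum.distrib sum_distrib_left)
qed

lemma ins_zero: "ins (\<lambda>l. 0) v = 0"
  by (simp add: ins_def insn_zero)

lemma ins_mult:
  assumes "len_bound N F"
  shows "ins (\<lambda>l. c * F l) v = c * ins F v"
proof -
  have "len_bound 0 (\<lambda>l. 0 :: 'k)" by (simp add: len_bound_def)
  from ins_step[OF assms this, of c v] show ?thesis by (simp add: ins_zero)
qed

lemma ins_sum:
  assumes "\<And>a. a \<in> S \<Longrightarrow> len_bound N (F a)"
  shows "ins (\<lambda>l. \<Sum>a\<in>S. F a l) v = (\<Sum>a\<in>S. ins (F a) v)"
  using assms
proof (induction S rule: infinite_finite_induct)
  case (insert a S)
  then have "len_bound N (F a)" "len_bound N (\<lambda>l. \<Sum>a\<in>S. F a l)"
    by (auto simp: len_bound_def)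
  from ins_step[OF this, of 1 v] insert show ?case by simp
qed (simp_all add: ins_zero)

lemma ins_fun_step:
  assumes "F \<in> tensor_algebra V" "G \<in> tensor_algebra V"
  shows "ins (fscale c F + G) = fscale c (ins F) + ins G"
proof (rule ext)
  fix v
  obtain M N where "len_bound M F" "len_bound N G"
    using assms by (metis len_bound_tensor_algebra)
  from ins_step[OF this, of c v] show "ins (fscale c F + G) v = (fscale c (ins F) + ins G) v"
    by (simp add: fun_apply plus_fun_def fscale_def)
qed

lemma ins_fun_zero: "ins 0 = 0"
  by (auto simp: fun_eq_iff zero_fun_def ins_zero)

text \<open>The letter \<open>f\<close> meets an inserted \<open>I\<close> or the first letter of
  the argument. Thus \<open>ins\<close> replaces \<open>f\<close> by f(I) 1 + f.\<close>

lemma ins_conc_single: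
  assumes "len_bound N H"
  shows "ins (conc (word [f] \<otimes> H)) = conc ((fscale (f I) (word []) + word [f]) \<otimes> ins H)"
proof (rule ext)
  fix v
  have "len_bound (Suc N) (conc (word [f] \<otimes> H))"
    using assms by (auto simp: len_bound_def conc_single_left split: list.splits)
  from ins_rec[OF this, of v] show
    "ins (conc (word [f] \<otimes> H)) v = conc ((fscale (f I) (word []) + word [f]) \<otimes> ins H) v"
    by (cases v) (simp_all add: ins_mult[OF assms] tensor_bilinear conc_step fun_apply conc_single_left)
qed

lemma ins_unit: "ins (word []) = word []"
proof (rule ext)
  fix v
  have "len_bound 0 (word [] :: 'v list \<Rightarrow> 'k)" by (simp add: len_bound_def word_def)
  from ins_rec[OF this, of v] show "ins (word []) v = word [] v"
    by (simp add: word_Nil_apply ins_zero split: list.splits)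
qed

lemma len_bound_word: "len_bound (length fs) (word fs)"
  by (simp add: len_bound_def word_def)

lemma ins_word_Cons:
  "ins (word (f # fs)) v = f I * ins (word fs) v + (case v of [] \<Rightarrow> 0 | y # v' \<Rightarrow> f y * ins (word fs) v')"
  unfolding word_Cons[of f fs] ins_conc_single[OF len_bound_word]
  by (simp add: tensor_bilinear conc_step fun_apply conc_single_left)

lemma ins_in_tensor_algebra:
  assumes "F \<in> tensor_algebra V"
  shows "ins F \<in> tensor_algebra V"
  using assms
proof (induction rule: tensor_algebra_induct)
  case zero
  then show ?case by (simp add: ins_fun_zero fs.subspace_0)
next
  case (step c vs F)
  have "ins (word vs) \<in> tensor_algebra V"
    using step(1)
  proof (induction vs)
    case Nil
    then show ?case by (simp add: ins_unit word_in_tensor_algebra)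
  next
    case (Cons f fs)
    then show ?case
      unfolding word_Cons[of f fs] ins_conc_single[OF len_bound_word]
      by (intro conc_in_tensor_algebra fs.subspace_add fs.subspace_scale tensor_algebra_subspace)
        (auto intro: word_in_tensor_algebra)
  qed
  with step show ?case
    by (simp add: ins_fun_step[of _ V] word_in_tensor_algebra fs.subspace_add fs.subspace_scale)
qed

text \<open>With \<open>ins_unit\<close> this makes \<open>ins\<close> an algebra endomorphism; it
  is the source of the compatibility of the pairing with deconcatenation.\<close>

lemma ins_conc:
  assumes "F \<in> tensor_algebra V" "G \<in> tensor_algebra V"
  shows "ins (conc (F \<otimes> G)) = conc (ins F \<otimes> ins G)"
  using assms(1)
proof (induction rule: tensor_algebra_induct)
  case zero
  then show ?case by (simp add: tensor_bilinear conc_zero ins_fun_zero)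
next
  case (step c vs F)
  have "ins (conc (word vs \<otimes> G)) = conc (ins (word vs) \<otimes> ins G)"
    using step(1)
  proof (induction vs)
    case Nil
    then show ?case by (simp add: ins_unit)
  next
    case (Cons f fs)
    have "conc (word fs \<otimes> G) \<in> tensor_algebra V"
      using Cons.prems assms(2) by (auto intro: conc_in_tensor_algebra word_in_tensor_algebra)
    then obtain N where N: "len_bound N (conc (word fs \<otimes> G))"
      by (metis len_bound_tensor_algebra)
    have "ins (conc (word (f # fs) \<otimes> G)) =
        conc ((fscale (f I) (word []) + word [f]) \<otimes> conc (ins (word fs) \<otimes> ins G))"
      using Cons by (simp add: word_Cons[of f fs] conc_single_assoc ins_conc_single[OF N])
    also have "\<dots> = conc (conc ((fscale (f I) (word []) + word [f]) \<otimes> ins (word fs)) \<otimes> ins G)"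
      by (simp add: tensor_bilinear conc_step conc_single_assoc)
    also have "\<dots> = conc (ins (word (f # fs)) \<otimes> ins G)"
      unfolding word_Cons[of f fs] ins_conc_single[OF len_bound_word] ..
    finally show ?case .
  qed
  with step show ?case
    by (simp add: tensor_bilinear conc_step ins_fun_step[of _ V] word_in_tensor_algebra
        conc_in_tensor_algebra assms(2))
qed

lemma ins_Nil: "len_bound N F \<Longrightarrow> ins F [] = dual_counit I F"
  by (simp add: ins_len_bound dual_counit_bound insn_Nil)

lemma lin_evl: "lin \<phi> \<Longrightarrow> evl scale v \<phi> = \<phi> v"
  by (simp add: evl_def)

text \<open>Vectors and linear forms exchange roles. Evaluating an element of
  \<open>T_operad\<close> at a list of forms is thus the same as evaluating a word of forms at
  vectors.\<close>

lemma oword_apply: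
  "(\<And>\<phi>. \<phi> \<in> set \<phi>s \<Longrightarrow> lin \<phi>) \<Longrightarrow> oword scale vs \<phi>s = word \<phi>s vs"
proof (induction vs arbitrary: \<phi>s)
  case Nil
  then show ?case by (auto simp: word_Nil_apply word_def)
next
  case (Cons v vs)
  show ?case
  proof (cases \<phi>s)
    case (Cons \<phi> \<phi>s')
    then show ?thesis using Cons.IH[of \<phi>s'] Cons.prems by (simp add: word_Cons_apply lin_evl)
  qed (simp add: word_Nil_apply word_Cons_apply)
qed

lemma oword_in_T_operad: "oword scale vs \<in> T_operad scale"
  by (rule word_in_tensor_algebra) auto

lemma T_operad_induct [consumes 1, case_names zero step]:
  assumes "X \<in> T_operad scale" "Q 0"
    and "\<And>c vs X. X \<in> T_operad scale \<Longrightarrow> Q X \<Longrightarrow> Q (fscale c (oword scale vs) + X)"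
  shows "Q X"
  using assms(1)
proof (induction rule: tensor_algebra_induct)
  case (step c us X)
  have "\<exists>vs. us = map (evl scale) vs"
    using step(1) by (induction us) (auto, metis list.simps(9))
  with step assms(3) show ?case by auto
qed (rule assms(2))

end

section \<open>Construction of the pairing\<close>

context fd_operad
begin

lemma oword_co: "oword scale vs (map co bs) = word (map co bs) vs"
  by (rule oword_apply) (auto simp: lin_co)

lemma T_operad_finite_coords:
  assumes "X \<in> T_operad scale"
  shows "finite {bs. X (map co bs) \<noteq> 0}"
  using assms
proof (induction rule: T_operad_induct)
  case (step c vs X)
  show ?case
    by (rule finite_subset[OF _ finite_UnI[OF step(2) word_co_finite[of vs]]])
      (auto simp: fun_apply oword_co)
qed (simp add: zero_fun_apply)

lemma tens_finite_coords:
  assumes "t \<in> tens A (T_operad scale)"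
  shows "finite {bs. \<exists>i. t (i, map co bs) \<noteq> 0}"
  using assms
proof (induction rule: tens_induct)
  case (step c a X y)
  show ?case
    by (rule finite_subset[OF _ finite_UnI[OF step(4) T_operad_finite_coords[OF step(2)]]])
      (auto simp: fun_apply)
qed (simp add: zero_fun_apply)

text \<open>The argument is a function and not a combination of words. Its right leg is therefore
  read off in the coordinates \<open>map co bs\<close>, and the left leg is evaluated by
  \<open>ins\<close> at the matching basis word.\<close>

definition pair :: "('v list \<times> ('v \<Rightarrow> 'k) list \<Rightarrow> 'k) \<Rightarrow> 'k" where
  "pair t = Sum_any (\<lambda>bs. ins (\<lambda>vs. t (vs, map co bs)) bs)"

lemma pair_finite:
  assumes "t \<in> tens A (T_operad scale)"
  shows "finite {bs. ins (\<lambda>vs. t (vs, map co bs)) bs \<noteq> 0}"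
proof (rule finite_subset[OF _ tens_finite_coords[OF assms]], clarify)
  fix bs assume "ins (\<lambda>vs. t (vs, map co bs)) bs \<noteq> 0"
  then have "(\<lambda>vs. t (vs, map co bs)) \<noteq> (\<lambda>vs. 0)" by (auto simp: ins_zero)
  then show "\<exists>i. t (i, map co bs) \<noteq> 0" by auto
qed

lemma Sum_any_step:
  fixes F G :: "'a \<Rightarrow> 'k"
  assumes "finite {a. F a \<noteq> 0}" "finite {a. G a \<noteq> 0}"
  shows "Sum_any (\<lambda>a. c * F a + G a) = c * Sum_any F + Sum_any G"
proof -
  let ?S = "{a. F a \<noteq> 0} \<union> {a. G a \<noteq> 0}"
  have fin: "finite ?S" using assms by simp
  show ?thesis
    by (subst (1 2 3) Sum_any.expand_superset[OF fin]) (auto simp: sum.distrib sum_distrib_left)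
qed

lemma pair_step:
  assumes s: "s \<in> tens (tensor_algebra V) (T_operad scale)"
    and t: "t \<in> tens (tensor_algebra V) (T_operad scale)"
  shows "pair (fscale c s + t) = c * pair s + pair t"
proof -
  have "ins (\<lambda>vs. (fscale c s + t) (vs, map co bs)) bs =
      c * ins (\<lambda>vs. s (vs, map co bs)) bs + ins (\<lambda>vs. t (vs, map co bs)) bs" for bs
  proof -
    have "(\<lambda>vs. s (vs, map co bs)) \<in> tensor_algebra V" "(\<lambda>vs. t (vs, map co bs)) \<in> tensor_algebra V"
      using tens_slice_left[OF s] tens_slice_left[OF t] by simp_all
    then show ?thesis
      using ins_fun_step[of "\<lambda>vs. s (vs, map co bs)" V "\<lambda>vs. t (vs, map co bs)" c]
      by (auto simp: fun_eq_iff fun_apply plus_fun_def fscale_def)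
  qed
  then show ?thesis
    unfolding pair_def by (simp only: Sum_any_step[OF pair_finite[OF s] pair_finite[OF t]])
qed

lemma pair_functional: "functional_on (tens (tensor_algebra V) (T_operad scale)) pair"
proof -
  have zero: "pair 0 = 0"
    by (simp add: pair_def zero_fun_apply ins_zero)
  have "pair (s + t) = pair s + pair t"
    if "s \<in> tens (tensor_algebra V) (T_operad scale)" "t \<in> tens (tensor_algebra V) (T_operad scale)" for s t
    using pair_step[OF that, of 1] by simp
  moreover have "pair (fscale c s) = c * pair s"
    if "s \<in> tens (tensor_algebra V) (T_operad scale)" for c s
    using pair_step[OF that fs.subspace_0[OF tens_subspace], of c] zero by simp
  ultimately show ?thesis by (simp add: linear_on_def)
qed

lemma pair_tensor:
  assumes "F \<in> tensor_algebra V"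
  shows "pair (F \<otimes> X) = Sum_any (\<lambda>bs. X (map co bs) * ins F bs)"
proof -
  obtain N where N: "len_bound N F" using assms len_bound_tensor_algebra by blast
  show ?thesis
    by (simp add: pair_def mult.commute[of "F _"] ins_mult[OF N])
qed

text \<open>Multilinearity of \<open>ins F\<close> reassembles the coordinates of \<open>vs\<close>,
  so the value on words is independent of the chosen basis.\<close>

lemma pair_oword:
  assumes "F \<in> T_dual scale P"
  shows "pair (F \<otimes> oword scale vs) = ins F vs"
  using mlin_Sum_any[OF mlin_T_dual[OF ins_in_tensor_algebra[OF assms]]]
  by (simp add: pair_tensor[OF assms] oword_co)

lemmas pair_step_TD = pair_step[where V = "graded_dual scale P"]
lemmas pair_functional_TD = pair_functional[where V = "graded_dual scale P"]

abbreviation (input) "TD \<equiv> T_dual scale P"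
abbreviation (input) "TO \<equiv> T_operad scale"

lemma pair_unit_left:
  assumes "X \<in> TO"
  shows "pair (word [] \<otimes> X) = deconc_counit X"
  using assms
proof (induction rule: T_operad_induct)
  case zero
  show ?case
    using linear_on_zero[OF pair_functional fs.subspace_0[OF tens_subspace]]
    by (simp add: tensor_bilinear deconc_counit_def) (simp add: zero_fun_apply)
next
  case (step c vs X)
  have "word [] \<otimes> oword scale vs \<in> tens TD TO" "word [] \<otimes> X \<in> tens TD TO"
    using step by (auto intro: tensor_in_tens word_Nil_in_T oword_in_T_operad)
  moreover have "oword scale vs [] = word [] vs"
    by (simp add: word_def)
  ultimately show ?case
    using step(2) by (simp add: tensor_bilinear pair_step_TD pair_oword word_Nil_in_T ins_unit deconc_counit_def)
      (simp add: fun_apply)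
qed

lemma pair_unit_right:
  assumes "F \<in> TD"
  shows "pair (F \<otimes> word []) = dual_counit I F"
proof -
  obtain N where "len_bound N F" using assms len_bound_tensor_algebra by blast
  then show ?thesis
    using pair_oword[OF assms, of "[]"] by (simp add: ins_Nil)
qed

lemma deconc_step: "deconc (fscale c X + Y) = fscale c (deconc X) + deconc Y"
  by (auto simp: deconc_def fun_eq_iff fun_apply)

lemma deconc_zero: "deconc 0 = 0"
  by (auto simp: deconc_def fun_eq_iff zero_fun_apply)

lemma deconc_oword:
  "deconc (oword scale vs) = (\<Sum>k\<le>length vs. oword scale (take k vs) \<otimes> oword scale (drop k vs))"
  by (simp add: deconc_word take_map drop_map)

lemma deconc_in_tens:
  assumes "X \<in> TO"
  shows "deconc X \<in> tens TO TO"
  using assms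
proof (induction rule: T_operad_induct)
  case (step c vs X)
  have "deconc (oword scale vs) \<in> tens TO TO"
    unfolding deconc_oword
    by (intro fs.subspace_sum tens_subspace tensor_in_tens oword_in_T_operad)
  with step show ?case
    by (simp add: deconc_step fs.subspace_add fs.subspace_scale)
qed (simp add: deconc_zero fs.subspace_0)

text \<open>Deconcatenation sums over the cuts of \<open>vs\<close>, and so does \<open>conc\<close>
  of the functions \<open>ins F\<close> and \<open>ins G\<close>. Hence the claim is
  \<open>ins_conc\<close> evaluated at \<open>vs\<close>.\<close>

lemma pair_conc:
  assumes "F \<in> TD" "G \<in> TD" "X \<in> TO"
  shows "pairing_square pair (F \<otimes> G) (deconc X) = pair (conc (F \<otimes> G) \<otimes> X)"
proof -
  have FG: "conc (F \<otimes> G) \<in> TD" using assms by (intro conc_in_tensor_algebra)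
  let ?Gx = "\<lambda>x. pair (G \<otimes> x)"
  have Gx: "functional_on TO ?Gx"
    by (rule functional_on_tensor[OF pair_functional tensor_algebra_subspace assms(2)])
  have sq: "pairing_square pair (F \<otimes> G) t = pair (F \<otimes> contract_right ?Gx t)" if "t \<in> tens TO TO" for t
    unfolding pairing_square_def
    by (subst pairing_matrix_tensor[OF pair_functional _ _ assms(2) that]) simp_all
  have cr: "contract_right ?Gx t \<in> TO" if "t \<in> tens TO TO" for t
    by (rule contract_right_in[OF Gx _ _ that]) simp_all
  have in_tens: "F \<otimes> x \<in> tens TD TO" "conc (F \<otimes> G) \<otimes> x \<in> tens TD TO" if "x \<in> TO" for x
    using that assms FG by (auto intro: tensor_in_tens)
  \<comment> \<open>\<open>deconc X\<close> is not elementary, so linearity in the right argument is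
    required. For the elementary left argument it follows by contracting with \<open>G\<close>
    first.\<close>
  have sq_step: "pairing_square pair (F \<otimes> G) (fscale c s + t) =
      c * pairing_square pair (F \<otimes> G) s + pairing_square pair (F \<otimes> G) t"
    if "s \<in> tens TO TO" "t \<in> tens TO TO" for c s t
    using that
    by (simp add: sq cr fs.subspace_add fs.subspace_scale contract_right_step[OF Gx]
        tensor_bilinear pair_step_TD in_tens)
  have sq_zero: "pairing_square pair (F \<otimes> G) 0 = 0"
    using sq_step[OF fs.subspace_0[OF tens_subspace] fs.subspace_0[OF tens_subspace], of 1] by simp
  have sum: "pairing_square pair (F \<otimes> G) (\<Sum>a\<in>S. g a) = (\<Sum>a\<in>S. pairing_square pair (F \<otimes> G) (g a))"
    if "\<And>a. a \<in> S \<Longrightarrow> g a \<in> tens TO TO" for S and g :: "nat \<Rightarrow> _"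
    using that
  proof (induction S rule: infinite_finite_induct)
    case (insert a S)
    then have "g a \<in> tens TO TO" "(\<Sum>a\<in>S. g a) \<in> tens TO TO"
      by (auto intro: fs.subspace_sum)
    from sq_step[OF this, of 1] insert show ?case by simp
  qed (simp_all add: sq_zero)
  show ?thesis
    using assms(3)
  proof (induction rule: T_operad_induct)
    case zero
    show ?case
      using linear_on_zero[OF pair_functional fs.subspace_0[OF tens_subspace]]
      by (simp add: deconc_zero sq_zero tensor_bilinear)
  next
    case (step c vs X)
    have "pairing_square pair (F \<otimes> G) (deconc (oword scale vs)) =
        (\<Sum>k\<le>length vs. pair (F \<otimes> oword scale (take k vs)) * pair (G \<otimes> oword scale (drop k vs)))"
      unfolding deconc_oword
      by (simp add: sum tensor_in_tens oword_in_T_operad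
          pairing_square_tensor[OF pair_functional assms(1,2) oword_in_T_operad oword_in_T_operad])
    also have "\<dots> = conc (ins F \<otimes> ins G) vs"
      by (simp add: pair_oword assms conc_def)
    also have "\<dots> = pair (conc (F \<otimes> G) \<otimes> oword scale vs)"
      by (simp add: pair_oword FG ins_conc[OF assms(1,2)])
    finally show ?case
      using step
      by (simp add: deconc_step sq_step deconc_in_tens oword_in_T_operad tensor_bilinear pair_step_TD in_tens)
  qed
qed

text \<open>
  The pairing is triangular with respect to the length of words: it vanishes on words \<open>F\<close>, \<open>X\<close> if
  \<open>X\<close> is the longer one, and no letters \<open>I\<close> are inserted if the lengths agree.
\<close>

lemma T_dual_eq_0I:
  assumes F: "F \<in> TD" and zero: "\<And>vs. ins F vs = 0"
  shows "F = 0"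
proof (rule ccontr)
  assume "F \<noteq> 0"
  then obtain l0 where l0: "F l0 \<noteq> 0" by (auto simp: fun_eq_iff zero_fun_apply)
  obtain N where N: "len_bound N F" using F len_bound_tensor_algebra by blast
  \<comment> \<open>The greatest length of a word at which \<open>F\<close> is nonzero. At such a
    word every insertion leads beyond this length, and only the value of \<open>F\<close> itself
    remains.\<close>
  define n where "n = (GREATEST n. \<exists>l. length l = n \<and> F l \<noteq> 0)"
  have bound: "\<forall>y. (\<exists>l. length l = y \<and> F l \<noteq> 0) \<longrightarrow> y \<le> N"
    using N by (auto simp: len_bound_def not_less[symmetric])
  have "\<exists>l. length l = n \<and> F l \<noteq> 0"
    unfolding n_def by (rule GreatestI_nat[of _ "length l0" N]) (use l0 bound in auto)
  then obtain l where l: "length l = n" "F l \<noteq> 0" by blast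
  have "len_bound n F"
    using Greatest_le_nat[of "\<lambda>n. \<exists>l. length l = n \<and> F l \<noteq> 0" _ N] bound
    by (force simp: len_bound_def n_def not_less[symmetric])
  then have "ins F l = (\<Sum>m\<le>n. insn m F l)" by (rule ins_len_bound)
  also have "\<dots> = (\<Sum>m\<in>{n}. insn m F l)"
    using l by (intro sum.mono_neutral_right) (auto simp: insn_short)
  also have "\<dots> = F l" using insn_full[of l F] l by simp
  finally show False using zero l by simp
qed

text \<open>For fixed forms the value of a word is multilinear in its letters. So each value of
  \<open>X\<close>, also at forms that are not coordinate forms, is a finite combination of the
  coordinates of \<open>X\<close>.\<close>

lemma T_operad_coords:
  assumes "X \<in> TO" "\<And>bs. X (map co bs) = 0"
  shows "X = 0"
proof (rule ext)
  fix \<phi>s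
  let ?M = "\<lambda>vs. oword scale vs \<phi>s"
  \<comment> \<open>\<open>X\<close> may be evaluated at functionals that are not linear;
    \<open>evl\<close> vanishes on them, so they can be replaced by the zero form.\<close>
  define \<psi>s where "\<psi>s = map (\<lambda>\<phi>. if lin \<phi> then \<phi> else (\<lambda>_. 0)) \<phi>s"
  have M: "?M vs = word \<psi>s vs" for vs
    unfolding \<psi>s_def
  proof (induction vs arbitrary: \<phi>s)
    case (Cons v vs)
    then show ?case by (cases \<phi>s) (simp_all add: word_Nil_apply word_Cons_apply evl_def)
  qed (auto simp: word_def)
  have "lin (\<lambda>_. 0)" by (rule linI) simp
  then have "mlin (word \<psi>s)" by (intro mlin_word) (auto simp: \<psi>s_def)
  then have mlin: "mlin ?M" by (simp add: M[abs_def])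
  have "X \<phi>s = Sum_any (\<lambda>bs. X (map co bs) * ?M bs)"
    using assms(1)
  proof (induction rule: T_operad_induct)
    case (step c vs X)
    have "finite {bs. oword scale vs (map co bs) * ?M bs \<noteq> 0}"
      by (rule finite_subset[OF _ word_co_finite[of vs]]) (auto simp: oword_co)
    moreover have "finite {bs. X (map co bs) * ?M bs \<noteq> 0}"
      by (rule finite_subset[OF _ T_operad_finite_coords[OF step(1)]]) auto
    ultimately have "Sum_any (\<lambda>bs. c * (oword scale vs (map co bs) * ?M bs) + X (map co bs) * ?M bs) =
        c * Sum_any (\<lambda>bs. oword scale vs (map co bs) * ?M bs) + Sum_any (\<lambda>bs. X (map co bs) * ?M bs)"
      by (rule Sum_any_step)
    also have "Sum_any (\<lambda>bs. oword scale vs (map co bs) * ?M bs) = ?M vs"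
      unfolding oword_co by (rule mlin_Sum_any[OF mlin])
    finally show ?case using step(2) by (simp add: fun_apply algebra_simps)
  qed (simp add: zero_fun_apply)
  then show "X \<phi>s = 0 \<phi>s" by (simp add: assms(2) zero_fun_apply)
qed

lemma word_co_basis_apply:
  "set bs \<subseteq> basis \<Longrightarrow> set cs \<subseteq> basis \<Longrightarrow> word (map co bs) cs = (if bs = cs then 1 else 0)"
proof (induction bs arbitrary: cs)
  case (Cons b bs)
  then show ?case by (cases cs) (auto simp: word_Nil_apply word_Cons_apply co_basis)
qed (auto simp: word_Nil_apply)

lemma T_operad_coords_basis:
  assumes "X \<in> TO" "X (map co bs) \<noteq> 0"
  shows "set bs \<subseteq> basis"
proof -
  have "X (map co bs) \<noteq> 0 \<longrightarrow> set bs \<subseteq> basis"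
    using assms(1)
  proof (induction rule: T_operad_induct)
    case (step c vs X)
    then show ?case using word_co_basis[of bs vs] by (auto simp: fun_apply oword_co)
  qed (simp add: zero_fun_apply)
  then show ?thesis using assms(2) by blast
qed

text \<open>Test \<open>X\<close> with the word dual to a shortest basis word \<open>bs\<close> in
  its support. A word \<open>cs\<close> longer than \<open>bs\<close> cannot contribute, a shorter
  one is absent, and at equal length duality leaves only \<open>bs\<close>.\<close>

lemma T_operad_eq_0I:
  assumes X: "X \<in> TO" and zero: "\<And>F. F \<in> TD \<Longrightarrow> pair (F \<otimes> X) = 0"
  shows "X = 0"
proof (rule T_operad_coords[OF X], rule ccontr)
  fix bs0
  let ?C = "\<lambda>bs. X (map co bs) \<noteq> 0"
  assume "?C bs0"
  then obtain bs where bs: "?C bs" and min: "\<And>cs. ?C cs \<Longrightarrow> length bs \<le> length cs"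
    using ex_has_least_nat[of ?C bs0 length] by blast
  have basis: "set bs \<subseteq> basis" by (rule T_operad_coords_basis[OF X bs])
  let ?F = "word (map co bs)"
  have F: "?F \<in> TD"
    unfolding T_dual_hdual by (intro word_in_tensor_algebra) (use basis co_hdual in auto)
  have "pair (?F \<otimes> X) = Sum_any (\<lambda>cs. X (map co cs) * ins ?F cs)"
    by (rule pair_tensor[OF F])
  also have "\<dots> = (\<Sum>cs\<in>{bs}. X (map co cs) * ins ?F cs)"
  proof (rule Sum_any.expand_superset, clarsimp+)
    fix cs assume c: "?C cs" "ins ?F cs \<noteq> 0"
    have ins: "ins ?F cs = insn (length bs) ?F cs"
    proof -
      have "insn m ?F cs = 0" if "m \<noteq> length bs" for m
        using insn_cong[of m ?F "\<lambda>_. 0" cs] that by (simp add: word_def insn_zero)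
      then show ?thesis
        unfolding ins_len_bound[OF len_bound_word] length_map
        by (subst sum.mono_neutral_right[of _ "{length bs}"]) auto
    qed
    then have "length cs \<le> length bs"
      using c insn_short[of "length bs" cs ?F] by force
    with min[OF c(1)] have "length cs = length bs" by simp
    then have "?F cs \<noteq> 0" using ins c insn_full[of cs ?F] by simp
    then show "cs = bs"
      using word_co_basis_apply[OF basis T_operad_coords_basis[OF X c(1)]] by (simp split: if_splits)
  qed
  also have "\<dots> = X (map co bs)"
  proof -
    have "ins ?F bs = (\<Sum>m\<le>length bs. insn m ?F bs)"
      using ins_len_bound[OF len_bound_word, of "map co bs" bs] by simp
    also have "\<dots> = (\<Sum>m\<in>{length bs}. insn m ?F bs)"
      by (intro sum.mono_neutral_right) (auto simp: insn_short)
    also have "\<dots> = 1"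
      using insn_full[of bs ?F] word_co_basis_apply[OF basis basis] by simp
    finally show ?thesis by simp
  qed
  finally show False using zero[OF F] bs by simp
qed

lemma pair_nondegenerate: "nondegenerate_pairing TD TO pair"
  unfolding nondegenerate_pairing_def
proof (intro conjI ballI impI)
  fix F assume F: "F \<in> TD" and "\<forall>X\<in>TO. pair (F \<otimes> X) = 0"
  then have "ins F vs = 0" for vs
    using pair_oword[OF F] oword_in_T_operad by metis
  then show "F = 0" by (rule T_dual_eq_0I[OF F])
next
  fix X assume "X \<in> TO" "\<forall>F\<in>TD. pair (F \<otimes> X) = 0"
  then show "X = 0" by (intro T_operad_eq_0I) auto
qed

text \<open>This function is a contraction of \<open>Delta F\<close>. Its membership in
  \<open>T_dual\<close> is needed before it can itself be paired with a word.\<close>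

lemma ins_cop_in:
  assumes "F \<in> TD"
  shows "(\<lambda>l. ins (cop F l) v) \<in> TD"
proof -
  have func: "functional_on TD (\<lambda>a. pair (a \<otimes> oword scale v))"
    using pair_functional[of "graded_dual scale P"] oword_in_T_operad
    by (auto simp: linear_on_def tensor_bilinear tensor_in_tens)
  have "contract_right (\<lambda>a. pair (a \<otimes> oword scale v)) (Delta F) \<in> TD"
    by (rule contract_right_in[OF func _ _ Delta_in_tens[OF assms]]) simp_all
  then show ?thesis
    by (simp add: contract_right_def Delta_apply pair_oword cop_slice[OF assms])
qed

lemma pairing_square_Delta:
  assumes "F \<in> TD"
  shows "pairing_square pair (Delta F) (oword scale xs \<otimes> oword scale v) = ins (\<lambda>l. ins (cop F l) v) xs"
proof -
  have "pairing_square pair (Delta F) (oword scale xs \<otimes> oword scale v) =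
      pair (contract_right (\<lambda>a. pair (a \<otimes> oword scale v)) (Delta F) \<otimes> oword scale xs)"
    by (rule pairing_square_tensor_right[OF pair_functional_TD])
      (simp_all add: Delta_in_tens[OF assms] oword_in_T_operad)
  also have "contract_right (\<lambda>a. pair (a \<otimes> oword scale v)) (Delta F) = (\<lambda>l. ins (cop F l) v)"
    by (simp add: contract_right_def Delta_apply pair_oword cop_slice[OF assms])
  finally show ?thesis by (simp add: pair_oword ins_cop_in[OF assms])
qed

end

section \<open>The product on the tensor algebra of the operad\<close>

definition factorizations :: "nat \<Rightarrow> 'a list \<Rightarrow> 'a list list set" where
  "factorizations k v = {ws. length ws = k \<and> concat ws = v}"

lemma finite_factorizations: "finite (factorizations k v)"
proof (rule finite_subset)
  let ?A = "{w. set w \<subseteq> set v \<and> length w \<le> length v}"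
  have "length w \<le> length (concat ws)" if "w \<in> set ws" for w and ws :: "'a list list"
    using that by (induction ws) auto
  then show "factorizations k v \<subseteq> {ws. set ws \<subseteq> ?A \<and> length ws = k}"
    by (auto simp: factorizations_def)
  show "finite {ws. set ws \<subseteq> ?A \<and> length ws = k}"
    by (intro finite_lists_length_eq finite_lists_length_le) simp
qed

lemma factorizations_1: "factorizations (Suc 0) v = {[v]}"
  by (auto simp: factorizations_def length_Suc_conv)

text \<open>If the first block is empty, the second is a prefix of \<open>v\<close>. Otherwise the
  first letter of \<open>v\<close> can be removed from the first block without changing the number
  of blocks.\<close>

lemma sum_factorizations:
  fixes g :: "'a list list \<Rightarrow> 'b::comm_monoid_add"
  shows "(\<Sum>ws\<in>factorizations (Suc (Suc k)) v. g ws) =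
    (\<Sum>j\<le>length v. \<Sum>ws\<in>factorizations k (drop j v). g ([] # take j v # ws)) +
    (case v of [] \<Rightarrow> 0
     | y # v' \<Rightarrow> \<Sum>ws\<in>factorizations (Suc (Suc k)) v'. g ((y # hd ws) # tl ws))"
proof -
  let ?W = "factorizations (Suc (Suc k))"
  let ?A = "{ws \<in> ?W v. hd ws = []}" and ?B = "{ws \<in> ?W v. hd ws \<noteq> []}"
  have "?W v = ?A \<union> ?B" by auto
  then have "(\<Sum>ws\<in>?W v. g ws) = (\<Sum>ws\<in>?A. g ws) + (\<Sum>ws\<in>?B. g ws)"
    by (metis (no_types, lifting) finite_factorizations finite_Un sum.union_disjoint disjoint_iff mem_Collect_eq)
  also have "(\<Sum>ws\<in>?A. g ws) =
      (\<Sum>(j, ws)\<in>(SIGMA j:{..length v}. factorizations k (drop j v)). g ([] # take j v # ws))"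
  proof (rule sum.reindex_bij_witness[of _ "\<lambda>(j, ws). [] # take j v # ws" "\<lambda>ws. (length (ws ! 1), drop 2 ws)"])
    fix ws assume "ws \<in> ?A"
    then obtain w ws' where "ws = [] # w # ws'" "v = w @ concat ws'" "length ws' = k"
      by (auto simp: factorizations_def length_Suc_conv)
    then show "(case (length (ws ! 1), drop 2 ws) of (j, ws) \<Rightarrow> [] # take j v # ws) = ws"
      and "(length (ws ! 1), drop 2 ws) \<in> (SIGMA j:{..length v}. factorizations k (drop j v))"
      and "(case (length (ws ! 1), drop 2 ws) of (j, ws) \<Rightarrow> g ([] # take j v # ws)) = g ws"
      by (auto simp: factorizations_def)
  qed (auto simp: factorizations_def)
  also have "\<dots> = (\<Sum>j\<le>length v. \<Sum>ws\<in>factorizations k (drop j v). g ([] # take j v # ws))"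
    by (rule sum.Sigma[symmetric]) (auto simp: finite_factorizations)
  also have "(\<Sum>ws\<in>?B. g ws) = (case v of [] \<Rightarrow> 0
     | y # v' \<Rightarrow> \<Sum>ws\<in>?W v'. g ((y # hd ws) # tl ws))"
  proof (cases v)
    case Nil
    then have "?B = {}" by (auto simp: factorizations_def length_Suc_conv)
    then show ?thesis unfolding \<open>?B = {}\<close> using Nil by simp
  next
    case (Cons y v')
    have "(\<Sum>ws\<in>?B. g ws) = (\<Sum>ws\<in>?W v'. g ((y # hd ws) # tl ws))"
    proof (rule sum.reindex_bij_witness[of _ "\<lambda>ws. (y # hd ws) # tl ws" "\<lambda>ws. tl (hd ws) # tl ws"])
      fix ws assume "ws \<in> ?B"
      then obtain w ws' where "ws = (y # w) # ws'" "v' = w @ concat ws'" "length ws' = Suc k"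
        using Cons by (cases ws; cases "hd ws") (auto simp: factorizations_def)
      then show "(y # hd (tl (hd ws) # tl ws)) # tl (tl (hd ws) # tl ws) = ws"
        and "tl (hd ws) # tl ws \<in> ?W v'"
        and "g ((y # hd (tl (hd ws) # tl ws)) # tl (tl (hd ws) # tl ws)) = g ws"
        by (auto simp: factorizations_def)
    next
      fix ws assume "ws \<in> ?W v'"
      then obtain w ws' where "ws = w # ws'" "v' = w @ concat ws'" "length ws' = Suc k"
        by (auto simp: factorizations_def length_Suc_conv)
      then show "tl (hd ((y # hd ws) # tl ws)) # tl ((y # hd ws) # tl ws) = ws"
        and "(y # hd ws) # tl ws \<in> ?B"
        using Cons by (auto simp: factorizations_def)
    qed
    then show ?thesis using Cons by simp
  qed
  finally show ?thesis .
qed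


context operad
begin

abbreviation br :: "'v \<Rightarrow> 'v list \<Rightarrow> 'v" where
  "br \<equiv> bracket P \<gamma> I"

text \<open>A set of positions either omits 0, so that the word starts with \<open>I\<close>, or
  contains 0, so that it starts with the first letter of \<open>ps\<close>. Shifting the remaining
  positions by one gives the recursion of \<open>insn\<close>.\<close>

lemma insn_subsets:
  "(\<Sum>S | S \<subseteq> {..<n} \<and> card S = length ps.
      G (map (\<lambda>i. if i \<in> S then ps ! card {j\<in>S. j < i} else I) [0..<n])) = insn n G ps"
proof (induction n arbitrary: G ps)
  case 0
  have "{S. S \<subseteq> {..<0::nat} \<and> card S = length ps} = (if ps = [] then {{}} else {})"
    by auto
  then show ?case by simp
next
  case (Suc n)
  let ?fill = "\<lambda>n ps S. map (\<lambda>i. if i \<in> S then ps ! card {j\<in>S. j < i} else I) [0..<n]"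
  let ?D = "\<lambda>n m. {S. S \<subseteq> {..<n::nat} \<and> card S = m}"
  \<comment> \<open>The two ways to extend a set of positions by a new first position. The rank of
    the old position i in the new set is unchanged under \<open>?f\<close> and grows by one under
    \<open>?g\<close>.\<close>
  let ?f = "\<lambda>T. Suc ` T" and ?g = "\<lambda>T. insert 0 (Suc ` T)"
  let ?A = "{S \<in> ?D (Suc n) (length ps). 0 \<notin> S}" and ?B = "{S \<in> ?D (Suc n) (length ps). 0 \<in> S}"
  have fin: "finite (?D m k)" for m k
    by (rule finite_subset[of _ "Pow {..<m}"]) auto
  have card_f: "card {j \<in> ?f T. j < Suc i} = card {j \<in> T. j < i}" for T i
  proof -
    have "{j \<in> ?f T. j < Suc i} = Suc ` {j \<in> T. j < i}" by auto
    then show ?thesis by (simp add: card_image)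
  qed
  have card_g: "card {j. (j = 0 \<or> j \<in> ?f T) \<and> j < Suc i} = Suc (card {j \<in> T. j < i})" for T i
  proof -
    have "{j. (j = 0 \<or> j \<in> ?f T) \<and> j < Suc i} = insert 0 (Suc ` {j \<in> T. j < i})" by auto
    moreover have "finite {j \<in> T. j < i}" by (rule finite_subset[of _ "{..<i}"]) auto
    ultimately show ?thesis by (simp add: card_image)
  qed
  have pred: "Suc ` ((\<lambda>i. i - 1) ` S) = S" if "0 \<notin> S" for S
    using that by (auto simp: image_iff) (metis Suc_pred bot_nat_0.not_eq_extremum)+
  have fill_f: "?fill (Suc n) ps (?f T) = I # ?fill n ps T" for T
    unfolding map_upt_Suc by (simp add: card_f inj_image_mem_iff)
  have fill_g: "?fill (Suc n) (p # ps') (?g T) = p # ?fill n ps' T" for T p ps'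
    unfolding map_upt_Suc by (auto simp: card_g)
  have D: "?D (Suc n) (length ps) = ?A \<union> ?B" by blast
  have "finite ?A" "finite ?B" "?A \<inter> ?B = {}"
    by (rule finite_subset[OF _ fin[of "Suc n" "length ps"]], blast)+ blast
  then have "(\<Sum>S\<in>?D (Suc n) (length ps). G (?fill (Suc n) ps S)) =
      (\<Sum>S\<in>?A. G (?fill (Suc n) ps S)) + (\<Sum>S\<in>?B. G (?fill (Suc n) ps S))"
    by (subst D) (rule sum.union_disjoint)
  also have "(\<Sum>S\<in>?A. G (?fill (Suc n) ps S)) = (\<Sum>T\<in>?D n (length ps). G (I # ?fill n ps T))"
  proof (rule sum.reindex_bij_witness[of _ ?f "\<lambda>S. (\<lambda>i. i - 1) ` S"])
    fix S assume S: "S \<in> ?A"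
    let ?T = "(\<lambda>i. i - 1) ` S"
    show f: "?f ?T = S" by (rule pred) (use S in simp)
    have "card ?T = length ps"
      using S card_image[of Suc ?T] f by simp
    moreover have "?T \<subseteq> {..<n}"
    proof
      fix i assume "i \<in> ?T"
      then obtain j where j: "j \<in> S" "i = j - 1" by blast
      then have "j \<noteq> 0" "j < Suc n" using S by (auto intro: ccontr)
      then show "i \<in> {..<n}" using j by auto
    qed
    ultimately show "?T \<in> ?D n (length ps)" by simp
    show "G (I # ?fill n ps ?T) = G (?fill (Suc n) ps S)"
      using fill_f[of ?T] unfolding f by simp
  next
    fix T assume T: "T \<in> ?D n (length ps)"
    then show "?f T \<in> ?A" by (auto simp: card_image)
    show "(\<lambda>i. i - 1) ` ?f T = T" by (auto simp: image_iff)
  qed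
  also have "\<dots> = insn n (\<lambda>l. G (I # l)) ps"
    by (rule Suc.IH)
  also have "(\<Sum>S\<in>?B. G (?fill (Suc n) ps S)) = (case ps of [] \<Rightarrow> 0 | p # ps' \<Rightarrow> insn n (\<lambda>l. G (p # l)) ps')"
  proof (cases ps)
    case Nil
    have "?B = {}" using Nil by (auto dest: finite_subset)
    then show ?thesis unfolding \<open>?B = {}\<close> using Nil by simp
  next
    case (Cons p ps')
    have "(\<Sum>S\<in>?B. G (?fill (Suc n) ps S)) = (\<Sum>T\<in>?D n (length ps'). G (p # ?fill n ps' T))"
    proof (rule sum.reindex_bij_witness[of _ ?g "\<lambda>S. (\<lambda>i. i - 1) ` (S - {0})"])
      fix S assume S: "S \<in> ?B"
      let ?T = "(\<lambda>i. i - 1) ` (S - {0})"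
      have f: "?f ?T = S - {0}" by (rule pred) simp
      then show g: "?g ?T = S" using S by auto
      have "finite S" using S by (auto intro: finite_subset)
      then have "card ?T = length ps'"
        using S Cons card_image[of Suc ?T] f by simp
      moreover have "?T \<subseteq> {..<n}" using S by auto
      ultimately show "?T \<in> ?D n (length ps')" by simp
      show "G (p # ?fill n ps' ?T) = G (?fill (Suc n) ps S)"
        using fill_g[of ?T p ps'] unfolding g Cons by simp
    next
      fix T assume T: "T \<in> ?D n (length ps')"
      then have "finite T" by (auto intro: finite_subset)
      with T show "?g T \<in> ?B" by (auto simp: Cons card_image)
      show "(\<lambda>i. i - 1) ` (?g T - {0}) = T" by (auto simp: image_iff)
    qed
    also have "\<dots> = insn n (\<lambda>l. G (p # l)) ps'"
      by (rule Suc.IH)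
    finally show ?thesis using Cons by simp
  qed
  finally show ?case by simp
qed

text \<open>Only the finitely many arities that occur in \<open>x\<close> accept arguments.\<close>

lemma len_bound_act:
  assumes "lin f"
  obtains N where "len_bound N (\<lambda>l. f (act x l))"
proof -
  obtain N where "\<forall>n\<in>{n. hcomp P n x \<noteq> 0}. n \<le> N"
    using hcomp_finite[of x] unfolding finite_nat_set_iff_bounded_le by blast
  then have "hcomp P (length l) x = 0" if "N < length l" for l :: "'v list"
    using that leD by blast
  then have "len_bound N (\<lambda>l. f (act x l))"
    by (simp add: len_bound_def act_def comp_zero_left lin_zero[OF assms])
  then show thesis by (rule that)
qed

text \<open>The component of \<open>x\<close> of arity n takes the words of length n, so the sums
  over arities and positions become one sum over insertions. Arities absent from \<open>x\<close>
  contribute nothing.\<close>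

lemma lin_br_eq:
  assumes "lin f"
  shows "f (br x ps) = ins (\<lambda>l. f (act x l)) ps"
proof -
  let ?fill = "\<lambda>n S. map (\<lambda>i. if i \<in> S then ps ! card {j\<in>S. j < i} else I) [0..<n]"
  have act: "\<gamma> (hcomp P n x) (?fill n S) = act x (?fill n S)" for n S
    by (simp add: act_def)
  have "f (br x ps) = (\<Sum>n | hcomp P n x \<noteq> 0. \<Sum>S | S \<subseteq> {..<n} \<and> card S = length ps. f (act x (?fill n S)))"
    unfolding bracket_def by (simp add: lin_sum[OF assms] act)
  also have "\<dots> = (\<Sum>n | hcomp P n x \<noteq> 0. insn n (\<lambda>l. f (act x l)) ps)"
    by (intro sum.cong refl insn_subsets)
  also have "\<dots> = ins (\<lambda>l. f (act x l)) ps"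
    unfolding ins_def
  proof (rule Sum_any.expand_superset[symmetric, OF hcomp_finite], clarify)
    fix n assume "insn n (\<lambda>l. f (act x l)) ps \<noteq> 0" "hcomp P n x = 0"
    moreover have "insn n (\<lambda>l. f (act x l)) ps = insn n (\<lambda>l. 0) ps"
      if "hcomp P n x = 0"
      using that by (intro insn_cong) (auto simp: act_def comp_zero_left lin_zero[OF assms])
    ultimately show False by (simp add: insn_zero)
  qed
  finally show ?thesis .
qed

lemma lin_br: "lin f \<Longrightarrow> lin (\<lambda>x. f (br x ps))"
proof (rule linI)
  fix c x y
  assume f: "lin f"
  obtain M N where "len_bound M (\<lambda>l. f (act x l))" "len_bound N (\<lambda>l. f (act y l))"
    using len_bound_act[OF f] by metis
  from ins_step[OF this, of c ps]
  show "f (br (scale c x + y) ps) = c * f (br x ps) + f (br y ps)"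
    by (simp add: lin_br_eq[OF f] act_step lin_step[OF f])
qed

lemma mlin_insn: "mlin F \<Longrightarrow> mlin (insn n F)"
proof (induction n arbitrary: F)
  case 0
  show ?case by (rule mlinI) simp
next
  case (Suc n)
  note IH = mlin_step[OF Suc.IH[OF mlin_cons[OF Suc.prems]]]
  show ?case
  proof (rule mlinI)
    fix us ws :: "'v list" and c x y
    show "insn (Suc n) F (us @ (scale c x + y) # ws) = c * insn (Suc n) F (us @ x # ws) + insn (Suc n) F (us @ y # ws)"
    proof (cases us)
      case Nil
      have "F ((scale c x + y) # l) = c * F (x # l) + F (y # l)" for l
        using mlin_step[OF Suc.prems, of "[]"] by simp
      then show ?thesis
        using IH[of _ "[]"] Nil by (simp add: insn_step distrib_left)
    next
      case (Cons u us')
      then show ?thesis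
        using IH[of _ us] by (simp add: IH distrib_left)
    qed
  qed
qed

lemma mlin_br: "lin f \<Longrightarrow> mlin (\<lambda>ps. f (br x ps))"
proof -
  assume f: "lin f"
  obtain N where "len_bound N (\<lambda>l. f (act x l))" using len_bound_act[OF f] .
  then show ?thesis
    by (simp add: lin_br_eq[OF f] ins_len_bound mlin_sum mlin_insn mlin_act[OF f])
qed

text \<open>The word that \<open>star_words\<close> forms from a factorization.\<close>

definition merge :: "'v list \<Rightarrow> 'v list list \<Rightarrow> 'v list" where
  "merge xs ws = concat (map (\<lambda>i. if even i then ws ! i else [br (xs ! (i div 2)) (ws ! i)]) [0..<length ws])"

text \<open>The extension of \<open>F\<close> by linearity, evaluated at the product of the words
  \<open>xs\<close> and \<open>v\<close>; this permits recursion with scalars instead of formal sums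
  of words.\<close>

definition star_sum :: "('v list \<Rightarrow> 'k) \<Rightarrow> 'v list \<Rightarrow> 'v list \<Rightarrow> 'k" where
  "star_sum F xs v = (\<Sum>ws\<in>factorizations (Suc (2 * length xs)) v. F (merge xs ws))"

lemma merge_Cons: "merge (x # xs) (w # w' # ws) = w @ br x w' # merge xs ws"
  unfolding merge_def list.size add_0_right add_Suc_right map_upt_Suc by (simp cong: if_cong)

lemma merge_single: "merge xs [w] = w"
  by (simp add: merge_def)

lemma star_sum_Nil: "star_sum F [] v = F v"
  by (simp add: star_sum_def factorizations_1 merge_single)

text \<open>The product word starts either with the bracket of \<open>x\<close> and a prefix of
  \<open>v\<close>, or with a letter of \<open>v\<close> that passes unchanged.\<close>

lemma star_sum_Cons:
  "star_sum F (x # xs) v =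
    (\<Sum>j\<le>length v. star_sum (\<lambda>l. F (br x (take j v) # l)) xs (drop j v)) +
    (case v of [] \<Rightarrow> 0 | y # v' \<Rightarrow> star_sum (\<lambda>l. F (y # l)) (x # xs) v')"
proof -
  have "merge (x # xs) ((y # hd ws) # tl ws) = y # merge (x # xs) ws"
    if ws: "ws \<in> factorizations (Suc (2 * length (x # xs))) v'" for y ws v'
  proof -
    obtain w w' ws' where "ws = w # w' # ws'"
      using ws by (auto simp: factorizations_def length_Suc_conv)
    then show ?thesis by (simp add: merge_Cons)
  qed
  then show ?thesis
    unfolding star_sum_def
    by (simp add: sum_factorizations[of _ "Suc (2 * length xs)" v] merge_Cons split: list.splits)
qed

lemma star_sum_step: "star_sum (\<lambda>l. c * F l + G l) xs v = c * star_sum F xs v + star_sum G xs v"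
  by (simp add: star_sum_def sum.distrib sum_distrib_left)

lemma star_sum_zero: "star_sum (\<lambda>l. 0) xs v = 0"
  by (simp add: star_sum_def)

lemma star_sum_mult: "star_sum (\<lambda>l. c * F l) xs v = c * star_sum F xs v"
  by (simp add: star_sum_def sum_distrib_left)

lemma star_sum_unit: "star_sum (word []) xs v = (if xs = [] \<and> v = [] then 1 else 0)"
proof (cases xs)
  case (Cons x xs')
  have "star_sum (\<lambda>l. word [] (y # l)) zs w = 0" for y zs w
    by (simp add: word_Nil_apply star_sum_zero)
  then show ?thesis using Cons by (simp add: star_sum_Cons split: list.splits)
qed (simp add: star_sum_Nil word_Nil_apply)

lemma star_sum_word_Cons:
  "star_sum (word (f # fs)) xs v = conc (word [f] \<otimes> star_sum (word fs) xs) v +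
    (case xs of [] \<Rightarrow> 0
     | x # xs' \<Rightarrow> \<Sum>j\<le>length v. f (br x (take j v)) * star_sum (word fs) xs' (drop j v))"
  by (cases xs) (auto simp: star_sum_Nil star_sum_Cons word_Cons_apply star_sum_mult conc_single_left
      split: list.splits)

text \<open>Multilinearity in \<open>v\<close>, and below in \<open>xs\<close>, is what removes the
  basis from the definition of \<open>star\<close>. A bracket may absorb several letters of
  \<open>v\<close>, but it is multilinear in them.\<close>

lemma mlin_star_sum_right:
  "(\<And>f. f \<in> set fs \<Longrightarrow> lin f) \<Longrightarrow> mlin (star_sum (word fs) xs)"
proof (induction fs arbitrary: xs)
  case Nil
  show ?case by (rule mlinI) (simp add: star_sum_unit)
next
  case (Cons f fs)
  have f: "lin f" and fs: "mlin (star_sum (word fs) zs)" for zs using Cons by auto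
  have eq: "star_sum (word (f # fs)) xs = (\<lambda>v. conc (word [f] \<otimes> star_sum (word fs) xs) v +
    (case xs of [] \<Rightarrow> 0 | x # xs' \<Rightarrow> conc ((\<lambda>w. f (br x w)) \<otimes> star_sum (word fs) xs') v))"
    by (rule ext) (simp add: star_sum_word_Cons conc_def[of "(\<lambda>w. f (br _ w)) \<otimes> _"] split: list.splits)
  show ?case
    unfolding eq
    by (cases xs) (auto intro!: mlin_add mlin_zero mlin_conc mlin_word_single f fs mlin_br)
qed

lemma mlin_star_sum_left:
  "(\<And>f. f \<in> set fs \<Longrightarrow> lin f) \<Longrightarrow> mlin (\<lambda>xs. star_sum (word fs) xs v)"
proof (induction fs arbitrary: v)
  case Nil
  show ?case by (rule mlinI) (simp add: star_sum_unit)
next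
  case (Cons f fs)
  have f: "lin f" and fs: "mlin (\<lambda>xs. star_sum (word fs) xs w)" for w using Cons by auto
  \<comment> \<open>For a fixed prefix of \<open>v\<close>, the value of \<open>f\<close> at the
    bracket is a linear form in the first letter of \<open>xs\<close>. So each summand is a
    concatenation with one letter.\<close>
  have eq: "(\<lambda>xs. star_sum (word (f # fs)) xs v) = (\<lambda>xs.
    (case v of [] \<Rightarrow> 0 | y # v' \<Rightarrow> f y * star_sum (word fs) xs v') +
    (\<Sum>j\<le>length v. conc (word [\<lambda>x. f (br x (take j v))] \<otimes> (\<lambda>xs. star_sum (word fs) xs (drop j v))) xs))"
    by (rule ext) (simp add: star_sum_word_Cons conc_single_left split: list.splits)
  have "mlin (\<lambda>xs. case v of [] \<Rightarrow> 0 | y # v' \<Rightarrow> f y * star_sum (word fs) xs v')"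
    by (cases v) (simp_all add: mlin_zero mlin_mult fs)
  then show ?case
    unfolding eq
    by (intro mlin_add mlin_sum mlin_conc mlin_word_single lin_br f fs)
qed

text \<open>The form \<open>f\<close> is fed with an inserted \<open>I\<close>, with a letter of
  \<open>v\<close>, or with a bracket. The first two possibilities form the \<open>conc\<close>
  term.\<close>

lemma star_sum_ins_Cons:
  "star_sum (ins (word (f # fs))) xs v =
    conc ((fscale (f I) (word []) + word [f]) \<otimes> star_sum (ins (word fs)) xs) v +
    (case xs of [] \<Rightarrow> 0
     | x # xs' \<Rightarrow> \<Sum>j\<le>length v. f (br x (take j v)) * star_sum (ins (word fs)) xs' (drop j v))"
proof (cases xs)
  case Nil
  then show ?thesis
    by (simp add: star_sum_Nil ins_word_Cons tensor_bilinear conc_step fun_apply conc_single_left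
        split: list.splits)
next
  case (Cons x xs')
  have eq: "star_sum (\<lambda>l. ins (word (f # fs)) (y # l)) zs w =
      f I * star_sum (\<lambda>l. ins (word fs) (y # l)) zs w + f y * star_sum (ins (word fs)) zs w" for y zs w
    by (simp add: ins_word_Cons star_sum_step star_sum_mult)
  show ?thesis
    using Cons
    by (cases v) (simp_all add: star_sum_Cons[of _ x xs'] eq tensor_bilinear conc_step fun_apply conc_single_left
        sum.distrib distrib_left sum_distrib_left del: sum.atMost_Suc)
qed

lemma star_words_apply:
  "star_words scale P \<gamma> I xs v \<phi>s =
    star_sum (word (map (\<lambda>\<phi>. if lin \<phi> then \<phi> else (\<lambda>_. 0)) \<phi>s)) xs v"
proof -
  have "oword scale vs \<phi>s = word (map (\<lambda>\<phi>. if lin \<phi> then \<phi> else (\<lambda>_. 0)) \<phi>s) vs" for vs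
  proof (induction vs arbitrary: \<phi>s)
    case (Cons v vs)
    then show ?case by (cases \<phi>s) (simp_all add: word_Nil_apply word_Cons_apply evl_def)
  qed (auto simp: word_def)
  then show ?thesis
    unfolding star_words_def star_sum_def merge_def factorizations_def sum_fun_apply
    by (simp only: Suc_eq_plus1)
qed

lemma star_words_oword:
  "star_words scale P \<gamma> I xs v = (\<Sum>ws\<in>factorizations (Suc (2 * length xs)) v. oword scale (merge xs ws))"
  unfolding star_words_def merge_def factorizations_def by (simp only: Suc_eq_plus1)

lemma star_words_in: "star_words scale P \<gamma> I xs v \<in> T_operad scale"
  unfolding star_words_oword
  by (intro fs.subspace_sum tensor_algebra_subspace oword_in_T_operad)

lemma mlin_star_words:
  "mlin (\<lambda>v. star_words scale P \<gamma> I xs v \<phi>s)" "mlin (\<lambda>xs. star_words scale P \<gamma> I xs v \<phi>s)"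
proof -
  have "lin (\<lambda>_. 0)" by (rule linI) simp
  then have f: "lin f" if "f \<in> set (map (\<lambda>\<phi>. if lin \<phi> then \<phi> else (\<lambda>_. 0)) \<phi>s)" for f
    using that by (auto split: if_splits)
  show "mlin (\<lambda>v. star_words scale P \<gamma> I xs v \<phi>s)"
    unfolding star_words_apply by (rule mlin_star_sum_right[OF f])
  show "mlin (\<lambda>xs. star_words scale P \<gamma> I xs v \<phi>s)"
    unfolding star_words_apply by (rule mlin_star_sum_left[OF f])
qed

end

section \<open>The product as a linear map, and its compatibility with the coproduct\<close>

context fd_operad
begin

text \<open>As for \<open>pair\<close>, both legs are expanded in coordinates, because
  \<open>t\<close> comes without a decomposition into words.\<close>

definition star :: "(('v \<Rightarrow> 'k) list \<times> ('v \<Rightarrow> 'k) list \<Rightarrow> 'k) \<Rightarrow> ('v \<Rightarrow> 'k) list \<Rightarrow> 'k" where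
  "star t = (\<Sum>(bs, cs) | t (map co bs, map co cs) \<noteq> 0.
     fscale (t (map co bs, map co cs)) (star_words scale P \<gamma> I bs cs))"

lemma star_superset:
  assumes "finite S" "{(bs, cs). t (map co bs, map co cs) \<noteq> 0} \<subseteq> S"
  shows "star t = (\<Sum>(bs, cs)\<in>S. fscale (t (map co bs, map co cs)) (star_words scale P \<gamma> I bs cs))"
  unfolding star_def
  by (rule sum.mono_neutral_left) (use assms in auto)

lemma tens_TO_finite_coords:
  assumes "t \<in> tens TO TO"
  shows "finite {(bs, cs). t (map co bs, map co cs) \<noteq> 0}"
  using assms
proof (induction rule: tens_induct)
  case (step c X Y t)
  have fin: "finite ({bs. X (map co bs) \<noteq> 0} \<times> {cs. Y (map co cs) \<noteq> 0})"
    using step by (intro finite_cartesian_product T_operad_finite_coords)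
  show ?case
    by (rule finite_subset[OF _ finite_UnI[OF step(4) fin]]) (auto simp: fun_apply)
qed (simp add: zero_fun_apply)

lemma star_step:
  assumes "s \<in> tens TO TO" "t \<in> tens TO TO"
  shows "star (fscale c s + t) = fscale c (star s) + star t"
proof -
  let ?S = "{(bs, cs). s (map co bs, map co cs) \<noteq> 0} \<union> {(bs, cs). t (map co bs, map co cs) \<noteq> 0}"
  have fin: "finite ?S" using assms by (simp add: tens_TO_finite_coords)
  have "star (fscale c s + t) = (\<Sum>(bs, cs)\<in>?S. fscale ((fscale c s + t) (map co bs, map co cs))
      (star_words scale P \<gamma> I bs cs))"
    by (rule star_superset[OF fin]) (auto simp: fun_apply)
  also have "\<dots> = (\<Sum>p\<in>?S. fscale c (case p of (bs, cs) \<Rightarrow> fscale (s (map co bs, map co cs)) (star_words scale P \<gamma> I bs cs))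
      + (case p of (bs, cs) \<Rightarrow> fscale (t (map co bs, map co cs)) (star_words scale P \<gamma> I bs cs)))"
    by (intro sum.cong refl) (auto simp: fun_apply fs.scale_left_distrib)
  also have "\<dots> = fscale c (star s) + star t"
    by (simp only: sum.distrib fs.scale_sum_right[symmetric]) (subst (1 2) star_superset[OF fin], auto)
  finally show ?thesis .
qed

lemma star_zero: "star 0 = 0"
  by (simp add: star_def zero_fun_apply)

lemma star_in:
  assumes "t \<in> tens TO TO"
  shows "star t \<in> TO"
  unfolding star_def
  by (intro fs.subspace_sum tensor_algebra_subspace) (auto intro!: fs.subspace_scale star_words_in)

lemma star_flinear: "flinear (tens TO TO) TO star"
proof -
  have "star (s + t) = star s + star t" if "s \<in> tens TO TO" "t \<in> tens TO TO" for s t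
    using star_step[OF that, of 1] by simp
  moreover have "star (fscale c s) = fscale c (star s)" if "s \<in> tens TO TO" for c s
    using star_step[OF that fs.subspace_0[OF tens_subspace], of c] by (simp add: star_zero)
  ultimately show ?thesis by (simp add: linear_on_def star_in)
qed

text \<open>The double coordinate sum collapses by multilinearity, first in the right word and then
  in the left one.\<close>

lemma star_oword: "star (oword scale xs \<otimes> oword scale v) = star_words scale P \<gamma> I xs v"
proof (rule ext)
  fix \<phi>s
  let ?M = "\<lambda>bs cs. star_words scale P \<gamma> I bs cs \<phi>s"
  let ?S = "{bs. word (map co bs) xs \<noteq> 0}" and ?T = "{cs. word (map co cs) v \<noteq> 0}"
  have S: "finite ?S" and T: "finite ?T" by (rule word_co_finite)+
  have "star (oword scale xs \<otimes> oword scale v) =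
      (\<Sum>(bs, cs)\<in>?S \<times> ?T. fscale ((oword scale xs \<otimes> oword scale v) (map co bs, map co cs))
        (star_words scale P \<gamma> I bs cs))"
    using S T by (intro star_superset) (auto simp: oword_co)
  then have "star (oword scale xs \<otimes> oword scale v) \<phi>s =
      (\<Sum>(bs, cs)\<in>?S \<times> ?T. word (map co bs) xs * (word (map co cs) v * ?M bs cs))"
    by (simp add: sum_fun_apply case_prod_unfold fscale_apply oword_co mult.assoc)
  also have "\<dots> = (\<Sum>bs\<in>?S. word (map co bs) xs * (\<Sum>cs\<in>?T. word (map co cs) v * ?M bs cs))"
    by (simp add: sum.cartesian_product[symmetric] sum_distrib_left)
  also have "\<dots> = (\<Sum>bs\<in>?S. word (map co bs) xs * ?M bs v)"
  proof (intro sum.cong refl arg_cong2[of _ _ _ _ "(*)"])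
    fix bs
    have "(\<Sum>cs\<in>?T. word (map co cs) v * ?M bs cs) = Sum_any (\<lambda>cs. word (map co cs) v * ?M bs cs)"
      by (rule Sum_any.expand_superset[OF T, symmetric]) auto
    then show "(\<Sum>cs\<in>?T. word (map co cs) v * ?M bs cs) = ?M bs v"
      by (simp only: mlin_Sum_any[OF mlin_star_words(1)])
  qed
  also have "\<dots> = Sum_any (\<lambda>bs. word (map co bs) xs * ?M bs v)"
    by (rule Sum_any.expand_superset[OF S, symmetric]) auto
  also have "\<dots> = ?M xs v"
    by (rule mlin_Sum_any[OF mlin_star_words(2)])
  finally show "star (oword scale xs \<otimes> oword scale v) \<phi>s = ?M xs v" .
qed

lemma star_is_star: "is_star scale P \<gamma> I star"
  by (simp add: is_star_def star_flinear star_oword)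

lemma cop_len_bound: "len_bound (length fs) (\<lambda>l. ins (cop (word fs) l) v)"
proof -
  have "cop (word fs) l = (\<lambda>_. 0)" if "length fs < length l" for l
  proof (rule ext)
    fix m
    have "cop (word fs) l m = cop (\<lambda>_. 0) l m"
      using that by (intro cop_cong) (simp add: word_def)
    then show "cop (word fs) l m = 0" by (simp add: cop_zero)
  qed
  then show ?thesis by (simp add: len_bound_def ins_zero)
qed

text \<open>The insertion recursion in the left leg offers \<open>f\<close> an inserted
  \<open>I\<close> or the first letter \<open>x\<close> of \<open>xs\<close>. Insertion in the right
  leg turns the composition with that letter into a bracket.\<close>

lemma ins_cop_Cons:
  assumes f: "f \<in> hdual" and fs: "set fs \<subseteq> hdual"
  shows "ins (\<lambda>l. ins (cop (word (f # fs)) l) v) xs =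
    conc ((fscale (f I) (word []) + word [f]) \<otimes> (\<lambda>w. ins (\<lambda>l. ins (cop (word fs) l) w) xs)) v +
    (case xs of [] \<Rightarrow> 0
     | x # xs' \<Rightarrow> \<Sum>j\<le>length v. f (br x (take j v)) * ins (\<lambda>l. ins (cop (word fs) l) (drop j v)) xs')"
proof -
  have f_lin: "lin f" using f by (rule hdual_lin)
  have words: "word [f] \<in> TD" "word fs \<in> TD"
    unfolding T_dual_hdual using f fs by (auto intro: word_in_tensor_algebra)
  let ?D = "\<lambda>l. ins (cop (word (f # fs)) l) v"
  \<comment> \<open>The extra term of the insertion recursion drops out: the coproduct of a nonempty
    word has no part with empty left factor.\<close>
  have D_Nil: "?D [] = 0"
  proof -
    have "cop (word (f # fs)) [] = (\<lambda>_. 0)" by (rule ext) (rule cop_word_Cons_Nil)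
    then show ?thesis by (simp only: ins_zero)
  qed
  have D_Cons: "?D (x # l) = (\<Sum>j\<le>length v. f (br x (take j v)) * ins (cop (word fs) l) (drop j v))" for x l
  proof -
    \<comment> \<open>Recognizing this function as a slice of the coproduct of \<open>f\<close>
      places it in \<open>T_dual\<close>, so that \<open>ins_conc\<close> applies.\<close>
    have "(\<lambda>m. f (act x m)) = cop (word [f]) [x]" by (rule ext) (simp add: cop_word_single del: cop.simps)
    then have "(\<lambda>m. f (act x m)) \<in> TD" using cop_slice[OF words(1)] by simp
    then have "ins (conc ((\<lambda>m. f (act x m)) \<otimes> cop (word fs) l)) = conc (ins (\<lambda>m. f (act x m)) \<otimes> ins (cop (word fs) l))"
      by (rule ins_conc) (rule cop_slice[OF words(2)])
    moreover have "cop (word (f # fs)) (x # l) = conc ((\<lambda>m. f (act x m)) \<otimes> cop (word fs) l)"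
      by (rule ext) (rule cop_single_Cons)
    ultimately show ?thesis
      by (simp add: conc_def lin_br_eq[OF f_lin])
  qed
  have ins_D: "ins (\<lambda>l. ?D (x # l)) zs =
      (\<Sum>j\<le>length v. f (br x (take j v)) * ins (\<lambda>l. ins (cop (word fs) l) (drop j v)) zs)" for x zs
  proof -
    have "len_bound (length fs) (\<lambda>l. c * ins (cop (word fs) l) w)" for c w
      using cop_len_bound[of fs w] by (simp add: len_bound_def)
    then show ?thesis
      unfolding D_Cons by (subst ins_sum[of _ "length fs"]) (simp_all add: ins_mult[OF cop_len_bound])
  qed
  \<comment> \<open>The bracket of the unit is \<open>I\<close> on the empty word, y on the word y
    and zero on longer words. So an \<open>I\<close> inserted in the left leg accounts for the whole
    \<open>conc\<close> term.\<close>
  have br_I: "f (br I w) = (fscale (f I) (word []) + word [f]) w" for w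
  proof -
    have "(\<lambda>l. f (act I l)) = word [f]"
      by (rule ext) (auto simp: act_unit word_single_apply lin_zero[OF f_lin] split: list.splits)
    moreover have "ins (word [f]) = fscale (f I) (word []) + word [f]"
      using ins_conc_single[OF len_bound_word, of f "[]"] by (simp add: ins_unit)
    ultimately show ?thesis by (simp add: lin_br_eq[OF f_lin])
  qed
  have "len_bound (length (f # fs)) ?D" by (rule cop_len_bound)
  from ins_rec[OF this, of xs] show ?thesis
    unfolding D_Nil ins_D br_I by (simp add: conc_def)
qed

lemma star_sum_ins:
  "set fs \<subseteq> hdual \<Longrightarrow> ins (\<lambda>l. ins (cop (word fs) l) v) xs = star_sum (ins (word fs)) xs v"
proof (induction fs arbitrary: xs v)
  case Nil
  have "ins (cop (word []) l) v = word [] v * word [] l" for l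
  proof -
    have "cop (word []) l = (if l = [] then word [] else (\<lambda>_. 0))"
      by (rule ext) (simp add: cop_word_Nil word_Nil_apply)
    then show ?thesis by (simp add: ins_unit ins_zero word_Nil_apply)
  qed
  then show ?case
    by (simp add: ins_mult[OF len_bound_word] ins_unit star_sum_unit) (simp add: word_Nil_apply)
next
  case (Cons f fs)
  then have IH: "ins (\<lambda>l. ins (cop (word fs) l) w) zs = star_sum (ins (word fs)) zs w" for w zs by simp
  show ?case
    using Cons.prems by (simp add: ins_cop_Cons star_sum_ins_Cons IH split: list.splits)
qed

lemma pair_star_oword:
  assumes "F \<in> TD"
  shows "pairing_square pair (Delta F) (oword scale xs \<otimes> oword scale v) =
    pair (F \<otimes> star_words scale P \<gamma> I xs v)"
  using assms unfolding T_dual_hdual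
proof (induction rule: tensor_algebra_induct)
  case zero
  have "cop 0 l = (\<lambda>_. 0)" for l
    by (rule ext) (simp add: zero_fun_def cop_zero)
  then have "pairing_square pair (Delta 0) (oword scale xs \<otimes> oword scale v) = 0"
    by (simp only: pairing_square_Delta[OF fs.subspace_0[OF tensor_algebra_subspace]] ins_zero)
  then show ?case
    using linear_on_zero[OF pair_functional_TD fs.subspace_0[OF tens_subspace]]
    by (simp add: tensor_bilinear)
next
  case (step c fs F)
  have F: "F \<in> TD" and w: "word fs \<in> TD"
    using step by (auto simp: T_dual_hdual intro: word_in_tensor_algebra)
  have "pairing_square pair (Delta (word fs)) (oword scale xs \<otimes> oword scale v) = star_sum (ins (word fs)) xs v"
    by (simp add: pairing_square_Delta[OF w] star_sum_ins step(1))
  \<comment> \<open>Both sides are the sum of \<open>ins (word fs)\<close> over the words of the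
    product.\<close>
  also have "\<dots> = pair (word fs \<otimes> star_words scale P \<gamma> I xs v)"
    unfolding star_words_oword star_sum_def
    by (subst linear_on_sum[OF functional_on_tensor[OF pair_functional_TD tensor_algebra_subspace w] tensor_algebra_subspace])
      (simp_all add: oword_in_T_operad pair_oword[OF w])
  finally have *: "pairing_square pair (Delta (word fs)) (oword scale xs \<otimes> oword scale v) =
      pair (word fs \<otimes> star_words scale P \<gamma> I xs v)" .
  have "pairing_square pair (Delta (fscale c (word fs) + F)) (oword scale xs \<otimes> oword scale v) =
      c * pairing_square pair (Delta (word fs)) (oword scale xs \<otimes> oword scale v) +
      pairing_square pair (Delta F) (oword scale xs \<otimes> oword scale v)"
    unfolding Delta_step
    by (rule pairing_square_step_left[OF pair_functional_TD])
      (simp_all add: Delta_in_tens F w tensor_in_tens oword_in_T_operad)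
  also have "\<dots> = pair ((fscale c (word fs) + F) \<otimes> star_words scale P \<gamma> I xs v)"
    unfolding * step(3) tensor_bilinear
    by (rule pair_step_TD[symmetric]) (auto intro!: tensor_in_tens star_words_in F w)
  finally show ?case .
qed

lemma pair_star:
  assumes F: "F \<in> TD" and "X \<in> TO" "Y \<in> TO"
  shows "pairing_square pair (Delta F) (X \<otimes> Y) = pair (F \<otimes> star (X \<otimes> Y))"
proof -
  \<comment> \<open>Contracting with \<open>Y\<close> first leaves a pairing with \<open>X\<close>.
    Linearity in \<open>X\<close> is then that of \<open>pair\<close>, and linearity in
    \<open>Y\<close> holds slice by slice, because every \<open>cop F i\<close> lies in
    \<open>T_dual\<close>.\<close>
  define C where "C = (\<lambda>Y. contract_right (\<lambda>a. pair (a \<otimes> Y)) (Delta F))"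
  have func: "functional_on TD (\<lambda>a. pair (a \<otimes> Y))" if "Y \<in> TO" for Y
    using pair_functional_TD that
    by (auto simp: linear_on_def tensor_bilinear tensor_in_tens)
  have C_in: "C Y \<in> TD" if "Y \<in> TO" for Y
    unfolding C_def by (rule contract_right_in[OF func[OF that] _ _ Delta_in_tens[OF F]]) simp_all
  have sq: "pairing_square pair (Delta F) (X \<otimes> Y) = pair (C Y \<otimes> X)" if "X \<in> TO" "Y \<in> TO" for X Y
    unfolding C_def
    by (rule pairing_square_tensor_right[OF pair_functional_TD]) (use that in \<open>simp_all add: Delta_in_tens[OF F]\<close>)
  have C_step: "C (fscale c Y + Y') = fscale c (C Y) + C Y'" if "Y \<in> TO" "Y' \<in> TO" for c Y Y'
  proof (rule ext)
    fix i
    have "cop F i \<in> TD" by (rule cop_slice[OF F])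
    then have "pair (cop F i \<otimes> (fscale c Y + Y')) = c * pair (cop F i \<otimes> Y) + pair (cop F i \<otimes> Y')"
      using that unfolding tensor_bilinear by (intro pair_step_TD tensor_in_tens)
    then show "C (fscale c Y + Y') i = (fscale c (C Y) + C Y') i"
      by (simp add: C_def contract_right_def Delta_apply fun_apply)
  qed
  have C_zero: "C 0 = 0"
    using C_step[OF fs.subspace_0 fs.subspace_0, of 1] by simp
  have pair0: "pair 0 = 0"
    using linear_on_zero[OF pair_functional_TD fs.subspace_0[OF tens_subspace]] .
  have pair_F_step: "pair (F \<otimes> (fscale c Z + Z')) = c * pair (F \<otimes> Z) + pair (F \<otimes> Z')"
    if "Z \<in> TO" "Z' \<in> TO" for c Z Z'
    unfolding tensor_bilinear by (rule pair_step_TD) (auto intro!: tensor_in_tens F that)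
  have Y: "pair (C Y \<otimes> oword scale xs) = pair (F \<otimes> star (oword scale xs \<otimes> Y))" for xs
    using assms(3)
  proof (induction rule: T_operad_induct)
    case zero
    show ?case by (simp add: C_zero tensor_bilinear star_zero pair0)
  next
    case (step c v Y)
    have o: "oword scale v \<in> TO" "oword scale xs \<in> TO" by (rule oword_in_T_operad)+
    have "pair (C (oword scale v) \<otimes> oword scale xs) = pair (F \<otimes> star (oword scale xs \<otimes> oword scale v))"
      using pair_star_oword[OF F] sq[OF o(2,1)] by (simp add: star_oword)
    moreover have "pair (C (fscale c (oword scale v) + Y) \<otimes> oword scale xs) =
        c * pair (C (oword scale v) \<otimes> oword scale xs) + pair (C Y \<otimes> oword scale xs)"
      unfolding C_step[OF o(1) step(1)] tensor_bilinear
      by (rule pair_step_TD) (auto intro!: tensor_in_tens C_in o step(1))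
    moreover have "star (oword scale xs \<otimes> (fscale c (oword scale v) + Y)) =
        fscale c (star (oword scale xs \<otimes> oword scale v)) + star (oword scale xs \<otimes> Y)"
      using step(1) by (simp add: tensor_bilinear star_step tensor_in_tens o)
    ultimately show ?case
      using step by (simp only: pair_F_step star_in tensor_in_tens o)
  qed
  have "pair (C Y \<otimes> X) = pair (F \<otimes> star (X \<otimes> Y))"
    using assms(2)
  proof (induction rule: T_operad_induct)
    case zero
    show ?case by (simp add: tensor_bilinear star_zero pair0)
  next
    case (step c xs X)
    have o: "oword scale xs \<in> TO" by (rule oword_in_T_operad)
    have "pair (C Y \<otimes> (fscale c (oword scale xs) + X)) =
        c * pair (C Y \<otimes> oword scale xs) + pair (C Y \<otimes> X)"
      unfolding tensor_bilinear
      by (rule pair_step_TD) (auto intro!: tensor_in_tens C_in o step(1) assms(3))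
    moreover have "star ((fscale c (oword scale xs) + X) \<otimes> Y) =
        fscale c (star (oword scale xs \<otimes> Y)) + star (X \<otimes> Y)"
      using step(1) assms(3) by (simp add: tensor_bilinear star_step tensor_in_tens o)
    ultimately show ?case
      using step assms(3) by (simp only: pair_F_step star_in tensor_in_tens o Y)
  qed
  then show ?thesis by (simp add: sq assms)
qed

lemma hopf: "hopf_pairing TD conc (word []) Delta (dual_counit I) TO star (word []) deconc deconc_counit pair"
  unfolding hopf_pairing_def
  using pair_functional_TD pair_unit_left pair_conc pair_unit_right pair_star by blast

end

theorem proposition47:
  fixes scale :: "'k::field_char_0 \<Rightarrow> 'v::ab_group_add \<Rightarrow> 'v"
    and P :: "nat \<Rightarrow> 'v set"
    and \<gamma> :: "'v \<Rightarrow> 'v list \<Rightarrow> 'v"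
    and I :: 'v
  assumes "operad scale P \<gamma> I"
    and "P 0 = {0}"
    and "\<And>n. finite_dimensional scale (P n)"
  shows "\<exists>\<Delta>. extends_delta scale P \<gamma> \<Delta> \<and>
    (\<forall>\<Delta>'. extends_delta scale P \<gamma> \<Delta>' \<longrightarrow> (\<forall>F\<in>T_dual scale P. \<Delta>' F = \<Delta> F)) \<and>
    bialgebra_on (T_dual scale P) conc (word []) \<Delta> (dual_counit I) \<and>
    (\<exists>G. graded_bialgebra_on (T_dual scale P) conc (word []) \<Delta> (dual_counit I) G \<and>
         (\<forall>n\<ge>1. \<forall>f\<in>dual_component scale P n. word [f] \<in> G (n - 1))) \<and>
    (\<exists>star p. is_star scale P \<gamma> I star \<and>
       nondegenerate_pairing (T_dual scale P) (T_operad scale) p \<and>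
       hopf_pairing (T_dual scale P) conc (word []) \<Delta> (dual_counit I)
                    (T_operad scale) star (word []) deconc deconc_counit p)"
proof -
  interpret fd_operad scale P \<gamma> I
    using assms by (simp add: fd_operad_def fd_operad_axioms_def)
  have "word [f] \<in> dual_part (n - 1)" if "n \<ge> 1" "f \<in> dual_component scale P n" for n f
    using hword.Cons[OF _ hword.Nil, of f "n - 1"] that by (intro word_in_dual_part) simp
  then show ?thesis
    using Delta_extends extends_delta_unique bialgebra graded_bialgebra star_is_star pair_nondegenerate hopf
    by (intro exI[of _ Delta] conjI exI[of _ dual_part] exI[of _ star] exI[of _ pair]) blast+
qed

end
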